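(* Let $K$ be a perfect field and let $\mathcal{A}$ be a commutative domain of essentially finite type over $K$, with Jacobian ideal $\mathfrak{a}_r$. The following statements are equivalent: (1) The algebra $\mathcal{D}(\mathcal{A})$ of differential operators on $\mathcal{A}$ is a simple algebra. (2) For every maximal ideal $\mathfrak{m}$ of $\mathcal{A}$ that contains $\mathfrak{a}_r$, the localization $\mathcal{D}(\mathcal{A})_{\mathfrak{m}}=(\mathcal{A}\setminus\mathfrak{m})^{-1}\mathcal{D}(\mathcal{A})$ is a simple algebra.
   Context: For a commutative $K$-algebra $R$, the ring of differential operators is $\mathcal{D}(R)=\bigcup_{i\geq 0}\mathcal{D}(R)_i\subseteq \mathrm{End}_K(R)$, where $\mathcal{D}(R)_{-1}=0$ and $\mathcal{D}(R)_i=\{u\in\mathrm{End}_K(R)\mid ru-ur\in\mathcal{D}(R)_{i-1}\text{ for all } r\in R\}$ (here $R$ is identified with multiplication operators, so $\mathcal{D}(R)_0=R$). An algebra of essentially finite type is a localization of a finitely generated commutative algebra. Write $\mathcal{A}=S^{-1}A$ with $A=P_n/I$, $P_n=K[x_1,\dots,x_n]$, $I=\sum_{i=1}^m P_nf_i$ a prime ideal, $S$ a multiplicative subset of $A$. Let $\overline{J}=(\overline{\partial f_i/\partial x_j})\in M_{m,n}(A)$ be the Jacobi matrix and $r$ its rank over the field of fractions of $A$. The Jacobian ideal $\mathfrak{a}_r$ of $\mathcal{A}$ is the ideal generated by all $r\times r$ minors of $\overline{J}$. The set $\mathcal{A}\setminus\mathfrak{m}$ is an Ore set of the domain $\mathcal{D}(\mathcal{A})$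 and $\mathcal{D}(\mathcal{A})_\mathfrak{m}$ denotes the corresponding localization. *)

theory Defs
  imports "HOL-Algebra.Ideal" "HOL-Library.Poly_Mapping" "Jordan_Normal_Form.Determinant"
begin

definition perfect_field :: "'k::field itself \<Rightarrow> bool" where
  "perfect_field _ \<longleftrightarrow> CHAR('k) = 0 \<or> (\<forall>a::'k. \<exists>b. b ^ CHAR('k) = a)"

definition type_ring :: "'a::comm_ring_1 ring" where
  "type_ring = \<lparr>carrier = UNIV, Group.monoid.mult = (*), Group.monoid.one = 1, zero = 0, add = (+)\<rparr>"

type_synonym 'k mpoly = "(nat \<Rightarrow>\<^sub>0 nat) \<Rightarrow>\<^sub>0 'k"

definition polys_in :: "nat \<Rightarrow> 'k::comm_ring_1 mpoly set" where
  "polys_in n = {p. \<forall>\<alpha>\<in>Poly_Mapping.keys p. Poly_Mapping.keys \<alpha> \<subseteq> {..<n}}"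

definition evalp :: "('k::comm_ring_1 \<Rightarrow> 'a::comm_ring_1) \<Rightarrow> (nat \<Rightarrow> 'a) \<Rightarrow> 'k mpoly \<Rightarrow> 'a" where
  "evalp \<iota> x p = (\<Sum>\<alpha>\<in>Poly_Mapping.keys p. \<iota> (Poly_Mapping.lookup p \<alpha>) * (\<Prod>i\<in>Poly_Mapping.keys \<alpha>. x i ^ Poly_Mapping.lookup \<alpha> i))"

definition pderiv_mp :: "nat \<Rightarrow> 'k::comm_ring_1 mpoly \<Rightarrow> 'k mpoly" where
  "pderiv_mp j p = (\<Sum>\<alpha>\<in>Poly_Mapping.keys p. Poly_Mapping.single (\<alpha> - Poly_Mapping.single j 1)
                                   (of_nat (Poly_Mapping.lookup \<alpha> j) * Poly_Mapping.lookup p \<alpha>))"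

definition minors :: "nat \<Rightarrow> nat \<Rightarrow> (nat \<Rightarrow> nat \<Rightarrow> 'a::comm_ring_1) \<Rightarrow> nat \<Rightarrow> 'a set" where
  "minors m n M k = {det (mat k k (\<lambda>(a, b). M (\<rho> a) (\<gamma> b))) | \<rho> \<gamma>.
      strict_mono_on {..<k} \<rho> \<and> \<rho> ` {..<k} \<subseteq> {..<m} \<and>
      strict_mono_on {..<k} \<gamma> \<and> \<gamma> ` {..<k} \<subseteq> {..<n}}"

text \<open>Rank over the field of fractions of a domain = largest size of a nonvanishing minor.\<close>
definition mat_rank :: "nat \<Rightarrow> nat \<Rightarrow> (nat \<Rightarrow> nat \<Rightarrow> 'a::idom) \<Rightarrow> nat" where
  "mat_rank m n M = Max {k. \<exists>d\<in>minors m n M k. d \<noteq> 0}"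

definition jacobi :: "('k::comm_ring_1 \<Rightarrow> 'a::comm_ring_1) \<Rightarrow> (nat \<Rightarrow> 'a) \<Rightarrow> (nat \<Rightarrow> 'k mpoly)
    \<Rightarrow> nat \<Rightarrow> nat \<Rightarrow> 'a" where
  "jacobi \<iota> x f i j = evalp \<iota> x (pderiv_mp j (f i))"

definition jacobian_ideal :: "('k::comm_ring_1 \<Rightarrow> 'a::idom) \<Rightarrow> nat \<Rightarrow> (nat \<Rightarrow> 'a)
    \<Rightarrow> nat \<Rightarrow> (nat \<Rightarrow> 'k mpoly) \<Rightarrow> 'a set" where
  "jacobian_ideal \<iota> n x m f =
     genideal type_ring (minors m n (jacobi \<iota> x f) (mat_rank m n (jacobi \<iota> x f)))"

text \<open>The algebra (type 'a, structure map iota) is S^{-1} A where A = P_n / I is the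
  image of P_n under x_i |-> x i, S a multiplicative subset of A, and I = ker is generated
  by f_0,...,f_(m-1).\<close>
definition ess_fin_presentation ::
  "('k::field \<Rightarrow> 'a::idom) \<Rightarrow> nat \<Rightarrow> (nat \<Rightarrow> 'a) \<Rightarrow> nat \<Rightarrow> (nat \<Rightarrow> 'k mpoly) \<Rightarrow> bool" where
  "ess_fin_presentation \<iota> n x m f \<longleftrightarrow>
     (\<exists>S. S \<subseteq> evalp \<iota> x ` polys_in n \<and> 1 \<in> S \<and> (\<forall>s\<in>S. \<forall>t\<in>S. s * t \<in> S) \<and>
          (\<forall>s\<in>S. \<exists>t. s * t = 1) \<and>
          (\<forall>y. \<exists>a\<in>evalp \<iota> x ` polys_in n. \<exists>s\<in>S. y * s = a)) \<and>
     (\<forall>i<m. f i \<in> polys_in n) \<and>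
     {p \<in> polys_in n. evalp \<iota> x p = 0} =
       {\<Sum>i<m. g i * f i | g. \<forall>i<m. g i \<in> polys_in n}"

definition klinear :: "('k \<Rightarrow> 'a::comm_ring_1) \<Rightarrow> ('a \<Rightarrow> 'a) \<Rightarrow> bool" where
  "klinear \<iota> u \<longleftrightarrow> (\<forall>y z. u (y + z) = u y + u z) \<and> (\<forall>c y. u (\<iota> c * y) = \<iota> c * u y)"

text \<open>diffop_lev i = D(R)_(i-1); so diffop_lev 0 = D(R)_(-1) = 0.\<close>
fun diffop_lev :: "('k \<Rightarrow> 'a::comm_ring_1) \<Rightarrow> nat \<Rightarrow> ('a \<Rightarrow> 'a) set" where
  "diffop_lev \<iota> 0 = {\<lambda>y. 0}"
| "diffop_lev \<iota> (Suc i) =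
     {u. klinear \<iota> u \<and> (\<forall>r. (\<lambda>y. r * u y - u (r * y)) \<in> diffop_lev \<iota> i)}"

definition diffops :: "('k \<Rightarrow> 'a::comm_ring_1) \<Rightarrow> ('a \<Rightarrow> 'a) set" where
  "diffops \<iota> = (\<Union>i. diffop_lev \<iota> i)"

definition diffop_ring :: "('k \<Rightarrow> 'a::comm_ring_1) \<Rightarrow> ('a \<Rightarrow> 'a) ring" where
  "diffop_ring \<iota> = \<lparr>carrier = diffops \<iota>, Group.monoid.mult = (\<circ>), Group.monoid.one = id, zero = (\<lambda>y. 0),
                     add = (\<lambda>u v y. u y + v y)\<rparr>"

definition simple_ring :: "('b, 'm) ring_scheme \<Rightarrow> bool" where
  "simple_ring R \<longleftrightarrow> ring R \<and> \<zero>\<^bsub>R\<^esub> \<noteq> \<one>\<^bsub>R\<^esub> \<and>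
     (\<forall>I. ideal I R \<longrightarrow> I = {\<zero>\<^bsub>R\<^esub>} \<or> I = carrier R)"

section \<open>Ore localization S^{-1} R (left fractions s^{-1} r)\<close>

definition ore_rel :: "('b, 'm) ring_scheme \<Rightarrow> 'b set \<Rightarrow> (('b \<times> 'b) \<times> ('b \<times> 'b)) set" where
  "ore_rel R S = {((s1, u1), (s2, u2)). s1 \<in> S \<and> s2 \<in> S \<and> u1 \<in> carrier R \<and> u2 \<in> carrier R \<and>
      (\<exists>a\<in>carrier R. \<exists>b\<in>carrier R. a \<otimes>\<^bsub>R\<^esub> s1 = b \<otimes>\<^bsub>R\<^esub> s2 \<and> a \<otimes>\<^bsub>R\<^esub> s1 \<in> S \<and>
                                      a \<otimes>\<^bsub>R\<^esub> u1 = b \<otimes>\<^bsub>R\<^esub> u2)}"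

definition ore_class :: "('b, 'm) ring_scheme \<Rightarrow> 'b set \<Rightarrow> 'b \<Rightarrow> 'b \<Rightarrow> ('b \<times> 'b) set" where
  "ore_class R S s u = ore_rel R S `` {(s, u)}"

definition ore_localization :: "('b, 'm) ring_scheme \<Rightarrow> 'b set \<Rightarrow> ('b \<times> 'b) set ring" where
  "ore_localization R S =
    \<lparr>carrier = (S \<times> carrier R) // ore_rel R S,
     Group.monoid.mult = (\<lambda>X Y. SOME Z. \<exists>s1 u1 s2 u2 s' r'. (s1, u1) \<in> X \<and> (s2, u2) \<in> Y \<and>
              s' \<in> S \<and> r' \<in> carrier R \<and> s' \<otimes>\<^bsub>R\<^esub> u1 = r' \<otimes>\<^bsub>R\<^esub> s2 \<and>
              Z = ore_class R S (s' \<otimes>\<^bsub>R\<^esub> s1) (r' \<otimes>\<^bsub>R\<^esub> u2)),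
     Group.monoid.one = ore_class R S \<one>\<^bsub>R\<^esub> \<one>\<^bsub>R\<^esub>,
     zero = ore_class R S \<one>\<^bsub>R\<^esub> \<zero>\<^bsub>R\<^esub>,
     add = (\<lambda>X Y. SOME Z. \<exists>s1 u1 s2 u2 a b. (s1, u1) \<in> X \<and> (s2, u2) \<in> Y \<and>
              a \<in> carrier R \<and> b \<in> carrier R \<and> a \<otimes>\<^bsub>R\<^esub> s1 = b \<otimes>\<^bsub>R\<^esub> s2 \<and> a \<otimes>\<^bsub>R\<^esub> s1 \<in> S \<and>
              Z = ore_class R S (a \<otimes>\<^bsub>R\<^esub> s1) (a \<otimes>\<^bsub>R\<^esub> u1 \<oplus>\<^bsub>R\<^esub> b \<otimes>\<^bsub>R\<^esub> u2))\<rparr>"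

definition diffop_loc :: "('k \<Rightarrow> 'a::comm_ring_1) \<Rightarrow> 'a set \<Rightarrow> (('a \<Rightarrow> 'a) \<times> ('a \<Rightarrow> 'a)) set ring" where
  "diffop_loc \<iota> M = ore_localization (diffop_ring \<iota>) {(\<lambda>y. s * y) | s. s \<notin> M}"

end

theory Submission
  imports Defs "HOL-Algebra.QuotRing" "HOL-Algebra.Subrings" "HOL-Computational_Algebra.Fraction_Field"
    "HOL-Computational_Algebra.Formal_Power_Series" "Jordan_Normal_Form.Char_Poly"
begin

text \<open>
  Localization preserves simplicity, so one implication is formal. For the other, a nonzero ideal
  \<open>I\<close> of the ring of differential operators meets the algebra \<open>A\<close> in a nonzero ideal \<open>b\<close>, and it
  suffices that \<open>b\<close> lies in no maximal ideal \<open>M\<close>. If \<open>M\<close> contains the Jacobian ideal, this is the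
  simplicity of the localization. Otherwise some minor \<open>\<Delta>\<close> of maximal size is not in \<open>M\<close>, and it
  suffices that \<open>b\<close> contains a power of \<open>\<Delta>\<close>. The coordinates \<open>y\<close> outside the columns of \<open>\<Delta>\<close> are
  algebraically independent (here the base field has to be perfect), and \<open>A\<close> is algebraic over
  \<open>K[y]\<close>, so \<open>b\<close> contains a nonzero polynomial in \<open>y\<close>. For each \<open>y\<^sub>j\<close>, Newton iteration gives a ring
  homomorphism from \<open>A\<close> to \<open>A[[z]]\<close> that moves \<open>y\<^sub>j\<close> to \<open>y\<^sub>j + \<Delta>\<^sup>2 z\<close>. Its coefficients are
  differential operators (in any characteristic), so \<open>b\<close> is stable under them; up to powers of
  \<open>\<Delta>\<close> they extract leading coefficients, which reduces the polynomial to a nonzero constant.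
\<close>

text \<open>The localization at M consists of classes of pairs, with operations picked by choice, so
  even its ring axioms need an argument. A differential operator on a domain extends uniquely to the
  field of fractions, where elements outside M become invertible; the localization is therefore
  computed as a subring of the operators on that field.

  The r equations selected by the minor need not generate the kernel of evaluation. They do so only
  after multiplication by a polynomial with nonzero value in A. This suffices: A[[z]] is a domain,
  so a homomorphism to it that kills these r equations and has evaluation as its constant term kills
  the whole kernel. One family of coefficient relations over K[y] yields both the multiplier and,
  through a characteristic polynomial, the algebraicity of A over K[y].

  The square in the shift has two sources. One factor \<Delta> is pulled out of the whole increment;
  the other makes the linear contribution of y_j divisible by \<Delta>, as the adjugate does for the
  bound coordinates. Then the Newton equation carries a common factor that can be split off,
  although \<Delta> need not be invertible.\<close>

lemma mem_congI: "u \<in> A \<Longrightarrow> (\<And>y. v y = u y) \<Longrightarrow> v \<in> A"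
  by (metis ext)

section \<open>The order filtration and the ring of differential operators\<close>

lemma klinear_add: "klinear \<iota> u \<Longrightarrow> u (y + z) = u y + u z"
  by (simp add: klinear_def)

lemma klinear_zero:
  fixes u :: "'a::comm_ring_1 \<Rightarrow> 'a"
  assumes "klinear \<iota> u" shows "u 0 = 0"
  using klinear_add[OF assms, of 0 0] by simp

lemma klinear_diff:
  fixes u :: "'a::comm_ring_1 \<Rightarrow> 'a"
  assumes "klinear \<iota> u" shows "u (y - z) = u y - u z"
  using klinear_add[OF assms, of "y - z" z] by simp

lemma diffop_lev_klinear: "u \<in> diffop_lev \<iota> i \<Longrightarrow> klinear \<iota> u"
  by (cases i) (auto simp: klinear_def)

lemma diffop_lev_zero: "(\<lambda>y. 0) \<in> diffop_lev \<iota> i"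
  by (induction i) (auto simp: klinear_def)

lemma diffop_lev_mono_Suc: "u \<in> diffop_lev \<iota> i \<Longrightarrow> u \<in> diffop_lev \<iota> (Suc i)"
proof (induction i arbitrary: u)
  case 0 then show ?case using diffop_lev_zero[of \<iota> "Suc 0"] by simp
next
  case (Suc i)
  have "klinear \<iota> u" "\<And>r. (\<lambda>y. r * u y - u (r * y)) \<in> diffop_lev \<iota> (Suc i)"
    using Suc.prems Suc.IH by auto
  then show ?case by (subst diffop_lev.simps(2)) blast
qed

lemma diffop_lev_mono: "u \<in> diffop_lev \<iota> i \<Longrightarrow> i \<le> j \<Longrightarrow> u \<in> diffop_lev \<iota> j"
  by (induction j rule: nat_induct) (auto simp: le_Suc_eq intro: diffop_lev_mono_Suc simp del: diffop_lev.simps)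

lemma diffop_lev_add:
  "u \<in> diffop_lev \<iota> i \<Longrightarrow> v \<in> diffop_lev \<iota> i \<Longrightarrow> (\<lambda>y. u y + v y) \<in> diffop_lev \<iota> i"
proof (induction i arbitrary: u v)
  case (Suc i)
  have "(\<lambda>y. r * (u y + v y) - (u (r * y) + v (r * y))) \<in> diffop_lev \<iota> i" for r
    by (rule mem_congI[OF Suc.IH[of "\<lambda>y. r * u y - u (r * y)" "\<lambda>y. r * v y - v (r * y)"]])
      (use Suc.prems in simp, use Suc.prems in simp, simp add: algebra_simps)
  moreover have "klinear \<iota> (\<lambda>y. u y + v y)"
    using Suc.prems by (simp add: klinear_def algebra_simps)
  ultimately show ?case by simp
qed simp

lemma diffop_lev_lmult: "u \<in> diffop_lev \<iota> i \<Longrightarrow> (\<lambda>y. a * u y) \<in> diffop_lev \<iota> i"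
proof (induction i arbitrary: u)
  case (Suc i)
  have "(\<lambda>y. r * (a * u y) - a * u (r * y)) \<in> diffop_lev \<iota> i" for r
    by (rule mem_congI[OF Suc.IH[of "\<lambda>y. r * u y - u (r * y)"]])
      (use Suc.prems in simp, simp add: algebra_simps)
  moreover have "klinear \<iota> (\<lambda>y. a * u y)"
    using Suc.prems by (simp add: klinear_def algebra_simps)
  ultimately show ?case by simp
qed simp

lemma diffop_lev_rmult: "u \<in> diffop_lev \<iota> i \<Longrightarrow> (\<lambda>y. u (a * y)) \<in> diffop_lev \<iota> i"
proof (induction i arbitrary: u)
  case (Suc i)
  have "(\<lambda>y. r * u (a * y) - u (a * (r * y))) \<in> diffop_lev \<iota> i" for r
    by (rule mem_congI[OF Suc.IH[of "\<lambda>y. r * u y - u (r * y)"]])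
      (use Suc.prems in simp, simp add: algebra_simps)
  moreover have "klinear \<iota> (\<lambda>y. u (a * y))"
    using Suc.prems by (auto simp: klinear_def distrib_left) (metis mult.left_commute)
  ultimately show ?case by simp
qed simp

lemma diffop_lev_uminus: "u \<in> diffop_lev \<iota> i \<Longrightarrow> (\<lambda>y. - u y) \<in> diffop_lev \<iota> i"
  using diffop_lev_lmult[of u \<iota> i "-1"] by simp

lemma diffop_lev_diff:
  "u \<in> diffop_lev \<iota> i \<Longrightarrow> v \<in> diffop_lev \<iota> i \<Longrightarrow> (\<lambda>y. u y - v y) \<in> diffop_lev \<iota> i"
  using diffop_lev_add[OF _ diffop_lev_uminus, of u \<iota> i v] by simp

lemma diffop_lev_sum:
  "(\<And>k. k \<in> A \<Longrightarrow> u k \<in> diffop_lev \<iota> i) \<Longrightarrow> (\<lambda>y. \<Sum>k\<in>A. u k y) \<in> diffop_lev \<iota> i"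
  by (induction A rule: infinite_finite_induct) (auto intro: diffop_lev_zero diffop_lev_add)

text \<open>The commutator is a derivation, [r, u v] = [r, u] v + u [r, v], and both summands have a
  smaller sum of indices. As levels are shifted by one against orders, i + j exceeds the expected i
  + j - 1; the weaker bound avoids truncated subtraction.\<close>

lemma diffop_lev_comp:
  "u \<in> diffop_lev \<iota> i \<Longrightarrow> v \<in> diffop_lev \<iota> j \<Longrightarrow> (\<lambda>y. u (v y)) \<in> diffop_lev \<iota> (i + j)"
proof (induction "i + j" arbitrary: i j u v rule: less_induct)
  case less
  note lin = diffop_lev_klinear[OF less.prems(1)] diffop_lev_klinear[OF less.prems(2)]
  show ?case
  proof (cases i)
    case 0 then show ?thesis using less.prems(1) diffop_lev_zero by simp
  next
    case i: (Suc i')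
    show ?thesis
    proof (cases j)
      case 0 then show ?thesis using less.prems(2) diffop_lev_zero[of \<iota> "Suc i'"] klinear_zero[OF lin(1)] i
        by simp
    next
      case j: (Suc j')
      have "(\<lambda>y. r * u (v y) - u (v (r * y))) \<in> diffop_lev \<iota> (i' + j)" for r
      proof -
        have "(\<lambda>y. r * u y - u (r * y)) \<in> diffop_lev \<iota> i'" "(\<lambda>y. r * v y - v (r * y)) \<in> diffop_lev \<iota> j'"
          using less.prems i j by auto
        from less.hyps[OF _ this(1) less.prems(2)] less.hyps[OF _ less.prems(1) this(2)] i j
        have "(\<lambda>y. r * u (v y) - u (r * v y)) \<in> diffop_lev \<iota> (i' + j)"
          "(\<lambda>y. u (r * v y - v (r * y))) \<in> diffop_lev \<iota> (i' + j)" by auto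
        from diffop_lev_add[OF this] show ?thesis by (simp add: klinear_diff[OF lin(1)])
      qed
      moreover have "klinear \<iota> (\<lambda>y. u (v y))" using lin by (simp add: klinear_def)
      ultimately show ?thesis using i by simp
    qed
  qed
qed

lemma diffop_lev_mult_op:
  fixes a :: "'a::comm_ring_1"
  shows "(\<lambda>y. a * y) \<in> diffop_lev \<iota> (Suc 0)"
  by (auto simp: klinear_def algebra_simps)

lemma diffops_iff: "u \<in> diffops \<iota> \<longleftrightarrow> (\<exists>i. u \<in> diffop_lev \<iota> i)"
  by (auto simp: diffops_def)

lemma diffops_klinear: "u \<in> diffops \<iota> \<Longrightarrow> klinear \<iota> u"
  by (auto simp: diffops_iff intro: diffop_lev_klinear)

lemma diffops_add:
  assumes "u \<in> diffops \<iota>" "v \<in> diffops \<iota>" shows "(\<lambda>y. u y + v y) \<in> diffops \<iota>"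
proof -
  obtain i j where "u \<in> diffop_lev \<iota> i" "v \<in> diffop_lev \<iota> j" using assms by (auto simp: diffops_iff)
  then have "u \<in> diffop_lev \<iota> (max i j)" "v \<in> diffop_lev \<iota> (max i j)" by (auto intro: diffop_lev_mono)
  then show ?thesis using diffop_lev_add diffops_iff by blast
qed

lemma diffops_comp: "u \<in> diffops \<iota> \<Longrightarrow> v \<in> diffops \<iota> \<Longrightarrow> u \<circ> v \<in> diffops \<iota>"
  unfolding diffops_iff o_def using diffop_lev_comp by blast

lemma diffops_mult_op: "(\<lambda>y. a * y) \<in> diffops \<iota>"
  using diffop_lev_mult_op diffops_iff by blast

lemma diffops_zero: "(\<lambda>y. 0) \<in> diffops \<iota>"
  using diffop_lev_zero diffops_iff by blast

lemma diffops_uminus: "u \<in> diffops \<iota> \<Longrightarrow> (\<lambda>y. - u y) \<in> diffops \<iota>"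
  using diffop_lev_uminus diffops_iff by blast

lemma diffops_id: "id \<in> diffops \<iota>"
  using diffops_mult_op[of 1 \<iota>] by (simp add: id_def)

lemma diffop_ring_simps [simp]:
  "carrier (diffop_ring \<iota>) = diffops \<iota>" "\<one>\<^bsub>diffop_ring \<iota>\<^esub> = id" "\<zero>\<^bsub>diffop_ring \<iota>\<^esub> = (\<lambda>y. 0)"
  "u \<otimes>\<^bsub>diffop_ring \<iota>\<^esub> v = u \<circ> v" "u \<oplus>\<^bsub>diffop_ring \<iota>\<^esub> v = (\<lambda>y. u y + v y)"
  by (simp_all add: diffop_ring_def)

lemma ring_diffop_ring: "ring (diffop_ring \<iota>)"
proof (rule ringI)
  show "abelian_group (diffop_ring \<iota>)"
  proof (rule abelian_groupI)
    fix u assume "u \<in> carrier (diffop_ring \<iota>)"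
    then show "\<exists>v\<in>carrier (diffop_ring \<iota>). v \<oplus>\<^bsub>diffop_ring \<iota>\<^esub> u = \<zero>\<^bsub>diffop_ring \<iota>\<^esub>"
      by (intro bexI[of _ "\<lambda>y. - u y"]) (auto simp: diffops_uminus)
  qed (auto simp: diffops_add diffops_zero algebra_simps)
  show "Group.monoid (diffop_ring \<iota>)"
    by (rule monoidI) (auto simp: diffops_comp diffops_id o_assoc)
qed (auto simp: klinear_add[OF diffops_klinear] o_def)

section \<open>Two-sided ideals of the ring of differential operators\<close>

context
  fixes I and \<iota> :: "'k \<Rightarrow> 'a::comm_ring_1"
  assumes I: "ideal I (diffop_ring \<iota>)"
begin

lemma diffop_ideal_subset: "u \<in> I \<Longrightarrow> u \<in> diffops \<iota>"
  using ideal.Icarr[OF I] by simp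

lemma diffop_ideal_add: "u \<in> I \<Longrightarrow> v \<in> I \<Longrightarrow> (\<lambda>y. u y + v y) \<in> I"
  using additive_subgroup.a_closed[OF ideal.axioms(1)[OF I]] by simp

lemma diffop_ideal_zero: "(\<lambda>y. 0) \<in> I"
  using additive_subgroup.zero_closed[OF ideal.axioms(1)[OF I]] by simp

lemma diffop_ideal_lcomp: "u \<in> I \<Longrightarrow> v \<in> diffops \<iota> \<Longrightarrow> (\<lambda>y. v (u y)) \<in> I"
  using ideal.I_l_closed[OF I, of u v] by (simp add: o_def)

lemma diffop_ideal_rcomp: "u \<in> I \<Longrightarrow> v \<in> diffops \<iota> \<Longrightarrow> (\<lambda>y. u (v y)) \<in> I"
  using ideal.I_r_closed[OF I, of u v] by (simp add: o_def)

lemma diffop_ideal_lmult: "u \<in> I \<Longrightarrow> (\<lambda>y. a * u y) \<in> I"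
  using diffop_ideal_lcomp[OF _ diffops_mult_op[of a \<iota>]] by simp

lemma diffop_ideal_rmult: "u \<in> I \<Longrightarrow> (\<lambda>y. u (a * y)) \<in> I"
  using diffop_ideal_rcomp[OF _ diffops_mult_op[of a \<iota>]] by simp

lemma diffop_ideal_diff: "u \<in> I \<Longrightarrow> v \<in> I \<Longrightarrow> (\<lambda>y. u y - v y) \<in> I"
  using diffop_ideal_add[OF _ diffop_ideal_lmult[of v "-1"]] by simp

lemma diffop_ideal_sum: "(\<And>k. k \<in> A \<Longrightarrow> u k \<in> I) \<Longrightarrow> (\<lambda>y. \<Sum>k\<in>A. u k y) \<in> I"
  by (induction A rule: infinite_finite_induct) (auto intro: diffop_ideal_zero diffop_ideal_add)

lemma diffop_ideal_eq_carrier: "(\<lambda>y. y) \<in> I \<Longrightarrow> I = diffops \<iota>"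
  using ideal.one_imp_carrier[OF I] by (simp add: id_def)

text \<open>The point is that the new numerator \<open>v\<close> stays in the given two-sided ideal.\<close>
lemma diffop_ideal_ore: "u \<in> I \<Longrightarrow> \<exists>N. \<exists>v\<in>I. (\<lambda>y. s ^ N * u y) = (\<lambda>y. v (s * y))"
proof -
  assume "u \<in> I"
  with diffop_ideal_subset obtain i where "u \<in> diffop_lev \<iota> i" by (auto simp: diffops_iff)
  with \<open>u \<in> I\<close> show ?thesis
  proof (induction i arbitrary: u)
    case 0
    then show ?case using diffop_ideal_zero by fastforce
  next
    case (Suc i)
    \<comment> \<open>The commutator [s, u] lies in \<open>I\<close> and has smaller level.
      Induction gives s^N [s, u] = v s, hence s^(N+1) u = (s^N u + v) s.\<close>
    have "(\<lambda>y. s * u y - u (s * y)) \<in> I"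
      using Suc.prems(1) by (intro diffop_ideal_diff diffop_ideal_lmult diffop_ideal_rmult)
    moreover have "(\<lambda>y. s * u y - u (s * y)) \<in> diffop_lev \<iota> i" using Suc.prems(2) by simp
    ultimately obtain N v where v: "v \<in> I" "(\<lambda>y. s ^ N * (s * u y - u (s * y))) = (\<lambda>y. v (s * y))"
      using Suc.IH by blast
    have "s ^ Suc N * u y = s ^ N * u (s * y) + v (s * y)" for y
      using fun_cong[OF v(2), of y] by (simp add: algebra_simps)
    then have "(\<lambda>y. s ^ Suc N * u y) = (\<lambda>y. (\<lambda>z. s ^ N * u z + v z) (s * y))" by blast
    moreover have "(\<lambda>z. s ^ N * u z + v z) \<in> I"
      by (intro diffop_ideal_add diffop_ideal_lmult Suc.prems(1) v(1))
    ultimately show ?case by (intro exI[of _ "Suc N"] bexI[of _ "\<lambda>z. s ^ N * u z + v z"])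
  qed
qed

text \<open>Commutators with multiplications stay in the ideal and lower the level. Either some
  commutator is nonzero and replaces u, or u commutes with all multiplications and is then
  multiplication by \<open>u 1\<close>.\<close>

lemma diffop_ideal_has_mult_op:
  assumes "I \<noteq> {\<lambda>y. 0}"
  shows "\<exists>a. a \<noteq> 0 \<and> (\<lambda>y. a * y) \<in> I"
proof -
  obtain u where "u \<in> I" "u \<noteq> (\<lambda>y. 0)" using assms diffop_ideal_zero by blast
  with diffop_ideal_subset obtain i where "u \<in> diffop_lev \<iota> i" by (auto simp: diffops_iff)
  with \<open>u \<in> I\<close> \<open>u \<noteq> (\<lambda>y. 0)\<close> show ?thesis
  proof (induction i arbitrary: u)
    case 0
    then show ?case by simp
  next
    case (Suc i)
    have comm: "(\<lambda>y. r * u y - u (r * y)) \<in> I" for r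
      using Suc.prems(1) by (intro diffop_ideal_diff diffop_ideal_lmult diffop_ideal_rmult)
    show ?case
    proof (cases "\<forall>r. (\<lambda>y. r * u y - u (r * y)) = (\<lambda>y. 0)")
      case True
      have "u r = u 1 * r" for r
        using fun_cong[OF spec[OF True, of r], of 1] by (simp add: mult.commute)
      then have "u = (\<lambda>y. u 1 * y)" by blast
      then show ?thesis using Suc.prems(1,2) by (metis mult_zero_left)
    next
      case False
      then show ?thesis using Suc.IH[OF comm] Suc.prems(3) by auto
    qed
  qed
qed

end

lemma diffop_ore:
  assumes "u \<in> diffops \<iota>"
  shows "\<exists>N. \<exists>v\<in>diffops \<iota>. (\<lambda>y. s ^ N * u y) = (\<lambda>y. v (s * y))"
  using diffop_ideal_ore[OF ring.oneideal[OF ring_diffop_ring]] assms by simp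

section \<open>Extension to the field of fractions\<close>

definition emb :: "'a::idom \<Rightarrow> 'a fract" where "emb a = Fract a 1"

lemma emb_simps:
  "emb (a + b) = emb a + emb b" "emb (a * b) = emb a * emb b" "emb (a - b) = emb a - emb b"
  "emb a = emb b \<longleftrightarrow> a = b" "emb a = 0 \<longleftrightarrow> a = 0" "emb 0 = 0" "emb 1 = 1"
  by (simp_all add: emb_def eq_fract Zero_fract_def One_fract_def)

lemma fract_clear: obtains s a where "s \<noteq> 0" "emb s * q = emb a"
  by (cases q) (auto simp: emb_def eq_fract mult.commute)

text \<open>By induction the commutator [s, w] vanishes, since it vanishes on the embedded domain
  and has smaller level. So s w(q) = w(s q), which is 0 when s is a denominator of q.\<close>

lemma diffop_fract_unique:
  assumes "w \<in> diffop_lev \<kappa> i" "\<And>a. w (emb a) = 0"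
  shows "w = (\<lambda>q. 0)"
  using assms
proof (induction i arbitrary: w)
  case (Suc i)
  have "w q = 0" for q
  proof -
    obtain s a where s: "s \<noteq> 0" "emb s * q = emb a" by (rule fract_clear)
    have "(\<lambda>y. emb s * w y - w (emb s * y)) = (\<lambda>q. 0)"
    proof (rule Suc.IH)
      show "(\<lambda>y. emb s * w y - w (emb s * y)) \<in> diffop_lev \<kappa> i" using Suc.prems(1) by simp
      show "emb s * w (emb a) - w (emb s * emb a) = 0" for a
        using Suc.prems(2)[of a] Suc.prems(2)[of "s * a"] by (simp add: emb_simps)
    qed
    from fun_cong[OF this, of q] s Suc.prems(2) show ?thesis by (simp add: emb_simps)
  qed
  then show ?case by blast
qed simp

lemma diffop_fract_unique2:
  assumes "w \<in> diffop_lev \<kappa> i" "w' \<in> diffop_lev \<kappa> j" "\<And>a. w (emb a) = w' (emb a)"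
  shows "w = w'"
proof -
  have "(\<lambda>y. w y - w' y) = (\<lambda>q. 0)"
    using assms by (intro diffop_fract_unique[where i = "max i j" and \<kappa> = \<kappa>] diffop_lev_diff)
      (auto intro: diffop_lev_mono)
  then show ?thesis by (metis eq_iff_diff_eq_0 ext)
qed

text \<open>The commutators [s, u] have smaller level, so they already extend, to
  \<open>W s\<close>. For q = b / s the extension has to satisfy s w(q) - u(b) = W s q, which
  determines w. What remains is independence of the fraction chosen, and that commutators of w with
  fractions have smaller level.\<close>

lemma diffop_fract_extend:
  assumes "u \<in> diffop_lev \<iota> i"
  shows "\<exists>w\<in>diffop_lev (\<lambda>c. emb (\<iota> c)) i. \<forall>a. w (emb a) = emb (u a)"
  using assms
proof (induction i arbitrary: u)
  case 0
  then show ?case by (auto simp: emb_simps)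
next
  case (Suc i)
  define \<kappa> where "\<kappa> = (\<lambda>c. emb (\<iota> c))"
  have lin: "klinear \<iota> u" using Suc.prems by simp
  have "\<forall>s. \<exists>w\<in>diffop_lev \<kappa> i. \<forall>a. w (emb a) = emb (s * u a - u (s * a))"
    using Suc.IH Suc.prems by (simp add: \<kappa>_def)
  then obtain W where W: "\<And>s. W s \<in> diffop_lev \<kappa> i"
    and Wemb: "\<And>s a. W s (emb a) = emb (s * u a - u (s * a))" by metis
  have Wlin: "klinear \<kappa> (W s)" for s using diffop_lev_klinear[OF W] .
  \<comment> \<open>On the domain this is [s t, u] = s [t, u] + [s, u] t; uniqueness of extensions
    carries it over to all fractions.\<close>
  have Wmult: "W (s * t) q = emb s * W t q + W s (emb t * q)" for s t q
  proof -
    have "W (s * t) = (\<lambda>q. emb s * W t q + W s (emb t * q))"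
    proof (rule diffop_fract_unique2[OF W])
      show "(\<lambda>q. emb s * W t q + W s (emb t * q)) \<in> diffop_lev \<kappa> i"
        using W by (intro diffop_lev_add diffop_lev_lmult diffop_lev_rmult)
      show "W (s * t) (emb a) = emb s * W t (emb a) + W s (emb t * emb a)" for a
        unfolding Wemb emb_simps(2)[symmetric] by (simp add: emb_simps algebra_simps)
    qed
    then show ?thesis by simp
  qed
  \<comment> \<open>The forced value of \<open>emb s * w q\<close> when s is a denominator of q. The
    choice of b is unique because \<open>emb\<close> is injective.\<close>
  define num where "num = (\<lambda>s q. emb (u (SOME b. emb s * q = emb b)) + W s q)"
  have num: "num s q = emb (u b) + W s q" if "emb s * q = emb b" for s q b
  proof -
    have "(SOME b. emb s * q = emb b) = b" using that by (auto simp: emb_simps intro!: some_equality)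
    then show ?thesis by (simp add: num_def)
  qed
  \<comment> \<open>Independence of the denominator: \<open>W\<close> at the product of s and t is
    expanded in both orders.\<close>
  have cross: "emb t * num s q = emb s * num t q" if "emb s * q = emb b" "emb t * q = emb c" for s t q b c
  proof -
    have eq: "W (s * t) q = W (t * s) q" by (simp add: mult.commute)
    have e: "t * b = s * c"
    proof -
      have "emb (t * b) = emb (s * c)" by (simp only: emb_simps(2) that[symmetric] ac_simps)
      then show ?thesis by (simp only: emb_simps(4))
    qed
    from e have "u (t * b) = u (s * c)" by simp
    then show ?thesis using eq unfolding Wmult that Wemb num[OF that(1)] num[OF that(2)]
      by (simp add: emb_simps algebra_simps)
  qed
  define w where "w = (\<lambda>q. let s = (SOME s. s \<noteq> 0 \<and> (\<exists>b. emb s * q = emb b)) in num s q / emb s)"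
  have w: "emb s * w q = emb (u b) + W s q" if "emb s * q = emb b" for s q b
  proof -
    define t where "t = (SOME s. s \<noteq> 0 \<and> (\<exists>b. emb s * q = emb b))"
    have "\<exists>s. s \<noteq> 0 \<and> (\<exists>b. emb s * q = emb b)" using fract_clear by metis
    then have t: "t \<noteq> 0" "\<exists>b. emb t * q = emb b" unfolding t_def using someI_ex by (metis (mono_tags, lifting))+
    then obtain c where c: "emb t * q = emb c" by blast
    have "w q = num t q / emb t" by (simp add: w_def t_def Let_def)
    then have "emb t * (emb s * w q) = emb t * num s q"
      using cross[OF that c] t(1) by (simp add: emb_simps field_simps)
    then show ?thesis using num[OF that] t(1) by (simp add: emb_simps)
  qed
  have w_emb: "w (emb a) = emb (u a)" for a
  proof -
    have "W 1 (emb a) = 0" by (simp add: Wemb emb_simps)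
    then show ?thesis using w[of 1 "emb a" a] by (simp add: emb_simps)
  qed
  have wadd: "w (p + q) = w p + w q" for p q
  proof -
    obtain s a where s: "s \<noteq> 0" "emb s * p = emb a" by (rule fract_clear)
    obtain t b where t: "t \<noteq> 0" "emb t * q = emb b" by (rule fract_clear)
    have 1: "emb (s * t) * p = emb (t * a)" "emb (s * t) * q = emb (s * b)"
      by (simp_all only: emb_simps s(2)[symmetric] t(2)[symmetric] ac_simps)
    have 2: "emb (s * t) * (p + q) = emb (t * a + s * b)"
      unfolding ring_distribs 1 by (simp add: emb_simps)
    have "emb (s * t) * w (p + q) = emb (s * t) * (w p + w q)"
      unfolding ring_distribs w[OF 1(1)] w[OF 1(2)] w[OF 2]
      by (simp add: klinear_add[OF Wlin] klinear_add[OF lin] emb_simps)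
    then show ?thesis using s t by (simp add: emb_simps)
  qed
  have wlin: "w (\<kappa> c * q) = \<kappa> c * w q" for c q
  proof -
    obtain s a where s: "s \<noteq> 0" "emb s * q = emb a" by (rule fract_clear)
    have 1: "emb s * (\<kappa> c * q) = emb (\<iota> c * a)"
      by (simp only: emb_simps s(2)[symmetric] \<kappa>_def ac_simps)
    have "emb s * w (\<kappa> c * q) = emb s * (\<kappa> c * w q)"
    proof -
      have "emb s * (\<kappa> c * w q) = \<kappa> c * (emb s * w q)" by (rule mult.left_commute)
      then show ?thesis unfolding w[OF 1] w[OF s(2)]
        using Wlin[of s] lin by (simp add: klinear_def emb_simps \<kappa>_def distrib_left)
    qed
    then show ?thesis using s by (simp add: emb_simps)
  qed
  \<comment> \<open>Rearranges the two expansions of \<open>W (s * a) = W (a * s)\<close>.\<close>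
  have Wcomm: "emb a * W s q - W s (emb a * q) = emb s * W a q - W a (emb s * q)" for a s q
  proof -
    have "emb s * W a q + W s (emb a * q) = emb a * W s q + W a (emb s * q)"
      unfolding Wmult[symmetric] by (simp only: mult.commute)
    then show ?thesis by (simp add: diff_eq_eq eq_diff_eq algebra_simps)
  qed
  have w_comm_emb: "emb a * w q - w (emb a * q) = W a q" for a q
  proof -
    obtain s b where s: "s \<noteq> 0" "emb s * q = emb b" by (rule fract_clear)
    have 1: "emb s * (emb a * q) = emb (a * b)"
      by (simp only: emb_simps s(2)[symmetric] ac_simps)
    have "W a (emb s * q) = emb (a * u b) - emb (u (a * b))" by (simp only: s(2) Wemb emb_simps)
    have "emb s * (emb a * w q - w (emb a * q)) = emb a * (emb s * w q) - emb s * w (emb a * q)"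
      by (simp add: algebra_simps)
    also have "\<dots> = (emb a * emb (u b) - emb (u (a * b))) + (emb a * W s q - W s (emb a * q))"
      unfolding w[OF 1] w[OF s(2)] by (simp add: algebra_simps)
    also have "\<dots> = W a (emb s * q) + (emb s * W a q - W a (emb s * q))"
      by (simp only: Wcomm[of a s q] \<open>W a (emb s * q) = _\<close> emb_simps(2))
    finally have "emb s * (emb a * w q - w (emb a * q)) = emb s * W a q" by simp
    then show ?thesis using s by (simp add: emb_simps)
  qed
  have "(\<lambda>q. r * w q - w (r * q)) \<in> diffop_lev \<kappa> i" for r
  proof -
    obtain s a where s: "s \<noteq> 0" "emb s * r = emb a" by (rule fract_clear)
    \<comment> \<open>For r = a / s the commutator is [r, w] = s^-1 ([a, w] - [s, w] r), which
      leaves only commutators with elements of the domain.\<close>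
    have "r * w q - w (r * q) = inverse (emb s) * (W a q - W s (r * q))" for q
    proof -
      have "emb s * (r * w q - w (r * q)) = W a q - W s (r * q)"
        using w_comm_emb[of a q] w_comm_emb[of s "r * q"] s(2)
        by (simp add: algebra_simps) (metis mult.assoc mult.commute)
      moreover have "emb s \<noteq> 0" using s by (simp add: emb_simps)
      ultimately show ?thesis by (simp add: field_simps)
    qed
    then show ?thesis
      using W by (auto intro!: diffop_lev_lmult diffop_lev_diff diffop_lev_rmult)
  qed
  then have "w \<in> diffop_lev \<kappa> (Suc i)" using wadd wlin by (simp add: klinear_def)
  then show ?case using w_emb unfolding \<kappa>_def by blast
qed

section \<open>Ore localizations inside an overring\<close>

lemma ideal_memI:
  fixes R (structure)
  assumes "ring R" "I \<subseteq> carrier R" "\<zero> \<in> I"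
    and "\<And>a b. a \<in> I \<Longrightarrow> b \<in> I \<Longrightarrow> a \<oplus> b \<in> I"
    and "\<And>a x. a \<in> I \<Longrightarrow> x \<in> carrier R \<Longrightarrow> x \<otimes> a \<in> I"
    and "\<And>a x. a \<in> I \<Longrightarrow> x \<in> carrier R \<Longrightarrow> a \<otimes> x \<in> I"
  shows "ideal I R"
proof -
  interpret ring R by fact
  have "\<ominus> a \<in> I" if "a \<in> I" for a
    using assms(5)[OF that, of "\<ominus> \<one>"] assms(2) that by (auto simp: l_minus)
  then show ?thesis
    using assms by (intro idealI add.subgroupI) (auto simp: a_inv_def[symmetric])
qed

lemma ideal_vimage:
  assumes "ring R" "ring S" "h \<in> Ring.ring_hom R S" "ideal J S"
  shows "ideal {r \<in> carrier R. h r \<in> J} R"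
proof -
  interpret R: ring R by fact
  interpret J: ideal J S by fact
  interpret h: ring_hom_ring R S h by (rule ring_hom_ringI2) fact+
  show ?thesis
    by (rule ideal_memI[OF assms(1)]) (auto simp: J.a_closed J.I_l_closed J.I_r_closed)
qed

lemma simple_ring_iso:
  assumes "h \<in> ring_iso R S" "ring S" "simple_ring R"
  shows "simple_ring S"
proof -
  have R: "ring R" and ne: "\<zero>\<^bsub>R\<^esub> \<noteq> \<one>\<^bsub>R\<^esub>"
    and simp: "\<And>I. ideal I R \<Longrightarrow> I = {\<zero>\<^bsub>R\<^esub>} \<or> I = carrier R"
    using assms(3) by (auto simp: simple_ring_def)
  interpret R: ring R by fact
  interpret S: ring S by fact
  have hom: "h \<in> Ring.ring_hom R S" and bij: "bij_betw h (carrier R) (carrier S)"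
    using assms(1) by (auto simp: ring_iso_def)
  interpret h: ring_hom_ring R S h by (rule ring_hom_ringI2) fact+
  have "\<zero>\<^bsub>S\<^esub> \<noteq> \<one>\<^bsub>S\<^esub>"
  proof
    assume "\<zero>\<^bsub>S\<^esub> = \<one>\<^bsub>S\<^esub>"
    then have "h \<zero>\<^bsub>R\<^esub> = h \<one>\<^bsub>R\<^esub>" by (simp only: h.hom_zero h.hom_one)
    from inj_onD[OF bij_betw_imp_inj_on[OF bij] this R.zero_closed R.one_closed] ne show False by contradiction
  qed
  moreover have "J = {\<zero>\<^bsub>S\<^esub>} \<or> J = carrier S" if J: "ideal J S" for J
  proof -
    interpret J: ideal J S by fact
    have img: "h ` {r \<in> carrier R. h r \<in> J} = J"
    proof -
      have "J \<subseteq> h ` carrier R" unfolding bij_betw_imp_surj_on[OF bij] by (rule J.a_subset)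
      then show ?thesis by auto
    qed
    from simp[OF ideal_vimage[OF R assms(2) hom J]] show ?thesis
    proof
      assume "{r \<in> carrier R. h r \<in> J} = {\<zero>\<^bsub>R\<^esub>}"
      then show ?thesis using img by simp
    next
      assume "{r \<in> carrier R. h r \<in> J} = carrier R"
      then show ?thesis using img bij_betw_imp_surj_on[OF bij] by simp
    qed
  qed
  ultimately show ?thesis using assms(2) by (simp add: simple_ring_def)
qed

text \<open>In an overring where \<open>S\<close> becomes invertible, left fractions are actual
  elements. The ring axioms are inherited there, and the class construction only has to be compared
  with these elements.\<close>

locale ore_embedding = R: ring R + Q: ring Q for R :: "('b, 'm) ring_scheme" (structure)
    and Q :: "('c, 'n) ring_scheme" +
  fixes S :: "'b set" and j :: "'b \<Rightarrow> 'c"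
  assumes j_hom: "j \<in> Ring.ring_hom R Q" and j_inj: "inj_on j (carrier R)"
    and S_sub: "S \<subseteq> carrier R" and S_one: "\<one> \<in> S" and S_mult: "s \<in> S \<Longrightarrow> t \<in> S \<Longrightarrow> s \<otimes> t \<in> S"
    and S_unit: "s \<in> S \<Longrightarrow> j s \<in> Units Q"
    and ore: "u \<in> carrier R \<Longrightarrow> s \<in> S \<Longrightarrow> \<exists>s'\<in>S. \<exists>u'\<in>carrier R. s' \<otimes> u = u' \<otimes> s"
begin

sublocale j: ring_hom_ring R Q j
  by (rule ring_hom_ringI2) (rule R.ring_axioms, rule Q.ring_axioms, rule j_hom)

definition frac :: "'b \<Rightarrow> 'b \<Rightarrow> 'c" where
  "frac s u = inv\<^bsub>Q\<^esub> (j s) \<otimes>\<^bsub>Q\<^esub> j u"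

lemma S_carrier [simp]: "s \<in> S \<Longrightarrow> s \<in> carrier R"
  using S_sub by blast

lemma frac_closed [simp]: "s \<in> S \<Longrightarrow> u \<in> carrier R \<Longrightarrow> frac s u \<in> carrier Q"
  by (simp add: frac_def S_unit)

lemma frac_clear: "s \<in> S \<Longrightarrow> u \<in> carrier R \<Longrightarrow> j s \<otimes>\<^bsub>Q\<^esub> frac s u = j u"
  using S_unit[of s] by (simp add: frac_def Q.m_assoc[symmetric])

lemma frac_eqI:
  assumes "s \<in> S" "u \<in> carrier R" "q \<in> carrier Q" "j s \<otimes>\<^bsub>Q\<^esub> q = j u"
  shows "frac s u = q"
  using assms S_unit[OF assms(1)] by (simp add: frac_def assms(4)[symmetric] Q.m_assoc[symmetric])

lemma frac_one: "u \<in> carrier R \<Longrightarrow> frac \<one> u = j u"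
  by (rule frac_eqI) (auto simp: S_one)

lemma frac_expand:
  assumes "s \<in> S" "u \<in> carrier R" "a \<in> carrier R" "a \<otimes> s \<in> S"
  shows "frac (a \<otimes> s) (a \<otimes> u) = frac s u"
  using assms by (intro frac_eqI) (auto simp: Q.m_assoc frac_clear)

lemma common_denominator:
  assumes "s \<in> S" "t \<in> S"
  obtains a b where "a \<in> carrier R" "b \<in> carrier R" "a \<otimes> s = b \<otimes> t" "a \<otimes> s \<in> S"
  using ore[of s t] assms S_mult by (metis S_carrier)

text \<open>A common denominator turns equality of fractions into equality of numerators in
  \<open>Q\<close>, and injectivity of \<open>j\<close> brings that back to \<open>R\<close>. In
  particular, the relation is an equivalence on pairs with denominator in \<open>S\<close>.\<close>

lemma ore_rel_iff:
  "((s, u), (t, v)) \<in> ore_rel R S \<longleftrightarrow>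
     s \<in> S \<and> t \<in> S \<and> u \<in> carrier R \<and> v \<in> carrier R \<and> frac s u = frac t v"
proof (intro iffI; (elim conjE)?)
  assume "((s, u), (t, v)) \<in> ore_rel R S"
  then show "s \<in> S \<and> t \<in> S \<and> u \<in> carrier R \<and> v \<in> carrier R \<and> frac s u = frac t v"
    unfolding ore_rel_def by clarsimp (metis frac_expand)
next
  assume *: "s \<in> S" "t \<in> S" "u \<in> carrier R" "v \<in> carrier R" "frac s u = frac t v"
  obtain a b where ab: "a \<in> carrier R" "b \<in> carrier R" "a \<otimes> s = b \<otimes> t" "a \<otimes> s \<in> S"
    using common_denominator[OF *(1,2)] .
  have "j (a \<otimes> u) = j (a \<otimes> s) \<otimes>\<^bsub>Q\<^esub> frac s u"
    using * ab by (metis frac_clear frac_expand R.m_closed)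
  also have "\<dots> = j (b \<otimes> v)"
    using * ab by (metis frac_clear frac_expand R.m_closed)
  finally have "a \<otimes> u = b \<otimes> v" using j_inj * ab by (simp add: inj_on_eq_iff del: j.hom_mult)
  then show "((s, u), (t, v)) \<in> ore_rel R S" unfolding ore_rel_def using * ab by blast
qed

definition fracs :: "'c set" where
  "fracs = {frac s u | s u. s \<in> S \<and> u \<in> carrier R}"

text \<open>The set of all representations of q as a left fraction. By \<open>ore_rel_iff\<close>,
  for q in \<open>fracs\<close> these sets are exactly the classes that make up the
  localization.\<close>

definition cls :: "'c \<Rightarrow> ('b \<times> 'b) set" where
  "cls q = {(s, u). s \<in> S \<and> u \<in> carrier R \<and> frac s u = q}"

lemma ore_class_eq: "s \<in> S \<Longrightarrow> u \<in> carrier R \<Longrightarrow> ore_class R S s u = cls (frac s u)"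
  by (auto simp: ore_class_def cls_def ore_rel_iff)

lemma fracsE: assumes "q \<in> fracs" obtains s u where "s \<in> S" "u \<in> carrier R" "q = frac s u"
  using assms by (auto simp: fracs_def)

lemma frac_mult:
  assumes "s \<in> S" "u \<in> carrier R" "t \<in> S" "v \<in> carrier R"
    "s' \<in> S" "r \<in> carrier R" "s' \<otimes> u = r \<otimes> t"
  shows "frac (s' \<otimes> s) (r \<otimes> v) = frac s u \<otimes>\<^bsub>Q\<^esub> frac t v"
proof (rule frac_eqI)
  have "j (s' \<otimes> s) \<otimes>\<^bsub>Q\<^esub> (frac s u \<otimes>\<^bsub>Q\<^esub> frac t v) = j s' \<otimes>\<^bsub>Q\<^esub> (j s \<otimes>\<^bsub>Q\<^esub> frac s u) \<otimes>\<^bsub>Q\<^esub> frac t v"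
    using assms by (simp add: Q.m_assoc)
  also have "\<dots> = j (s' \<otimes> u) \<otimes>\<^bsub>Q\<^esub> frac t v" using assms(1,2,5) by (simp add: frac_clear)
  also have "\<dots> = j (r \<otimes> t) \<otimes>\<^bsub>Q\<^esub> frac t v" by (simp only: assms(7))
  also have "\<dots> = j r \<otimes>\<^bsub>Q\<^esub> (j t \<otimes>\<^bsub>Q\<^esub> frac t v)" using assms(3,4,6) by (simp add: Q.m_assoc)
  finally show "j (s' \<otimes> s) \<otimes>\<^bsub>Q\<^esub> (frac s u \<otimes>\<^bsub>Q\<^esub> frac t v) = j (r \<otimes> v)" using assms by (simp add: frac_clear)
qed (use assms S_mult in auto)

lemma frac_add:
  assumes "s \<in> S" "u \<in> carrier R" "t \<in> S" "v \<in> carrier R"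
    "a \<in> carrier R" "b \<in> carrier R" "a \<otimes> s = b \<otimes> t" "a \<otimes> s \<in> S"
  shows "frac (a \<otimes> s) (a \<otimes> u \<oplus> b \<otimes> v) = frac s u \<oplus>\<^bsub>Q\<^esub> frac t v"
proof (rule frac_eqI)
  have "j (a \<otimes> s) \<otimes>\<^bsub>Q\<^esub> frac s u = j (a \<otimes> u)"
    using assms by (metis frac_clear frac_expand R.m_closed)
  moreover have "j (a \<otimes> s) \<otimes>\<^bsub>Q\<^esub> frac t v = j (b \<otimes> v)"
    using assms by (metis frac_clear frac_expand R.m_closed)
  ultimately show "j (a \<otimes> s) \<otimes>\<^bsub>Q\<^esub> (frac s u \<oplus>\<^bsub>Q\<^esub> frac t v) = j (a \<otimes> u \<oplus> b \<otimes> v)"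
    using assms by (simp add: Q.r_distr del: j.hom_mult)
qed (use assms in auto)

lemma fracs_mult:
  assumes "p \<in> fracs" "q \<in> fracs" shows "p \<otimes>\<^bsub>Q\<^esub> q \<in> fracs"
proof -
  obtain s u t v where *: "s \<in> S" "u \<in> carrier R" "p = frac s u" "t \<in> S" "v \<in> carrier R" "q = frac t v"
    using assms by (elim fracsE)
  obtain s' r where "s' \<in> S" "r \<in> carrier R" "s' \<otimes> u = r \<otimes> t" using ore * by blast
  then have "p \<otimes>\<^bsub>Q\<^esub> q = frac (s' \<otimes> s) (r \<otimes> v)" using * frac_mult by simp
  then show ?thesis using * \<open>s' \<in> S\<close> \<open>r \<in> carrier R\<close> S_mult unfolding fracs_def by blast
qed

lemma fracs_add:
  assumes "p \<in> fracs" "q \<in> fracs" shows "p \<oplus>\<^bsub>Q\<^esub> q \<in> fracs"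
proof -
  obtain s u t v where *: "s \<in> S" "u \<in> carrier R" "p = frac s u" "t \<in> S" "v \<in> carrier R" "q = frac t v"
    using assms by (elim fracsE)
  obtain a b where ab: "a \<in> carrier R" "b \<in> carrier R" "a \<otimes> s = b \<otimes> t" "a \<otimes> s \<in> S"
    using common_denominator[OF *(1,4)] .
  then have "p \<oplus>\<^bsub>Q\<^esub> q = frac (a \<otimes> s) (a \<otimes> u \<oplus> b \<otimes> v)" using * frac_add by simp
  moreover have "a \<otimes> u \<oplus> b \<otimes> v \<in> carrier R" using * ab by simp
  ultimately show ?thesis using ab unfolding fracs_def by blast
qed

lemma fracs_j: "u \<in> carrier R \<Longrightarrow> j u \<in> fracs"
  unfolding fracs_def using frac_one[symmetric] S_one by blast

lemma fracs_sub: "fracs \<subseteq> carrier Q"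
  by (auto elim: fracsE)

lemma fracs_subring: "subring fracs Q"
proof (rule Q.subringI)
  show "fracs \<subseteq> carrier Q" by (rule fracs_sub)
  show "\<one>\<^bsub>Q\<^esub> \<in> fracs" using fracs_j[of \<one>] by simp
  show "\<ominus>\<^bsub>Q\<^esub> q \<in> fracs" if "q \<in> fracs" for q
  proof -
    have q: "q \<in> carrier Q" using that fracs_sub by blast
    have "\<ominus>\<^bsub>Q\<^esub> q = j (\<ominus> \<one>) \<otimes>\<^bsub>Q\<^esub> q" using q by (simp add: Q.l_minus)
    then show ?thesis using fracs_mult[OF fracs_j[of "\<ominus> \<one>"] that] by simp
  qed
qed (auto intro: fracs_mult fracs_add)

abbreviation "frac_ring \<equiv> Q\<lparr>carrier := fracs\<rparr>"

lemma ring_frac_ring: "ring frac_ring"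
  by (rule Q.subring_is_ring[OF fracs_subring])

lemma cls_inj: "inj_on cls fracs"
proof (rule inj_onI)
  fix p q assume "p \<in> fracs" "cls p = cls q"
  then show "p = q" by (auto elim!: fracsE simp: cls_def)
qed

text \<open>By \<open>frac_mult\<close>, every choice of representatives and of Ore data leads to
  the same fraction, so the choice operator in the definition has exactly one candidate.\<close>

lemma cls_mult:
  assumes "p \<in> fracs" "q \<in> fracs"
  shows "cls p \<otimes>\<^bsub>ore_localization R S\<^esub> cls q = cls (p \<otimes>\<^bsub>Q\<^esub> q)"
  unfolding ore_localization_def monoid.simps
proof (rule some_equality)
  obtain s u t v where *: "s \<in> S" "u \<in> carrier R" "p = frac s u" "t \<in> S" "v \<in> carrier R" "q = frac t v"
    using assms by (elim fracsE)
  obtain s' r where r: "s' \<in> S" "r \<in> carrier R" "s' \<otimes> u = r \<otimes> t" using ore * by blast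
  have "cls (p \<otimes>\<^bsub>Q\<^esub> q) = ore_class R S (s' \<otimes> s) (r \<otimes> v)"
    using * r frac_mult[OF _ _ _ _ r] S_mult by (simp add: ore_class_eq)
  then show "\<exists>s1 u1 s2 u2 s' r'. (s1, u1) \<in> cls p \<and> (s2, u2) \<in> cls q \<and> s' \<in> S \<and> r' \<in> carrier R \<and>
      s' \<otimes> u1 = r' \<otimes> s2 \<and> cls (p \<otimes>\<^bsub>Q\<^esub> q) = ore_class R S (s' \<otimes> s1) (r' \<otimes> u2)"
    using * r unfolding cls_def by blast
next
  fix Z assume "\<exists>s1 u1 s2 u2 s' r'. (s1, u1) \<in> cls p \<and> (s2, u2) \<in> cls q \<and> s' \<in> S \<and> r' \<in> carrier R \<and>
      s' \<otimes> u1 = r' \<otimes> s2 \<and> Z = ore_class R S (s' \<otimes> s1) (r' \<otimes> u2)"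
  then show "Z = cls (p \<otimes>\<^bsub>Q\<^esub> q)"
    by (auto simp: cls_def[of p] cls_def[of q] ore_class_eq S_mult frac_mult)
qed

lemma cls_add:
  assumes "p \<in> fracs" "q \<in> fracs"
  shows "cls p \<oplus>\<^bsub>ore_localization R S\<^esub> cls q = cls (p \<oplus>\<^bsub>Q\<^esub> q)"
  unfolding ore_localization_def ring.simps
proof (rule some_equality)
  obtain s u t v where *: "s \<in> S" "u \<in> carrier R" "p = frac s u" "t \<in> S" "v \<in> carrier R" "q = frac t v"
    using assms by (elim fracsE)
  obtain a b where ab: "a \<in> carrier R" "b \<in> carrier R" "a \<otimes> s = b \<otimes> t" "a \<otimes> s \<in> S"
    using common_denominator[OF *(1,4)] .
  have "cls (p \<oplus>\<^bsub>Q\<^esub> q) = ore_class R S (a \<otimes> s) (a \<otimes> u \<oplus> b \<otimes> v)"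
    using * ab frac_add[OF _ _ _ _ ab] by (simp add: ore_class_eq)
  then show "\<exists>s1 u1 s2 u2 a b. (s1, u1) \<in> cls p \<and> (s2, u2) \<in> cls q \<and> a \<in> carrier R \<and> b \<in> carrier R \<and>
      a \<otimes> s1 = b \<otimes> s2 \<and> a \<otimes> s1 \<in> S \<and> cls (p \<oplus>\<^bsub>Q\<^esub> q) = ore_class R S (a \<otimes> s1) (a \<otimes> u1 \<oplus> b \<otimes> u2)"
    using * ab unfolding cls_def by blast
next
  fix Z assume "\<exists>s1 u1 s2 u2 a b. (s1, u1) \<in> cls p \<and> (s2, u2) \<in> cls q \<and> a \<in> carrier R \<and> b \<in> carrier R \<and>
      a \<otimes> s1 = b \<otimes> s2 \<and> a \<otimes> s1 \<in> S \<and> Z = ore_class R S (a \<otimes> s1) (a \<otimes> u1 \<oplus> b \<otimes> u2)"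
  then obtain s1 u1 s2 u2 a b where *: "(s1, u1) \<in> cls p" "(s2, u2) \<in> cls q" "a \<in> carrier R" "b \<in> carrier R"
      "a \<otimes> s1 = b \<otimes> s2" "a \<otimes> s1 \<in> S" "Z = ore_class R S (a \<otimes> s1) (a \<otimes> u1 \<oplus> b \<otimes> u2)" by blast
  then have "Z = cls (frac (a \<otimes> s1) (a \<otimes> u1 \<oplus> b \<otimes> u2))"
    by (auto simp: cls_def[of p] cls_def[of q] ore_class_eq)
  also have "frac (a \<otimes> s1) (a \<otimes> u1 \<oplus> b \<otimes> u2) = p \<oplus>\<^bsub>Q\<^esub> q"
    using * frac_add[of s1 u1 s2 u2 a b] by (auto simp: cls_def[of p] cls_def[of q])
  finally show "Z = cls (p \<oplus>\<^bsub>Q\<^esub> q)" .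
qed

lemma carrier_ore_localization: "carrier (ore_localization R S) = cls ` fracs"
proof -
  have "ore_rel R S `` {(s, u)} = cls (frac s u)" if "s \<in> S" "u \<in> carrier R" for s u
    using ore_class_eq[OF that] by (simp add: ore_class_def)
  then show ?thesis
    by (force simp: ore_localization_def quotient_def fracs_def)
qed

lemma cls_iso: "cls \<in> ring_iso frac_ring (ore_localization R S)"
proof (rule ring_iso_memI)
  show "bij_betw cls (carrier frac_ring) (carrier (ore_localization R S))"
    by (simp add: bij_betw_def cls_inj carrier_ore_localization)
  have "\<one>\<^bsub>ore_localization R S\<^esub> = cls (frac \<one> \<one>)"
    by (simp add: ore_localization_def ore_class_eq S_one)
  then show "cls \<one>\<^bsub>frac_ring\<^esub> = \<one>\<^bsub>ore_localization R S\<^esub>" by (simp add: frac_one)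
qed (auto simp: cls_mult cls_add carrier_ore_localization)

lemma ring_ore_localization: "ring (ore_localization R S)"
proof -
  have "\<zero>\<^bsub>ore_localization R S\<^esub> = cls (frac \<one> \<zero>)"
    by (simp add: ore_localization_def ore_class_eq S_one)
  then have z: "\<zero>\<^bsub>ore_localization R S\<^esub> = cls \<zero>\<^bsub>Q\<^esub>" by (simp add: frac_one)
  \<comment> \<open>Transport along the bijection gives a ring whose zero is reset to the image of
    zero; this reset changes nothing here.\<close>
  have "ore_localization R S\<lparr>zero := \<zero>\<^bsub>ore_localization R S\<^esub>\<rparr> = ore_localization R S" by simp
  then have "ore_localization R S\<lparr>zero := cls \<zero>\<^bsub>frac_ring\<^esub>\<rparr> = ore_localization R S"
    unfolding z by simp
  with ring.ring_iso_imp_img_ring[OF ring_frac_ring cls_iso] show ?thesis by (simp only:)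
qed

lemma simple_ore_localization_iff:
  "simple_ring (ore_localization R S) \<longleftrightarrow> simple_ring frac_ring"
proof
  assume "simple_ring (ore_localization R S)"
  with simple_ring_iso[OF ring_iso_set_sym[OF ring_frac_ring cls_iso] ring_frac_ring]
  show "simple_ring frac_ring" .
next
  assume "simple_ring frac_ring"
  with simple_ring_iso[OF cls_iso ring_ore_localization] show "simple_ring (ore_localization R S)" .
qed

text \<open>Multiplying a fraction by its denominator shows that its numerator lies in the ideal as
  well. So an ideal of fractions whose contraction to \<open>R\<close> is zero is itself zero, and
  one whose contraction is \<open>R\<close> contains 1.\<close>

lemma simple_ore_localization:
  assumes "simple_ring R"
  shows "simple_ring (ore_localization R S)"
proof -
  interpret F: ring frac_ring by (rule ring_frac_ring)
  have jF: "j \<in> Ring.ring_hom R frac_ring"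
    using j_hom by (auto simp: Ring.ring_hom_def fracs_j)
  have ne: "\<zero> \<noteq> \<one>" and simp: "\<And>I. ideal I R \<Longrightarrow> I = {\<zero>} \<or> I = carrier R"
    using assms by (auto simp: simple_ring_def)
  have "\<zero>\<^bsub>Q\<^esub> \<noteq> \<one>\<^bsub>Q\<^esub>"
  proof
    assume "\<zero>\<^bsub>Q\<^esub> = \<one>\<^bsub>Q\<^esub>"
    then have "j \<zero> = j \<one>" by (simp only: j.hom_zero j.hom_one)
    from inj_onD[OF j_inj this R.zero_closed R.one_closed] ne show False by contradiction
  qed
  moreover have "J = {\<zero>\<^bsub>Q\<^esub>} \<or> J = fracs" if J: "ideal J frac_ring" for J
  proof -
    interpret J: ideal J frac_ring by fact
    from simp[OF ideal_vimage[OF R.ring_axioms ring_frac_ring jF J]] show ?thesis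
    proof
      assume *: "{r \<in> carrier R. j r \<in> J} = {\<zero>}"
      have "q = \<zero>\<^bsub>Q\<^esub>" if "q \<in> J" for q
      proof -
        have "q \<in> fracs" using J.a_subset that by auto
        then obtain s u where su: "s \<in> S" "u \<in> carrier R" "q = frac s u" by (rule fracsE)
        then have "j u \<in> J" using J.I_l_closed[OF that, of "j s"] fracs_j frac_clear by simp
        then have "u = \<zero>" using * su by auto
        then show ?thesis using su S_unit[of s] by (simp add: frac_def)
      qed
      then have "J \<subseteq> {\<zero>\<^bsub>Q\<^esub>}" by blast
      moreover have "\<zero>\<^bsub>Q\<^esub> \<in> J" using J.zero_closed by simp
      ultimately show ?thesis by blast
    next
      assume "{r \<in> carrier R. j r \<in> J} = carrier R"
      then have "j \<one> \<in> J" using R.one_closed by blast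
      then show ?thesis using J.one_imp_carrier by simp
    qed
  qed
  ultimately show ?thesis
    unfolding simple_ore_localization_iff using ring_frac_ring by (simp add: simple_ring_def)
qed

text \<open>Without the last hypothesis, right multiplication
  by an inverse of an element of the multiplicative set might leave the set of fractions with numerator in the ideal.\<close>
lemma simple_ore_localization_meets:
  assumes "simple_ring (ore_localization R S)" and I: "ideal I R" "I \<noteq> {\<zero>}"
    and oreI: "\<And>u s. u \<in> I \<Longrightarrow> s \<in> S \<Longrightarrow> \<exists>s'\<in>S. \<exists>u'\<in>I. s' \<otimes> u = u' \<otimes> s"
  shows "I \<inter> S \<noteq> {}"
proof -
  interpret I: ideal I R by fact
  define J where "J = {frac s u | s u. s \<in> S \<and> u \<in> I}"
  have JI: "frac s u \<in> J" if "s \<in> S" "u \<in> I" for s u using that by (auto simp: J_def)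
  have Ic: "u \<in> carrier R" if "u \<in> I" for u using I.Icarr that .
  have "ideal J frac_ring"
  proof (rule ideal_memI[OF ring_frac_ring])
    show "J \<subseteq> carrier frac_ring" using I.a_subset by (auto simp: J_def fracs_def)
    show "\<zero>\<^bsub>frac_ring\<^esub> \<in> J" using JI[OF S_one, of \<zero>] by (simp add: frac_one)
    fix p assume "p \<in> J"
    then obtain s u where p: "s \<in> S" "u \<in> I" "p = frac s u" by (auto simp: J_def)
    show "p \<oplus>\<^bsub>frac_ring\<^esub> q \<in> J" if qJ: "q \<in> J" for q
    proof -
      obtain t v where q: "t \<in> S" "v \<in> I" "q = frac t v" using qJ by (auto simp: J_def)
      obtain a b where ab: "a \<in> carrier R" "b \<in> carrier R" "a \<otimes> s = b \<otimes> t" "a \<otimes> s \<in> S"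
        using common_denominator[OF p(1) q(1)] .
      have "frac (a \<otimes> s) (a \<otimes> u \<oplus> b \<otimes> v) \<in> J"
        using p q ab by (intro JI I.a_closed I.I_l_closed) auto
      then show ?thesis using frac_add[OF p(1) Ic[OF p(2)] q(1) Ic[OF q(2)] ab] p q by simp
    qed
    fix q assume "q \<in> carrier frac_ring"
    then obtain t v where q: "t \<in> S" "v \<in> carrier R" "q = frac t v" by (auto elim: fracsE)
    show "q \<otimes>\<^bsub>frac_ring\<^esub> p \<in> J"
    proof -
      obtain s' r where r: "s' \<in> S" "r \<in> carrier R" "s' \<otimes> v = r \<otimes> s" using ore p q by blast
      have "frac (s' \<otimes> t) (r \<otimes> u) \<in> J" using p q r by (intro JI I.I_l_closed S_mult) auto
      then show ?thesis using frac_mult[OF q(1,2) p(1) Ic[OF p(2)] r] p q by simp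
    qed
    show "p \<otimes>\<^bsub>frac_ring\<^esub> q \<in> J"
    proof -
      obtain s' r where r: "s' \<in> S" "r \<in> I" "s' \<otimes> u = r \<otimes> t" using oreI p q by blast
      have "frac (s' \<otimes> s) (r \<otimes> v) \<in> J" using p q r by (intro JI I.I_r_closed S_mult) auto
      then show ?thesis using frac_mult[OF p(1) Ic[OF p(2)] q(1,2) r(1) Ic[OF r(2)] r(3)] p q by simp
    qed
  qed
  moreover obtain u where u: "u \<in> I" "u \<noteq> \<zero>" using I I.zero_closed by blast
  have "j u \<noteq> \<zero>\<^bsub>Q\<^esub>" using u inj_onD[OF j_inj, of u \<zero>] Ic by auto
  then have "J \<noteq> {\<zero>\<^bsub>Q\<^esub>}" using JI[OF S_one u(1)] u Ic by (auto simp: frac_one)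
  ultimately have "J = fracs"
    using assms(1) unfolding simple_ore_localization_iff by (auto simp: simple_ring_def)
  \<comment> \<open>Writing 1 as a fraction with numerator v in \<open>I\<close> and denominator s
    forces j s = j v, so s = v is the common element.\<close>
  then have "\<one>\<^bsub>Q\<^esub> \<in> J" using fracs_j[of \<one>] by simp
  then obtain s v where sv: "s \<in> S" "v \<in> I" "frac s v = \<one>\<^bsub>Q\<^esub>" by (auto simp: J_def)
  then have "j s = j v" using frac_clear[of s v] Ic by simp
  then have "s = v" using sv Ic j_inj by (auto dest: inj_onD)
  then show ?thesis using sv by blast
qed

end

section \<open>Localizations of rings of differential operators\<close>

lemma type_ring_simps [simp]:
  "carrier type_ring = UNIV" "a \<otimes>\<^bsub>type_ring\<^esub> b = a * b" "\<one>\<^bsub>type_ring\<^esub> = 1"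
  "\<zero>\<^bsub>type_ring\<^esub> = 0" "a \<oplus>\<^bsub>type_ring\<^esub> b = a + b"
  by (simp_all add: type_ring_def)

lemma cring_type_ring: "cring (type_ring :: 'a::comm_ring_1 ring)"
proof (rule cringI)
  show "abelian_group (type_ring :: 'a ring)"
    by (rule abelian_groupI) (auto simp: algebra_simps intro: exI[of _ "- x" for x])
  show "Group.comm_monoid (type_ring :: 'a ring)"
    by (rule comm_monoidI) (auto simp: algebra_simps)
qed (auto simp: algebra_simps)

lemma ideal_type_ring_iff:
  "ideal J (type_ring :: 'a::comm_ring_1 ring) \<longleftrightarrow>
     0 \<in> J \<and> (\<forall>a\<in>J. \<forall>b\<in>J. a + b \<in> J) \<and> (\<forall>a\<in>J. \<forall>x. x * a \<in> J)"
proof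
  assume "ideal J (type_ring :: 'a ring)"
  then interpret J: ideal J "type_ring :: 'a ring" .
  have "0 \<in> J" using additive_subgroup.zero_closed[OF J.additive_subgroup_axioms] by simp
  moreover have "a + b \<in> J" if "a \<in> J" "b \<in> J" for a b
    using additive_subgroup.a_closed[OF J.additive_subgroup_axioms that] by simp
  ultimately show "0 \<in> J \<and> (\<forall>a\<in>J. \<forall>b\<in>J. a + b \<in> J) \<and> (\<forall>a\<in>J. \<forall>x. x * a \<in> J)"
    using J.I_l_closed by simp
next
  assume "0 \<in> J \<and> (\<forall>a\<in>J. \<forall>b\<in>J. a + b \<in> J) \<and> (\<forall>a\<in>J. \<forall>x. x * a \<in> J)"
  then show "ideal J (type_ring :: 'a ring)"
    by (intro ideal_memI cring.axioms(1)[OF cring_type_ring]) (auto simp: mult.commute)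
qed

lemma ex_maximalideal:
  fixes J :: "'a::comm_ring_1 set"
  assumes "ideal J type_ring" "1 \<notin> J"
  shows "\<exists>M. maximalideal M type_ring \<and> J \<subseteq> M"
proof -
  define P where "P = {L. ideal L (type_ring :: 'a ring) \<and> 1 \<notin> L \<and> J \<subseteq> L}"
  have "P \<noteq> {}" using assms by (auto simp: P_def)
  moreover have "\<Union>C \<in> P" if C: "C \<noteq> {}" "subset.chain P C" for C
  proof -
    have CP: "\<And>L. L \<in> C \<Longrightarrow> L \<in> P" and tot: "\<And>L L'. L \<in> C \<Longrightarrow> L' \<in> C \<Longrightarrow> L \<subseteq> L' \<or> L' \<subseteq> L"
      using C(2) by (auto simp: subset.chain_def)
    have "a + b \<in> \<Union>C" if ab: "a \<in> \<Union>C" "b \<in> \<Union>C" for a b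
    proof -
      obtain L L' where L: "L \<in> C" "a \<in> L" "L' \<in> C" "b \<in> L'" using ab by blast
      then obtain L'' where "L'' \<in> C" "a \<in> L''" "b \<in> L''" using tot[of L L'] by blast
      then show ?thesis using CP[of L''] by (auto simp: P_def ideal_type_ring_iff)
    qed
    moreover have "x * a \<in> \<Union>C" if "a \<in> \<Union>C" for a x
    proof -
      obtain L where "L \<in> C" "a \<in> L" using \<open>a \<in> \<Union>C\<close> by blast
      then have "x * a \<in> L" using CP[of L] by (simp add: P_def ideal_type_ring_iff)
      then show ?thesis using \<open>L \<in> C\<close> by blast
    qed
    moreover obtain L where "L \<in> C" using C(1) by blast
    then have "0 \<in> \<Union>C" "J \<subseteq> \<Union>C" using CP[of L] by (auto simp: P_def ideal_type_ring_iff)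
    moreover have "1 \<notin> \<Union>C" using CP by (auto simp: P_def)
    ultimately show ?thesis by (simp add: P_def ideal_type_ring_iff)
  qed
  ultimately obtain M where M: "M \<in> P" "\<And>X. X \<in> P \<Longrightarrow> M \<subseteq> X \<Longrightarrow> X = M"
    using subset_Zorn_nonempty[of P] by blast
  have "maximalideal M (type_ring :: 'a ring)"
  proof (rule maximalidealI)
    show "ideal M (type_ring :: 'a ring)" using M(1) by (simp add: P_def)
    show "carrier (type_ring :: 'a ring) \<noteq> M" using M(1) by (auto simp: P_def)
    fix X assume X: "ideal X (type_ring :: 'a ring)" "M \<subseteq> X" "X \<subseteq> carrier type_ring"
    show "X = M \<or> X = carrier type_ring"
    proof (cases "1 \<in> X")
      case True
      then show ?thesis using ideal.one_imp_carrier[OF X(1)] by simp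
    next
      case False
      then have "X \<in> P" using X M(1) by (auto simp: P_def)
      then show ?thesis using M(2) X(2) by simp
    qed
  qed
  then show ?thesis using M(1) by (auto simp: P_def)
qed

lemma maximalideal_type_ringD:
  assumes "maximalideal M (type_ring :: 'a::comm_ring_1 ring)"
  shows "1 \<notin> M" "0 \<in> M" "a * b \<in> M \<Longrightarrow> a \<in> M \<or> b \<in> M" "a \<in> M \<Longrightarrow> b \<in> M \<Longrightarrow> a + b \<in> M"
    "a \<in> M \<Longrightarrow> x * a \<in> M" "a ^ N \<in> M \<Longrightarrow> a \<in> M"
proof -
  interpret prime: primeideal M "type_ring :: 'a ring"
    using cring.maximalideal_prime[OF cring_type_ring assms] .
  show "1 \<notin> M" using prime.one_imp_carrier prime.I_notcarr by auto
  show pr: "a * b \<in> M \<Longrightarrow> a \<in> M \<or> b \<in> M" for a b using prime.I_prime[of a b] by simp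
  show "0 \<in> M" "a \<in> M \<Longrightarrow> b \<in> M \<Longrightarrow> a + b \<in> M" "a \<in> M \<Longrightarrow> x * a \<in> M"
    using prime.is_ideal by (auto simp: ideal_type_ring_iff)
  show "a ^ N \<in> M \<Longrightarrow> a \<in> M" using \<open>1 \<notin> M\<close> pr by (induction N) auto
qed

definition diffop_extend :: "('k \<Rightarrow> 'a::idom) \<Rightarrow> ('a \<Rightarrow> 'a) \<Rightarrow> ('a fract \<Rightarrow> 'a fract)" where
  "diffop_extend \<iota> u = (THE w. w \<in> diffops (\<lambda>c. emb (\<iota> c)) \<and> (\<forall>a. w (emb a) = emb (u a)))"

lemma diffop_extend_eqI:
  assumes "w \<in> diffops (\<lambda>c. emb (\<iota> c))" "\<And>a. w (emb a) = emb (u a)"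
  shows "diffop_extend \<iota> u = w"
  unfolding diffop_extend_def
proof (rule the_equality)
  fix w' assume "w' \<in> diffops (\<lambda>c. emb (\<iota> c)) \<and> (\<forall>a. w' (emb a) = emb (u a))"
  then show "w' = w" using assms by (auto simp: diffops_iff intro: diffop_fract_unique2)
qed (use assms in auto)

lemma diffop_extend:
  assumes "u \<in> diffops \<iota>"
  shows "diffop_extend \<iota> u \<in> diffops (\<lambda>c. emb (\<iota> c))" "diffop_extend \<iota> u (emb a) = emb (u a)"
proof -
  obtain i where "u \<in> diffop_lev \<iota> i" using assms by (auto simp: diffops_iff)
  from diffop_fract_extend[OF this] obtain w
    where w: "w \<in> diffops (\<lambda>c. emb (\<iota> c))" "\<And>a. w (emb a) = emb (u a)" by (auto simp: diffops_iff)
  show "diffop_extend \<iota> u \<in> diffops (\<lambda>c. emb (\<iota> c))" "diffop_extend \<iota> u (emb a) = emb (u a)"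
    using diffop_extend_eqI[OF w] w by simp_all
qed

text \<open>The overring consists of the operators on the field of fractions, where multiplication
  by a nonzero element is invertible. The left Ore condition moves u past s at the cost of a power
  of s, which stays outside \<open>M\<close> because a maximal ideal is prime.\<close>

lemma ore_embedding_diffops:
  assumes M: "maximalideal M (type_ring :: 'a::idom ring)"
  shows "ore_embedding (diffop_ring \<iota>) (diffop_ring (\<lambda>c. emb (\<iota> c)))
    {(\<lambda>y. s * y) | s. s \<notin> M} (diffop_extend \<iota>)"
proof -
  note M = maximalideal_type_ringD[OF M]
  define \<kappa> where "\<kappa> = (\<lambda>c. emb (\<iota> c))"
  note ext = diffop_extend[where \<iota> = \<iota>, folded \<kappa>_def]
  note extI = diffop_extend_eqI[where \<iota> = \<iota>, folded \<kappa>_def]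
  have mult: "diffop_extend \<iota> (\<lambda>y. s * y) = (\<lambda>q. emb s * q)" for s
    by (rule extI) (auto simp: emb_simps diffops_mult_op)
  interpret R: ring "diffop_ring \<iota>" by (rule ring_diffop_ring)
  interpret Q: ring "diffop_ring \<kappa>" by (rule ring_diffop_ring)
  show ?thesis unfolding \<kappa>_def[symmetric]
  proof (intro ore_embedding.intro R.ring_axioms Q.ring_axioms ore_embedding_axioms.intro)
    show "diffop_extend \<iota> \<in> Ring.ring_hom (diffop_ring \<iota>) (diffop_ring \<kappa>)"
    proof (rule ring_hom_memI)
      fix u v assume uv: "u \<in> carrier (diffop_ring \<iota>)" "v \<in> carrier (diffop_ring \<iota>)"
      show "diffop_extend \<iota> (u \<otimes>\<^bsub>diffop_ring \<iota>\<^esub> v) =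
          diffop_extend \<iota> u \<otimes>\<^bsub>diffop_ring \<kappa>\<^esub> diffop_extend \<iota> v"
        using uv by (auto intro!: extI diffops_comp simp: ext)
      show "diffop_extend \<iota> (u \<oplus>\<^bsub>diffop_ring \<iota>\<^esub> v) =
          diffop_extend \<iota> u \<oplus>\<^bsub>diffop_ring \<kappa>\<^esub> diffop_extend \<iota> v"
        using uv by (auto intro!: extI diffops_add simp: ext emb_simps)
    qed (auto simp: ext intro!: extI diffops_id)
    show "inj_on (diffop_extend \<iota>) (carrier (diffop_ring \<iota>))"
    proof (rule inj_onI)
      fix u v assume uv: "u \<in> carrier (diffop_ring \<iota>)" "v \<in> carrier (diffop_ring \<iota>)"
        "diffop_extend \<iota> u = diffop_extend \<iota> v"
      have "emb (u a) = emb (v a)" for a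
        using uv ext(2)[of u a] ext(2)[of v a] by simp
      then show "u = v" by (auto simp: emb_simps)
    qed
    show "{(\<lambda>y. s * y) | s. s \<notin> M} \<subseteq> carrier (diffop_ring \<iota>)" by (auto simp: diffops_mult_op)
    show "\<one>\<^bsub>diffop_ring \<iota>\<^esub> \<in> {(\<lambda>y. s * y) | s. s \<notin> M}"
      using M(1) by (auto simp: id_def intro!: exI[of _ 1])
    show "s \<otimes>\<^bsub>diffop_ring \<iota>\<^esub> t \<in> {(\<lambda>y. s * y) | s. s \<notin> M}"
      if st: "s \<in> {(\<lambda>y. s * y) | s. s \<notin> M}" "t \<in> {(\<lambda>y. s * y) | s. s \<notin> M}" for s t
    proof -
      obtain a b where ab: "s = (\<lambda>y. a * y)" "a \<notin> M" "t = (\<lambda>y. b * y)" "b \<notin> M" using st by blast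
      then have "s \<otimes>\<^bsub>diffop_ring \<iota>\<^esub> t = (\<lambda>y. (a * b) * y)" by (auto simp: mult.assoc)
      then show ?thesis using M(3) ab by blast
    qed
    show "diffop_extend \<iota> s \<in> Units (diffop_ring \<kappa>)" if s: "s \<in> {(\<lambda>y. s * y) | s. s \<notin> M}" for s
    proof -
      obtain a where a: "s = (\<lambda>y. a * y)" "a \<notin> M" using s by blast
      then have "emb a \<noteq> 0" using M(2) by (auto simp: emb_simps)
      then show ?thesis unfolding a mult Units_def
        by (auto simp: diffops_mult_op intro!: bexI[of _ "\<lambda>q. inverse (emb a) * q"])
    qed
    show "\<exists>s'\<in>{(\<lambda>y. s * y) | s. s \<notin> M}. \<exists>u'\<in>carrier (diffop_ring \<iota>).
        s' \<otimes>\<^bsub>diffop_ring \<iota>\<^esub> u = u' \<otimes>\<^bsub>diffop_ring \<iota>\<^esub> s"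
      if u: "u \<in> carrier (diffop_ring \<iota>)" and s: "s \<in> {(\<lambda>y. s * y) | s. s \<notin> M}" for u s
    proof -
      obtain a where a: "s = (\<lambda>y. a * y)" "a \<notin> M" using s by blast
      obtain N v where "v \<in> diffops \<iota>" "(\<lambda>y. a ^ N * u y) = (\<lambda>y. v (a * y))"
        using diffop_ore[of u \<iota> a] u by auto
      then show ?thesis using a M(6)[of a N]
        by (intro bexI[of _ "\<lambda>y. a ^ N * y"] bexI[of _ v]) (auto simp: o_def)
    qed
  qed
qed

lemma simple_diffop_loc:
  assumes "maximalideal M (type_ring :: 'a::idom ring)" "simple_ring (diffop_ring \<iota>)"
  shows "simple_ring (diffop_loc \<iota> M)"
  unfolding diffop_loc_def
  using ore_embedding.simple_ore_localization[OF ore_embedding_diffops[OF assms(1)] assms(2)] .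

lemma simple_diffop_loc_meets:
  assumes M: "maximalideal M (type_ring :: 'a::idom ring)" and "simple_ring (diffop_loc \<iota> M)"
    and I: "ideal I (diffop_ring \<iota>)" "I \<noteq> {\<lambda>y. 0}"
  shows "\<exists>s. s \<notin> M \<and> (\<lambda>y. s * y) \<in> I"
proof -
  let ?S = "{(\<lambda>y. s * y) | s. s \<notin> M}"
  have "I \<inter> ?S \<noteq> {}"
  proof (rule ore_embedding.simple_ore_localization_meets[OF ore_embedding_diffops[OF M], of \<iota>])
    show "simple_ring (ore_localization (diffop_ring \<iota>) ?S)" using assms(2) by (simp add: diffop_loc_def)
    show "\<exists>s'\<in>?S. \<exists>u'\<in>I. s' \<otimes>\<^bsub>diffop_ring \<iota>\<^esub> u = u' \<otimes>\<^bsub>diffop_ring \<iota>\<^esub> s"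
      if u: "u \<in> I" and s: "s \<in> ?S" for u s
    proof -
      obtain a where a: "s = (\<lambda>y. a * y)" "a \<notin> M" using s by blast
      obtain N v where "v \<in> I" "(\<lambda>y. a ^ N * u y) = (\<lambda>y. v (a * y))"
        using diffop_ideal_ore[OF I(1) u, of a] by auto
      then show ?thesis using a maximalideal_type_ringD(6)[OF M, of a N]
        by (intro bexI[of _ "\<lambda>y. a ^ N * y"] bexI[of _ v]) (auto simp: o_def)
    qed
  qed (use I in auto)
  then show ?thesis by blast
qed

lemma ideal_diffop_ideal_mult_ops:
  assumes "ideal I (diffop_ring \<iota>)"
  shows "ideal {a. (\<lambda>y. a * y) \<in> I} type_ring"
  unfolding ideal_type_ring_iff
proof (intro conjI ballI allI; clarify)
  show "(\<lambda>y. 0 * y) \<in> I" by (rule mem_congI[OF diffop_ideal_zero[OF assms]]) simp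
  show "(\<lambda>y. (a + b) * y) \<in> I" if "(\<lambda>y. a * y) \<in> I" "(\<lambda>y. b * y) \<in> I" for a b
    by (rule mem_congI[OF diffop_ideal_add[OF assms that]]) (simp add: distrib_right)
  show "(\<lambda>y. (x * a) * y) \<in> I" if "(\<lambda>y. a * y) \<in> I" for a x
    by (rule mem_congI[OF diffop_ideal_lmult[OF assms that, of x]]) (simp add: mult.assoc)
qed

lemma simple_diffop_ringI:
  fixes \<iota> :: "'k \<Rightarrow> 'a::idom"
  assumes "\<And>M I. maximalideal M (type_ring :: 'a ring) \<Longrightarrow> ideal I (diffop_ring \<iota>) \<Longrightarrow> I \<noteq> {\<lambda>y. 0} \<Longrightarrow>
    \<exists>s. s \<notin> M \<and> (\<lambda>y. s * y) \<in> I"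
  shows "simple_ring (diffop_ring \<iota>)"
proof -
  have "I = {\<lambda>y. 0} \<or> I = diffops \<iota>" if I: "ideal I (diffop_ring \<iota>)" for I
  proof (rule disjCI, rule ccontr)
    assume *: "I \<noteq> diffops \<iota>" "I \<noteq> {\<lambda>y. 0}"
    have "1 \<notin> {a. (\<lambda>y. a * y) \<in> I}"
    proof
      assume "1 \<in> {a. (\<lambda>y. a * y) \<in> I}"
      then have "(\<lambda>y. 1 * y) \<in> I" by (rule CollectD)
      then have "(\<lambda>y. y) \<in> I" by (rule mem_congI) simp
      then show False using diffop_ideal_eq_carrier[OF I] *(1) by simp
    qed
    from ex_maximalideal[OF ideal_diffop_ideal_mult_ops[OF I] this]
    obtain M where M: "maximalideal M (type_ring :: 'a ring)" "{a. (\<lambda>y. a * y) \<in> I} \<subseteq> M" by blast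
    with assms[OF M(1) I *(2)] show False by blast
  qed
  moreover have "(\<lambda>y::'a. 0) \<noteq> id" by (metis id_apply zero_neq_one)
  ultimately show ?thesis by (simp add: simple_ring_def ring_diffop_ring)
qed

section \<open>Multivariate polynomials\<close>

abbreviation "lookup \<equiv> Poly_Mapping.lookup"
abbreviation "keys \<equiv> Poly_Mapping.keys"
abbreviation "single \<equiv> Poly_Mapping.single"

definition cst :: "'a::zero \<Rightarrow> 'a mpoly" where
  "cst c = single 0 c"

definition var :: "nat \<Rightarrow> 'a::zero_neq_one mpoly" where
  "var i = single (single i 1) 1"

definition mon :: "(nat \<Rightarrow> 'a::comm_monoid_mult) \<Rightarrow> (nat \<Rightarrow>\<^sub>0 nat) \<Rightarrow> 'a" where
  "mon x \<alpha> = (\<Prod>i\<in>keys \<alpha>. x i ^ lookup \<alpha> i)"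

lemma mpoly_expand: "p = (\<Sum>\<alpha>\<in>keys p. single \<alpha> (lookup p \<alpha>))"
  by (rule poly_mapping_eqI)
    (auto simp: lookup_sum lookup_single when_def not_in_keys_iff_lookup_eq_zero)

lemma mon_superset:
  assumes "finite A" "keys \<alpha> \<subseteq> A"
  shows "mon x \<alpha> = (\<Prod>i\<in>A. x i ^ lookup \<alpha> i)"
  unfolding mon_def using assms
  by (intro prod.mono_neutral_left) (auto simp: not_in_keys_iff_lookup_eq_zero)

lemma mon_add: "mon x (\<alpha> + \<beta>) = mon x \<alpha> * mon x \<beta>"
proof -
  let ?A = "keys \<alpha> \<union> keys \<beta>"
  have "keys (\<alpha> + \<beta>) \<subseteq> ?A" by (rule keys_add)
  then show ?thesis
    by (simp add: mon_superset[of ?A] lookup_add power_add prod.distrib)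
qed

lemma mon_zero [simp]: "mon x 0 = 1"
  by (simp add: mon_def)

lemma mon_single [simp]: "mon x (single i k) = x i ^ k"
  by (simp add: mon_def)

lemma evalp_mon: "evalp \<phi> x p = (\<Sum>\<alpha>\<in>keys p. \<phi> (lookup p \<alpha>) * mon x \<alpha>)"
  by (simp add: evalp_def mon_def)

lemma single_eq_cst_mon:
  "single \<alpha> c = cst c * mon var \<alpha>"
proof -
  have pow: "var i ^ k = single (single i k) (1::'a)" for i k
    by (induction k) (simp_all add: var_def mult_single single_add[symmetric])
  have prod: "(\<Prod>i\<in>A. var i ^ f i) = single (\<Sum>i\<in>A. single i (f i)) (1::'a)" for A and f :: "nat \<Rightarrow> nat"
    by (induction A rule: infinite_finite_induct) (simp_all add: pow mult_single)
  have "\<alpha> = (\<Sum>i\<in>keys \<alpha>. single i (lookup \<alpha> i))"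
    by (rule poly_mapping_eqI)
      (auto simp: lookup_sum lookup_single when_def not_in_keys_iff_lookup_eq_zero)
  then show ?thesis by (simp add: mon_def prod cst_def mult_single)
qed

lemma comm_ring_homI:
  fixes \<phi> :: "'a::comm_ring_1 \<Rightarrow> 'b::comm_ring_1"
  assumes "\<phi> 1 = 1" "\<And>a b. \<phi> (a + b) = \<phi> a + \<phi> b" "\<And>a b. \<phi> (a * b) = \<phi> a * \<phi> b"
  shows "comm_ring_hom \<phi>"
proof -
  have "\<phi> 0 = 0" using assms(2)[of 0 0] by simp
  then show ?thesis using assms by unfold_locales auto
qed

context
  fixes \<phi> :: "'k::comm_ring_1 \<Rightarrow> 'a::comm_ring_1" and x :: "nat \<Rightarrow> 'a"
  assumes \<phi>: "comm_ring_hom \<phi>"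
begin

interpretation \<phi>: comm_ring_hom \<phi> by (rule \<phi>)

lemma evalp_superset:
  assumes "finite A" "keys p \<subseteq> A"
  shows "evalp \<phi> x p = (\<Sum>\<alpha>\<in>A. \<phi> (lookup p \<alpha>) * mon x \<alpha>)"
  unfolding evalp_mon using assms
  by (intro sum.mono_neutral_left) (auto simp: not_in_keys_iff_lookup_eq_zero)

lemma evalp_single: "evalp \<phi> x (single \<alpha> c) = \<phi> c * mon x \<alpha>"
  by (simp add: evalp_mon)

lemma evalp_add: "evalp \<phi> x (p + q) = evalp \<phi> x p + evalp \<phi> x q"
proof -
  let ?A = "keys p \<union> keys q"
  have "keys (p + q) \<subseteq> ?A" by (rule keys_add)
  then show ?thesis
    by (simp add: evalp_superset[of ?A] lookup_add \<phi>.hom_add distrib_right sum.distrib)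
qed

lemma evalp_sum: "evalp \<phi> x (\<Sum>i\<in>A. f i) = (\<Sum>i\<in>A. evalp \<phi> x (f i))"
  by (induction A rule: infinite_finite_induct) (simp_all add: evalp_add evalp_mon[of _ _ 0])

lemma evalp_mult: "evalp \<phi> x (p * q) = evalp \<phi> x p * evalp \<phi> x q"
proof -
  have "p * q = (\<Sum>\<alpha>\<in>keys p. \<Sum>\<beta>\<in>keys q.
      single (\<alpha> + \<beta>) (lookup p \<alpha> * lookup q \<beta>))"
    by (subst (1) mpoly_expand[of p], subst (1) mpoly_expand[of q]) (simp add: sum_product mult_single)
  then show ?thesis
    by (simp add: evalp_sum evalp_single evalp_mon[of _ _ p] evalp_mon[of _ _ q] sum_product mon_add
        \<phi>.hom_mult algebra_simps)
qed

lemma evalp_cst [simp]: "evalp \<phi> x (cst c) = \<phi> c"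
  by (simp add: cst_def evalp_single)

lemma evalp_var [simp]: "evalp \<phi> x (var i) = x i"
  by (simp add: var_def evalp_single)

lemma evalp_hom: "comm_ring_hom (evalp \<phi> x)"
  by (rule comm_ring_homI) (use evalp_cst[of 1] in \<open>simp_all add: cst_def evalp_add evalp_mult\<close>)

end

lemma cst_hom: "comm_ring_hom (cst :: 'a::comm_ring_1 \<Rightarrow> 'a mpoly)"
  by (rule comm_ring_homI) (simp_all add: cst_def single_add mult_single)

section \<open>Polynomials with coefficients in a subring\<close>

definition polys_over :: "'a::comm_ring_1 set \<Rightarrow> nat set \<Rightarrow> 'a mpoly set" where
  "polys_over B V = {p. (\<forall>\<alpha>. lookup p \<alpha> \<in> B) \<and> (\<forall>\<alpha>\<in>keys p. keys \<alpha> \<subseteq> V)}"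

abbreviation "polys \<equiv> polys_over UNIV"

lemma polys_in_eq: "polys_in n = polys {..<n}"
  by (simp add: polys_in_def polys_over_def)

text \<open>Subrings are kept as plain sets with the type class operations, because the later base
  ring K[y] only occurs as a subset of A.\<close>

definition subring_set :: "'a::comm_ring_1 set \<Rightarrow> bool" where
  "subring_set B \<longleftrightarrow> 0 \<in> B \<and> 1 \<in> B \<and> - 1 \<in> B \<and> (\<forall>a\<in>B. \<forall>b\<in>B. a + b \<in> B) \<and> (\<forall>a\<in>B. \<forall>b\<in>B. a * b \<in> B)"

lemma subring_setD:
  assumes "subring_set B"
  shows "0 \<in> B" "1 \<in> B" "a \<in> B \<Longrightarrow> b \<in> B \<Longrightarrow> a + b \<in> B" "a \<in> B \<Longrightarrow> b \<in> B \<Longrightarrow> a * b \<in> B"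
    "a \<in> B \<Longrightarrow> - a \<in> B" "a \<in> B \<Longrightarrow> b \<in> B \<Longrightarrow> a - b \<in> B"
proof -
  show *: "0 \<in> B" "1 \<in> B" "a \<in> B \<Longrightarrow> b \<in> B \<Longrightarrow> a + b \<in> B" "a \<in> B \<Longrightarrow> b \<in> B \<Longrightarrow> a * b \<in> B"
    for a b using assms by (auto simp: subring_set_def)
  show neg: "a \<in> B \<Longrightarrow> - a \<in> B" for a using *(4)[of "-1" a] assms by (auto simp: subring_set_def)
  show "a \<in> B \<Longrightarrow> b \<in> B \<Longrightarrow> a - b \<in> B" using *(3)[of a "- b"] neg[of b] by simp
qed

lemma subring_set_sum:
  assumes "subring_set B" "\<And>i. i \<in> A \<Longrightarrow> f i \<in> B" shows "(\<Sum>i\<in>A. f i) \<in> B"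
  using assms(2) by (induction A rule: infinite_finite_induct) (auto intro: subring_setD[OF assms(1)])

lemma subring_set_prod:
  assumes "subring_set B" "\<And>i. i \<in> A \<Longrightarrow> f i \<in> B" shows "(\<Prod>i\<in>A. f i) \<in> B"
  using assms(2) by (induction A rule: infinite_finite_induct) (auto intro: subring_setD[OF assms(1)])

lemma subring_set_power:
  assumes "subring_set B" "a \<in> B" shows "a ^ k \<in> B"
  using subring_set_prod[OF assms(1), of "{..<k}" "\<lambda>_. a"] assms(2) by simp

lemma subring_set_UNIV: "subring_set UNIV"
  by (simp add: subring_set_def)

lemma subring_set_image:
  assumes "comm_ring_hom \<phi>" "subring_set B" shows "subring_set (\<phi> ` B)"
proof -
  interpret comm_ring_hom \<phi> by fact
  show ?thesis unfolding subring_set_def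
  proof (intro conjI ballI)
    show "0 \<in> \<phi> ` B" by (rule image_eqI[of _ _ 0]) (auto intro: subring_setD[OF assms(2)])
    show "1 \<in> \<phi> ` B" by (rule image_eqI[of _ _ 1]) (auto intro: subring_setD[OF assms(2)])
    show "- 1 \<in> \<phi> ` B"
      by (rule image_eqI[of _ _ "-1"]) (auto simp: hom_uminus intro: subring_setD[OF assms(2)])
  next
    fix a b assume "a \<in> \<phi> ` B" "b \<in> \<phi> ` B"
    then obtain c d where "c \<in> B" "a = \<phi> c" "d \<in> B" "b = \<phi> d" by blast
    then show "a + b \<in> \<phi> ` B" "a * b \<in> \<phi> ` B"
      by (auto simp: hom_add[symmetric] hom_mult[symmetric] intro!: imageI subring_setD[OF assms(2)])
  qed
qed

lemma polys_over_mono: "p \<in> polys_over B V \<Longrightarrow> B \<subseteq> B' \<Longrightarrow> V \<subseteq> V' \<Longrightarrow> p \<in> polys_over B' V'"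
  by (fastforce simp: polys_over_def)

context
  fixes B :: "'a::comm_ring_1 set" and V :: "nat set"
  assumes B: "subring_set B"
begin

lemma polys_over_single: "c \<in> B \<Longrightarrow> keys \<alpha> \<subseteq> V \<Longrightarrow> single \<alpha> c \<in> polys_over B V"
  using subring_setD(1)[OF B] by (auto simp: polys_over_def lookup_single when_def)

lemma polys_over_cst: "c \<in> B \<Longrightarrow> cst c \<in> polys_over B V"
  by (simp add: cst_def polys_over_single)

lemma polys_over_var: "i \<in> V \<Longrightarrow> var i \<in> polys_over B V"
  by (simp add: var_def polys_over_single subring_setD(2)[OF B])

lemma polys_over_add: "p \<in> polys_over B V \<Longrightarrow> q \<in> polys_over B V \<Longrightarrow> p + q \<in> polys_over B V"
  using keys_add[of p q] subring_setD(3)[OF B] by (fastforce simp: polys_over_def lookup_add)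

lemma polys_over_zero: "0 \<in> polys_over B V"
  by (simp add: polys_over_def subring_setD(1)[OF B])

lemma polys_over_sum: "(\<And>i. i \<in> A \<Longrightarrow> f i \<in> polys_over B V) \<Longrightarrow> (\<Sum>i\<in>A. f i) \<in> polys_over B V"
  by (induction A rule: infinite_finite_induct) (auto intro: polys_over_zero polys_over_add)

lemma polys_over_mult:
  assumes "p \<in> polys_over B V" "q \<in> polys_over B V" shows "p * q \<in> polys_over B V"
proof -
  have eq: "p * q = (\<Sum>\<alpha>\<in>keys p. \<Sum>\<beta>\<in>keys q.
      single (\<alpha> + \<beta>) (lookup p \<alpha> * lookup q \<beta>))"
    by (subst (1) mpoly_expand[of p], subst (1) mpoly_expand[of q]) (simp add: sum_product mult_single)
  show ?thesis unfolding eq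
  proof (intro polys_over_sum polys_over_single)
    fix \<alpha> \<beta> assume "\<alpha> \<in> keys p" "\<beta> \<in> keys q"
    then show "keys (\<alpha> + \<beta>) \<subseteq> V"
      using assms keys_add[of \<alpha> \<beta>] by (fastforce simp: polys_over_def)
    show "lookup p \<alpha> * lookup q \<beta> \<in> B"
      using assms subring_setD(4)[OF B] by (simp add: polys_over_def)
  qed
qed

lemma subring_set_polys_over: "subring_set (polys_over B V)"
  unfolding subring_set_def
proof (intro conjI ballI)
  have "cst 1 \<in> polys_over B V" "cst (-1) \<in> polys_over B V"
    by (auto intro!: polys_over_cst subring_setD[OF B])
  then show "1 \<in> polys_over B V" "-1 \<in> polys_over B V" by (simp_all add: cst_def single_uminus)
qed (auto intro: polys_over_zero polys_over_add polys_over_mult)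

lemma polys_over_induct [consumes 2, case_names cst var add mult]:
  assumes "p \<in> polys_over B V"
    and cst: "\<And>c. c \<in> B \<Longrightarrow> P (cst c)" and var: "\<And>i. i \<in> V \<Longrightarrow> P (var i)"
    and add: "\<And>p q. P p \<Longrightarrow> P q \<Longrightarrow> P (p + q)" and mult: "\<And>p q. P p \<Longrightarrow> P q \<Longrightarrow> P (p * q)"
  shows "P p"
proof -
  have P0: "P 0" and P1: "P 1"
    using cst[of 0] cst[of 1] subring_setD[OF B] by (simp_all add: cst_def)
  have pow: "P (var i ^ k)" if "i \<in> V" for i k
    by (induction k) (auto intro: P1 mult var that)
  have prod: "P (\<Prod>i\<in>A. f i)" if "\<And>i. i \<in> A \<Longrightarrow> P (f i)" for A and f :: "nat \<Rightarrow> 'a mpoly"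
    using that by (induction A rule: infinite_finite_induct) (auto intro: P1 mult)
  have sum: "P (\<Sum>i\<in>A. f i)" if "\<And>i. i \<in> A \<Longrightarrow> P (f i)" for A and f :: "(nat \<Rightarrow>\<^sub>0 nat) \<Rightarrow> 'a mpoly"
    using that by (induction A rule: infinite_finite_induct) (auto intro: P0 add)
  show ?thesis
  proof (subst mpoly_expand, rule sum)
    fix \<alpha> assume \<alpha>: "\<alpha> \<in> keys p"
    then have "keys \<alpha> \<subseteq> V" "lookup p \<alpha> \<in> B"
      using assms(1) by (auto simp: polys_over_def)
    then show "P (single \<alpha> (lookup p \<alpha>))"
      unfolding single_eq_cst_mon mon_def by (auto intro!: mult cst prod pow)
  qed
qed

end

lemma evalp_mem:
  assumes "comm_ring_hom \<phi>" "subring_set C" "p \<in> polys_over B V" "subring_set B"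
    and "\<And>c. c \<in> B \<Longrightarrow> \<phi> c \<in> C" "\<And>i. i \<in> V \<Longrightarrow> x i \<in> C"
  shows "evalp \<phi> x p \<in> C"
  using assms(4,3)
  by (induction rule: polys_over_induct)
    (auto simp: assms evalp_add[OF assms(1)] evalp_mult[OF assms(1)] evalp_cst[OF assms(1)]
      evalp_var[OF assms(1)] intro: subring_setD[OF assms(2)])

lemma evalp_cong:
  assumes "\<And>\<alpha> i. \<alpha> \<in> keys p \<Longrightarrow> i \<in> keys \<alpha> \<Longrightarrow> x i = y i"
  shows "evalp \<phi> x p = evalp \<phi> y p"
  unfolding evalp_def by (intro sum.cong prod.cong arg_cong2[where f = "(*)"]) (auto simp: assms)

lemma hom_evalp:
  assumes "comm_ring_hom \<phi>" "comm_ring_hom H"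
  shows "H (evalp \<phi> x p) = evalp (\<lambda>c. H (\<phi> c)) (\<lambda>i. H (x i)) p"
proof -
  interpret comm_ring_hom H by fact
  show ?thesis by (simp add: evalp_def hom_distribs)
qed

section \<open>Partial derivatives\<close>

lemma pderiv_mp_superset:
  assumes "finite A" "keys p \<subseteq> A"
  shows "pderiv_mp j p = (\<Sum>\<alpha>\<in>A. single (\<alpha> - single j 1)
    (of_nat (lookup \<alpha> j) * lookup p \<alpha>))"
  unfolding pderiv_mp_def using assms
  by (intro sum.mono_neutral_left) (auto simp: not_in_keys_iff_lookup_eq_zero)

lemma pderiv_mp_add: "pderiv_mp j (p + q) = pderiv_mp j p + pderiv_mp j q"
proof -
  let ?A = "keys p \<union> keys q"
  have "keys (p + q) \<subseteq> ?A" by (rule keys_add)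
  then show ?thesis
    by (simp add: pderiv_mp_superset[of ?A] lookup_add distrib_left single_add sum.distrib)
qed

lemma pderiv_mp_single:
  "pderiv_mp j (single \<alpha> c) =
    single (\<alpha> - single j 1) (of_nat (lookup \<alpha> j) * c)"
  by (subst pderiv_mp_superset[of "{\<alpha>}"]) auto

lemma pderiv_mp_sum: "pderiv_mp j (\<Sum>i\<in>A. f i) = (\<Sum>i\<in>A. pderiv_mp j (f i))"
  by (induction A rule: infinite_finite_induct) (simp_all add: pderiv_mp_add pderiv_mp_def[of _ 0])

text \<open>Subtraction of exponents is truncated, so \<alpha> - e + \<beta> and \<alpha> + \<beta>
  - e differ when j does not occur in \<alpha>. In that case the coefficient is 0 and the exponent
  does not matter.\<close>

lemma pderiv_mp_mult_single:
  fixes a b :: "'a::comm_ring_1"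
  shows "pderiv_mp j (single \<alpha> a * single \<beta> b) =
    pderiv_mp j (single \<alpha> a) * single \<beta> b +
    single \<alpha> a * pderiv_mp j (single \<beta> b)"
proof -
  let ?e = "single j (1::nat)"
  have shift: "\<gamma> + \<delta> - ?e = (\<gamma> - ?e) + \<delta>" if "lookup \<gamma> j \<noteq> 0" for \<gamma> \<delta> :: "nat \<Rightarrow>\<^sub>0 nat"
    using that by (intro poly_mapping_eqI) (auto simp: lookup_add lookup_minus lookup_single when_def)
  have 1: "single (\<alpha> - ?e + \<beta>) (of_nat (lookup \<alpha> j) * a * b) =
      single (\<alpha> + \<beta> - ?e) (of_nat (lookup \<alpha> j) * a * b)"
    by (cases "lookup \<alpha> j = 0") (simp_all add: shift del: One_nat_def)
  have 2: "single (\<alpha> + (\<beta> - ?e)) (a * (of_nat (lookup \<beta> j) * b)) =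
      single (\<alpha> + \<beta> - ?e) (a * (of_nat (lookup \<beta> j) * b))"
    using shift[of \<beta> \<alpha>] by (cases "lookup \<beta> j = 0") (simp_all add: add.commute del: One_nat_def)
  show ?thesis
    by (simp only: mult_single pderiv_mp_single 1 2 single_add[symmetric])
      (simp add: lookup_add algebra_simps)
qed

lemma pderiv_mp_mult: "pderiv_mp j (p * q) = pderiv_mp j p * q + p * pderiv_mp j q"
proof -
  have "pderiv_mp j ((\<Sum>\<alpha>\<in>A. single \<alpha> (f \<alpha>)) * (\<Sum>\<beta>\<in>C. single \<beta> (g \<beta>))) =
    pderiv_mp j (\<Sum>\<alpha>\<in>A. single \<alpha> (f \<alpha>)) * (\<Sum>\<beta>\<in>C. single \<beta> (g \<beta>)) +
    (\<Sum>\<alpha>\<in>A. single \<alpha> (f \<alpha>)) * pderiv_mp j (\<Sum>\<beta>\<in>C. single \<beta> (g \<beta>))"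
    for A C and f g :: "(nat \<Rightarrow>\<^sub>0 nat) \<Rightarrow> 'a"
    by (simp add: sum_product pderiv_mp_sum pderiv_mp_mult_single sum.distrib)
  from this[where A = "keys p" and f = "lookup p"
      and C = "keys q" and g = "lookup q"]
  show ?thesis unfolding mpoly_expand[symmetric] .
qed

lemma pderiv_mp_cst [simp]: "pderiv_mp j (cst c) = 0"
  by (simp add: cst_def pderiv_mp_single)

lemma pderiv_mp_var [simp]: "pderiv_mp j (var i) = (if i = j then 1 else 0)"
proof (cases "i = j")
  case True
  then show ?thesis by (simp add: var_def pderiv_mp_single)
qed (simp add: var_def pderiv_mp_single lookup_single)

section \<open>Minors of maximal size\<close>

lemma inj_on_sort:
  fixes \<rho> :: "nat \<Rightarrow> nat"
  assumes "inj_on \<rho> {..<k}"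
  shows "\<exists>\<rho>' p. strict_mono_on {..<k} \<rho>' \<and> p permutes {0..<k} \<and> (\<forall>a<k. \<rho> a = \<rho>' (p a)) \<and>
    \<rho>' ` {..<k} = \<rho> ` {..<k}"
proof -
  define A where "A = \<rho> ` {..<k}"
  have A: "finite A" "card A = k" using assms by (auto simp: A_def card_image)
  define \<rho>' where "\<rho>' = (\<lambda>i. sorted_list_of_set A ! i)"
  have len: "length (sorted_list_of_set A) = k" using A by simp
  have mono: "strict_mono_on {..<k} \<rho>'"
    using sorted_wrt_nth_less[OF strict_sorted_list_of_set[of A]] len
    by (auto simp: strict_mono_on_def \<rho>'_def)
  have img: "\<rho>' ` {..<k} = A"
  proof -
    have "\<rho>' ` {..<k} = set (sorted_list_of_set A)"
      unfolding set_conv_nth using len by (auto simp: \<rho>'_def)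
    then show ?thesis by (simp only: set_sorted_list_of_set[OF A(1)])
  qed
  have inj: "inj_on \<rho>' {..<k}" using mono by (rule strict_mono_on_imp_inj_on)
  define p where "p = (\<lambda>a. if a < k then the_inv_into {..<k} \<rho>' (\<rho> a) else a)"
  have p: "p a < k" "\<rho>' (p a) = \<rho> a" if "a < k" for a
  proof -
    have "\<rho> a \<in> \<rho>' ` {..<k}" using that img by (simp add: A_def)
    then show "p a < k" "\<rho>' (p a) = \<rho> a"
      using the_inv_into_into[OF inj, of "\<rho> a" "{..<k}"] f_the_inv_into_f[OF inj, of "\<rho> a"] that
      by (auto simp: p_def)
  qed
  have "inj_on p {0..<k}"
    using assms p by (metis atLeastLessThan_iff inj_on_def lessThan_iff)
  moreover have "p ` {0..<k} \<subseteq> {0..<k}" using p by auto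
  ultimately have "bij_betw p {0..<k} {0..<k}"
    by (simp add: bij_betw_def endo_inj_surj)
  then have "p permutes {0..<k}" by (rule bij_imp_permutes) (auto simp: p_def)
  moreover have "\<forall>a<k. \<rho> a = \<rho>' (p a)" using p by simp
  ultimately show ?thesis using mono img unfolding A_def by blast
qed

definition submat :: "nat \<Rightarrow> (nat \<Rightarrow> nat \<Rightarrow> 'a) \<Rightarrow> (nat \<Rightarrow> nat) \<Rightarrow> (nat \<Rightarrow> nat) \<Rightarrow> 'a mat" where
  "submat k M \<rho> \<gamma> = mat k k (\<lambda>(a, b). M (\<rho> a) (\<gamma> b))"

lemma submat_carrier [simp]: "submat k M \<rho> \<gamma> \<in> carrier_mat k k"
  by (simp add: submat_def)

lemma submat_transpose: "(submat k M \<rho> \<gamma>)\<^sup>T = submat k (\<lambda>i j. M j i) \<gamma> \<rho>"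
  by (rule eq_matI) (auto simp: submat_def)

lemma det_submat_zero_rows:
  fixes M :: "nat \<Rightarrow> nat \<Rightarrow> 'a::comm_ring_1"
  assumes "\<And>\<rho>'. strict_mono_on {..<k} \<rho>' \<Longrightarrow> \<rho>' ` {..<k} \<subseteq> {..<m} \<Longrightarrow> det (submat k M \<rho>' \<gamma>) = 0"
    and "\<rho> ` {..<k} \<subseteq> {..<m}"
  shows "det (submat k M \<rho> \<gamma>) = 0"
proof (cases "inj_on \<rho> {..<k}")
  case True
  obtain \<rho>' p where *: "strict_mono_on {..<k} \<rho>'" "p permutes {0..<k}" "\<And>a. a < k \<Longrightarrow> \<rho> a = \<rho>' (p a)"
    "\<rho>' ` {..<k} = \<rho> ` {..<k}" using inj_on_sort[OF True] by blast
  have "submat k M \<rho> \<gamma> = mat k k (\<lambda>(i, j). submat k M \<rho>' \<gamma> $$ (p i, j))"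
    by (rule eq_matI) (use * permutes_in_image[OF *(2)] in \<open>auto simp: submat_def\<close>)
  then have "det (submat k M \<rho> \<gamma>) = signof p * det (submat k M \<rho>' \<gamma>)"
    using det_permute_rows[OF submat_carrier *(2)] by simp
  then show ?thesis using assms * by simp
next
  case False
  then obtain i j where "i < k" "j < k" "i \<noteq> j" "\<rho> i = \<rho> j" by (auto simp: inj_on_def)
  then show ?thesis
    by (intro det_identical_rows[OF submat_carrier, of i j]) (auto simp: submat_def)
qed

text \<open>Minors use increasing selections only, while bordering a minor appends an index in
  arbitrary position. Sorting rows changes a determinant by a sign, a repeated row makes it vanish,
  and transposition treats the columns.\<close>

lemma minors_zero_imp:
  fixes M :: "nat \<Rightarrow> nat \<Rightarrow> 'a::comm_ring_1"
  assumes "\<And>d. d \<in> minors m n M k \<Longrightarrow> d = 0"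
    and "\<rho> ` {..<k} \<subseteq> {..<m}" "\<gamma> ` {..<k} \<subseteq> {..<n}"
  shows "det (submat k M \<rho> \<gamma>) = 0"
proof (rule det_submat_zero_rows[OF _ assms(2)])
  fix \<rho>' assume \<rho>': "strict_mono_on {..<k} \<rho>'" "\<rho>' ` {..<k} \<subseteq> {..<m}"
  have "det (submat k (\<lambda>i j. M j i) \<gamma> \<rho>') = 0"
  proof (rule det_submat_zero_rows[OF _ assms(3)])
    fix \<gamma>' assume \<gamma>': "strict_mono_on {..<k} \<gamma>'" "\<gamma>' ` {..<k} \<subseteq> {..<n}"
    have "det (submat k M \<rho>' \<gamma>') = 0"
      using \<rho>' \<gamma>' by (intro assms(1)) (auto simp: minors_def submat_def)
    then show "det (submat k (\<lambda>i j. M j i) \<gamma>' \<rho>') = 0"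
      using det_transpose[OF submat_carrier[of k M \<rho>' \<gamma>']] by (simp add: submat_transpose)
  qed
  then show "det (submat k M \<rho>' \<gamma>) = 0"
    using det_transpose[OF submat_carrier[of k M \<rho>' \<gamma>]] by (simp add: submat_transpose)
qed

text \<open>An increasing selection among m rows has size at most m. This makes the set in
  \<open>mat_rank\<close> finite, so that its maximum really is an upper bound.\<close>

lemma minors_above_rank:
  fixes M :: "nat \<Rightarrow> nat \<Rightarrow> 'a::idom"
  assumes "k > mat_rank m n M" "d \<in> minors m n M k"
  shows "d = 0"
proof (rule ccontr)
  assume "d \<noteq> 0"
  have le: "k \<le> m" if "d \<in> minors m n M k" for k d
  proof -
    obtain \<rho> where "strict_mono_on {..<k} \<rho>" "\<rho> ` {..<k} \<subseteq> {..<m}"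
      using \<open>d \<in> minors m n M k\<close> unfolding minors_def by blast
    then show "k \<le> m"
      using card_inj_on_le[OF strict_mono_on_imp_inj_on, of "{..<k}" \<rho> "{..<m}"] by simp
  qed
  have "{k. \<exists>d\<in>minors m n M k. d \<noteq> 0} \<subseteq> {..m}"
    using le by blast
  then have "finite {k. \<exists>d\<in>minors m n M k. d \<noteq> 0}"
    by (rule finite_subset) simp
  then have "k \<le> mat_rank m n M"
    unfolding mat_rank_def using assms(2) \<open>d \<noteq> 0\<close> by (intro Max_ge) auto
  then show False using assms(1) by simp
qed

text \<open>Expanding the vanishing bordered minor along its last row: the cofactors do not depend on
  the bordering row.\<close>
lemma bordered_minor_relation:
  fixes M :: "nat \<Rightarrow> nat \<Rightarrow> 'a::idom"
  assumes r: "r = mat_rank m n M" and \<rho>: "\<rho> ` {..<r} \<subseteq> {..<m}" and \<gamma>: "\<gamma> ` {..<r} \<subseteq> {..<n}"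
    and j: "j < n"
  shows "\<exists>v. \<forall>i<m. (\<Sum>c<r. M i (\<gamma> c) * v c) + M i j * det (submat r M \<rho> \<gamma>) = 0"
proof -
  define N where "N = (\<lambda>i. submat (Suc r) M (\<lambda>a. if a < r then \<rho> a else i) (\<lambda>b. if b < r then \<gamma> b else j))"
  define v where "v = (\<lambda>b. cofactor (N 0) r b)"
  have N: "N i \<in> carrier_mat (Suc r) (Suc r)" for i by (simp add: N_def)
  have cof: "cofactor (N i) r b = v b" for i b
  proof -
    have "mat_delete (N i) r b = mat_delete (N 0) r b"
      by (rule eq_matI) (auto simp: mat_delete_def N_def submat_def)
    then show ?thesis by (simp add: v_def cofactor_def)
  qed
  have last: "v r = det (submat r M \<rho> \<gamma>)"
  proof -
    have "mat_delete (N 0) r r = submat r M \<rho> \<gamma>"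
      by (rule eq_matI) (auto simp: mat_delete_def N_def submat_def)
    then show ?thesis by (simp add: v_def cofactor_def mult_2[symmetric])
  qed
  have "(\<Sum>c<r. M i (\<gamma> c) * v c) + M i j * det (submat r M \<rho> \<gamma>) = 0" if i: "i < m" for i
  proof -
    have "det (N i) = 0" unfolding N_def
    proof (rule minors_zero_imp[where m = m and n = n])
      show "d = 0" if "d \<in> minors m n M (Suc r)" for d
        using minors_above_rank[OF _ that] r by simp
    qed (use \<rho> \<gamma> i j in auto)
    moreover have "det (N i) = (\<Sum>b<Suc r. N i $$ (r, b) * cofactor (N i) r b)"
      by (rule laplace_expansion_row[OF N]) simp
    ultimately show ?thesis by (simp add: cof last) (simp add: N_def submat_def)
  qed
  then show ?thesis by blast
qed

section \<open>Algebraic independence of the free coordinates\<close>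

lemma lookup_pderiv_mp:
  "lookup (pderiv_mp j p) \<beta> =
    of_nat (Suc (lookup \<beta> j)) * lookup p (\<beta> + single j 1)"
proof -
  let ?e = "single j (1::nat)"
  have "lookup (pderiv_mp j p) \<beta> = (\<Sum>\<alpha>\<in>keys p.
      if \<alpha> = \<beta> + ?e then of_nat (Suc (lookup \<beta> j)) * lookup p \<alpha> else 0)"
    unfolding pderiv_mp_def lookup_sum
  proof (rule sum.cong[OF refl])
    fix \<alpha>
    show "lookup (single (\<alpha> - ?e)
        (of_nat (lookup \<alpha> j) * lookup p \<alpha>)) \<beta> =
      (if \<alpha> = \<beta> + ?e then of_nat (Suc (lookup \<beta> j)) * lookup p \<alpha> else 0)"
    proof (cases "lookup \<alpha> j = 0")
      case True
      then have "\<alpha> \<noteq> \<beta> + ?e" by (auto simp: lookup_add)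
      then show ?thesis using True by (simp add: lookup_single)
    next
      case False
      have "\<alpha> = (\<alpha> - ?e) + ?e"
        using False by (intro poly_mapping_eqI) (auto simp: lookup_add lookup_minus lookup_single when_def)
      then have "\<alpha> - ?e = \<beta> \<longleftrightarrow> \<alpha> = \<beta> + ?e" by (metis add_diff_cancel_right')
      then show ?thesis by (auto simp: lookup_single when_def lookup_add)
    qed
  qed
  then show ?thesis by (simp add: not_in_keys_iff_lookup_eq_zero)
qed

lemma poly_mapping_pred_add:
  fixes \<alpha> :: "nat \<Rightarrow>\<^sub>0 nat"
  assumes "lookup \<alpha> j \<noteq> 0"
  shows "\<alpha> - single j 1 + single j 1 = \<alpha>"
  using assms by (intro poly_mapping_eqI) (auto simp: lookup_add lookup_minus lookup_single when_def)

text \<open>In positive characteristic a polynomial with vanishing partial derivatives is a p-th power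
  of a polynomial of smaller degree, because the base field is perfect.\<close>
lemma alg_independentI:
  fixes \<iota> :: "'k::field \<Rightarrow> 'a::idom"
  assumes "comm_ring_hom \<iota>" and perf: "perfect_field TYPE('k)" and V: "V \<subseteq> {..<n}"
    and der: "\<And>g j. g \<in> polys V \<Longrightarrow> evalp \<iota> x g = 0 \<Longrightarrow> j < n \<Longrightarrow> evalp \<iota> x (pderiv_mp j g) = 0"
    and "g \<in> polys V" "evalp \<iota> x g = 0"
  shows "g = 0"
proof -
  interpret \<iota>: comm_ring_hom \<iota> by fact
  have \<iota>0: "c = 0" if "\<iota> c = 0" for c
    using that \<iota>.hom_mult[of c "inverse c"] by (cases "c = 0") auto
  define tdeg where "tdeg = (\<lambda>\<alpha>. \<Sum>i<n. lookup \<alpha> i :: nat)"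
  have "\<forall>g\<in>polys V. (\<forall>\<alpha>\<in>keys g. tdeg \<alpha> < D) \<longrightarrow> evalp \<iota> x g = 0 \<longrightarrow> g = 0" for D
  proof (induction D)
    case 0
    then show ?case by (auto simp: keys_eq_empty)
  next
    case (Suc D)
    show ?case
    proof (intro ballI impI)
      fix g :: "'k mpoly"
      assume g: "g \<in> polys V" and deg: "\<forall>\<alpha>\<in>keys g. tdeg \<alpha> < Suc D"
        and ev: "evalp \<iota> x g = 0"
      have gk: "keys \<alpha> \<subseteq> V" if "\<alpha> \<in> keys g" for \<alpha>
        using g that by (auto simp: polys_over_def)
      have pd: "pderiv_mp j g = 0" if j: "j < n" for j
      proof -
        have keys: "\<beta> + single j 1 \<in> keys g"
          if "\<beta> \<in> keys (pderiv_mp j g)" for \<beta>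
          using that by (auto simp: in_keys_iff lookup_pderiv_mp)
        have sub: "keys \<beta> \<subseteq> keys (\<beta> + single j (1::nat))" for \<beta>
          by (auto simp: in_keys_iff lookup_add)
        have "pderiv_mp j g \<in> polys V"
          unfolding polys_over_def using keys gk sub by blast
        moreover have "tdeg \<beta> < D" if "\<beta> \<in> keys (pderiv_mp j g)" for \<beta>
        proof -
          have "tdeg \<beta> < tdeg (\<beta> + single j 1)"
            unfolding tdeg_def using j by (intro sum_strict_mono_ex1) (auto simp: lookup_add lookup_single when_def)
          then show ?thesis using deg keys[OF that] by force
        qed
        ultimately show ?thesis using Suc.IH der[OF g ev j] by blast
      qed
      \<comment> \<open>Up to naming, the coefficient of the j-th derivative at \<alpha> - e_j is
        \<alpha>_j times the nonzero coefficient of g at \<alpha>.\<close>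
      have char: "of_nat (lookup \<alpha> j) = (0::'k)" if \<alpha>: "\<alpha> \<in> keys g" for \<alpha> j
      proof (cases "lookup \<alpha> j = 0")
        case False
        then have "j \<in> keys \<alpha>" by (simp add: in_keys_iff)
        then have "j < n" using gk[OF \<alpha>] V by blast
        have "lookup (pderiv_mp j g) (\<alpha> - single j 1) = 0"
          using pd[OF \<open>j < n\<close>] by simp
        moreover have "lookup (\<alpha> - single j 1 + single j 1) j
            = Suc (lookup (\<alpha> - single j 1) j)" by (simp add: lookup_add)
        ultimately show ?thesis
          using \<alpha> unfolding lookup_pderiv_mp poly_mapping_pred_add[OF False] by (auto simp: in_keys_iff)
      qed simp
      show "g = 0"
      proof (cases "\<forall>\<alpha>\<in>keys g. \<alpha> = 0")
        case True
        then have "g = cst (lookup g 0)"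
          by (intro poly_mapping_eqI) (auto simp: cst_def lookup_single when_def in_keys_iff)
        then show ?thesis using ev \<iota>0 evalp_cst[OF assms(1)] by (metis cst_def single_zero)
      next
        case False
        then obtain \<alpha>0 where \<alpha>0: "\<alpha>0 \<in> keys g" "\<alpha>0 \<noteq> 0" by blast
        then obtain j0 where j0: "lookup \<alpha>0 j0 \<noteq> 0"
          by (metis lookup_zero poly_mapping_eqI)
        define p where "p = CHAR('k)"
        have dvd: "p dvd lookup \<alpha> j" if "\<alpha> \<in> keys g" for \<alpha> j
          using char[OF that, of j] by (simp add: p_def of_nat_eq_0_iff_char_dvd)
        \<comment> \<open>This excludes characteristic 0: p divides the nonzero exponent of j0 in
          \<alpha>0.\<close>
        have "p \<noteq> 0" using dvd[OF \<alpha>0(1), of j0] j0 by auto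
        then have prime: "prime p" unfolding p_def using prime_CHAR_semidom by blast
        have charA: "CHAR('a) = p"
        proof -
          have "of_nat k = (0::'a) \<longleftrightarrow> of_nat k = (0::'k)" for k
            using \<iota>0[of "of_nat k"] by (auto simp: \<iota>.hom_of_nat) (metis \<iota>.hom_of_nat \<iota>.hom_zero)
          then have "CHAR('a) dvd k \<longleftrightarrow> CHAR('k) dvd k" for k
            by (simp add: of_nat_eq_0_iff_char_dvd)
          then show ?thesis unfolding p_def by (meson dvd_antisym dvd_refl)
        qed
        obtain rt where rt: "\<And>a::'k. rt a ^ p = a"
          using perf \<open>p \<noteq> 0\<close> unfolding perfect_field_def p_def by metis
        define dv where "dv = (\<lambda>\<alpha>::nat \<Rightarrow>\<^sub>0 nat. Poly_Mapping.map (\<lambda>k. k div p) \<alpha>)"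
        have dv: "lookup (dv \<alpha>) i = lookup \<alpha> i div p" for \<alpha> i
          by (simp add: dv_def map.rep_eq when_def)
        have dv_mult: "lookup \<alpha> i = lookup (dv \<alpha>) i * p" if "\<alpha> \<in> keys g" for \<alpha> i
          using dvd[OF that] by (simp add: dv)
        have dv_inj: "inj_on dv (keys g)"
          by (rule inj_onI, rule poly_mapping_eqI) (metis dv_mult)
        have dv_keys: "keys (dv \<alpha>) \<subseteq> keys \<alpha>" for \<alpha>
          by (auto simp: in_keys_iff dv intro: ccontr)
        \<comment> \<open>Exponents are divided by p and coefficients replaced by p-th roots, so
          that the value of g is the p-th power of the value of h.\<close>
        define h where "h = (\<Sum>\<alpha>\<in>keys g. single (dv \<alpha>) (rt (lookup g \<alpha>)))"
        have h: "h \<in> polys V" unfolding h_def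
          using dv_keys gk by (intro polys_over_sum polys_over_single subring_set_UNIV) auto
        have hkeys: "\<exists>\<alpha>\<in>keys g. \<beta> = dv \<alpha>" if "\<beta> \<in> keys h" for \<beta>
        proof (rule ccontr)
          assume "\<not> ?thesis"
          then have "lookup h \<beta> = 0"
            by (auto simp: h_def lookup_sum lookup_single when_def intro!: sum.neutral)
          then show False using that by (simp add: in_keys_iff)
        qed
        have "tdeg \<beta> < D" if \<beta>h: "\<beta> \<in> keys h" for \<beta>
        proof -
          obtain \<alpha> where \<alpha>: "\<alpha> \<in> keys g" "\<beta> = dv \<alpha>" using hkeys[OF \<beta>h] by blast
          then have eq: "tdeg \<alpha> = tdeg \<beta> * p"
            using dv_mult[OF \<alpha>(1)] by (simp add: tdeg_def sum_distrib_right)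
          show ?thesis
          proof (cases "tdeg \<beta> = 0")
            \<comment> \<open>Division by p does not lower degree 0. Here strictness comes from D >
              0, which the nonconstant exponent \<alpha>0 of degree at most D provides.\<close>
            case True
            have "j0 \<in> keys \<alpha>0" using j0 by (simp add: in_keys_iff)
            then have "j0 < n" using gk[OF \<alpha>0(1)] V by blast
            then have "tdeg \<alpha>0 > 0" using j0 unfolding tdeg_def
              by (metis finite_lessThan gr0I lessThan_iff sum_eq_0_iff)
            then show ?thesis using deg \<alpha>0(1) True by force
          next
            case False
            then have "tdeg \<beta> < tdeg \<alpha>" using eq prime_gt_1_nat[OF prime] by simp
            then show ?thesis using deg \<alpha>(1) by force
          qed
        qed
        moreover have "evalp \<iota> x h = 0"
        proof -
          have mon_p: "mon x \<alpha> = mon x (dv \<alpha>) ^ p" if "\<alpha> \<in> keys g" for \<alpha>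
            unfolding mon_superset[OF finite_keys dv_keys[of \<alpha>]] mon_def[of x \<alpha>] prod_power_distrib
            by (intro prod.cong refl) (simp add: dv_mult[OF that] power_mult)
          \<comment> \<open>The Frobenius map on A is additive because A has the same characteristic
            p as K.\<close>
          have "evalp \<iota> x h ^ p = (\<Sum>\<alpha>\<in>keys g. (\<iota> (rt (lookup g \<alpha>)) * mon x (dv \<alpha>)) ^ p)"
            unfolding h_def evalp_sum[OF assms(1)] evalp_single[OF assms(1)]
            by (rule freshmans_dream_sum) (simp_all add: prime charA)
          also have "\<dots> = evalp \<iota> x g"
            unfolding evalp_mon
            by (intro sum.cong) (simp_all add: power_mult_distrib mon_p \<iota>.hom_power[symmetric] rt)
          finally show ?thesis using ev by simp
        qed
        ultimately have "h = 0" using Suc.IH h by blast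
        moreover have "lookup h (dv \<alpha>0) = rt (lookup g \<alpha>0)"
        proof -
          have "lookup h (dv \<alpha>0) = (\<Sum>\<alpha>\<in>keys g.
              if \<alpha> = \<alpha>0 then rt (lookup g \<alpha>) else 0)"
            unfolding h_def lookup_sum
            by (intro sum.cong) (auto simp: lookup_single when_def inj_on_eq_iff[OF dv_inj] \<alpha>0)
          then show ?thesis using \<alpha>0(1) by simp
        qed
        ultimately have "rt (lookup g \<alpha>0) ^ p = 0" using \<open>p \<noteq> 0\<close> by simp
        then show ?thesis using \<alpha>0(1) by (simp add: rt in_keys_iff)
      qed
    qed
  qed
  from this[of "Suc (Max (insert 0 (tdeg ` keys g)))"] show ?thesis
    using assms(5,6) by (simp add: less_Suc_eq_le Max_ge)
qed

section \<open>Nondegenerate zeros of polynomial systems over a subring\<close>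

lemma det_mem:
  assumes S: "subring_set S" and A: "A \<in> carrier_mat n n"
    and "\<And>i j. i < n \<Longrightarrow> j < n \<Longrightarrow> A $$ (i, j) \<in> S"
  shows "det A \<in> S"
  unfolding det_def'[OF A]
proof (intro subring_set_sum[OF S] subring_setD(4)[OF S] subring_set_prod[OF S])
  fix p assume p: "p \<in> {p. p permutes {0..<n}}"
  show "signof p \<in> S" using subring_setD[OF S] by (auto simp: sign_def)
  fix i assume "i \<in> {0..<n}"
  then show "A $$ (i, p i) \<in> S" using assms(3) permutes_in_image[of p "{0..<n}" i] p by simp
qed

lemma adj_mat_mem:
  assumes S: "subring_set S" and A: "A \<in> carrier_mat n n"
    and "\<And>i j. i < n \<Longrightarrow> j < n \<Longrightarrow> A $$ (i, j) \<in> S" "i < n" "j < n"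
  shows "adj_mat A $$ (i, j) \<in> S"
proof -
  have "det (mat_delete A j i) \<in> S"
    using assms by (intro det_mem[OF S mat_delete_carrier[OF A]]) (auto simp: mat_delete_def)
  moreover have "(-1) ^ k \<in> S" for k
    using subring_setD[OF S] by (intro subring_set_power[OF S]) auto
  ultimately show ?thesis using assms subring_setD(4)[OF S] by (simp add: adj_mat_def cofactor_def)
qed

lemma id_hom: "comm_ring_hom (\<lambda>c::'a::comm_ring_1. c)"
  by (rule comm_ring_homI) auto

lemma lookup_cst_mult: "lookup (cst c * p) \<alpha> = c * lookup p \<alpha>"
proof -
  have "cst c * p = (\<Sum>\<beta>\<in>keys p. single \<beta> (c * lookup p \<beta>))"
    by (subst (1) mpoly_expand[of p]) (simp add: sum_distrib_left cst_def mult_single)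
  then show ?thesis
    by (auto simp: lookup_sum lookup_single when_def not_in_keys_iff_lookup_eq_zero)
qed

section \<open>Linear independence over a subring, with denominators\<close>

definition free_over :: "'a::comm_ring_1 set \<Rightarrow> 'a set \<Rightarrow> bool" where
  "free_over B E \<longleftrightarrow> finite E \<and>
    (\<forall>c. (\<forall>e\<in>E. c e \<in> B) \<longrightarrow> (\<Sum>e\<in>E. c e * e) = 0 \<longrightarrow> (\<forall>e\<in>E. c e = 0))"

lemma free_overD:
  "free_over B E \<Longrightarrow> (\<And>e. e \<in> E \<Longrightarrow> c e \<in> B) \<Longrightarrow> (\<Sum>e\<in>E. c e * e) = 0 \<Longrightarrow> e \<in> E \<Longrightarrow> c e = 0"
  by (simp add: free_over_def)

text \<open>The subring is not a field, so only a multiple of s can be expected in the span of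
  \<open>E\<close>; the factor b is the denominator.\<close>

definition expands :: "'a::comm_ring_1 set \<Rightarrow> 'a set \<Rightarrow> 'a \<Rightarrow> 'a \<Rightarrow> bool" where
  "expands B E b s \<longleftrightarrow> (\<exists>c. (\<forall>e\<in>E. c e \<in> B) \<and> b * s = (\<Sum>e\<in>E. c e * e))"

text \<open>Elements of \<open>S\<close> are processed one at a time: an independent one joins the
  set, a dependent one contributes a denominator. Keeping \<open>E0\<close> inside the new set is
  what later allows coefficients to be compared along a set fixed beforehand.\<close>

lemma free_over_extend:
  fixes B :: "'a::idom set"
  assumes B: "subring_set B" and "finite S" "free_over B E0"
  shows "\<exists>E. E0 \<subseteq> E \<and> free_over B E \<and> (\<exists>b\<in>B. b \<noteq> 0 \<and> (\<forall>s\<in>S. expands B E b s))"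
  using assms(2)
proof (induction S)
  case empty
  show ?case using assms(3) subring_setD(2)[OF B] by (intro exI[of _ E0] conjI bexI[of _ 1]) auto
next
  case (insert s S)
  then obtain E b where E: "E0 \<subseteq> E" "free_over B E" "b \<in> B" "b \<noteq> 0" "\<forall>t\<in>S. expands B E b t" by blast
  have fin: "finite E" using E(2) by (simp add: free_over_def)
  show ?case
  proof (cases "free_over B (insert s E) \<and> s \<notin> E")
    case True
    have "expands B (insert s E) b t" if t: "t \<in> insert s S" for t
    proof (cases "t = s")
      case True
      have "(\<Sum>e\<in>insert s E. (if e = s then b else 0) * e) = b * s"
        using fin by (simp add: if_distrib[of "\<lambda>z. z * _"] sum.delta cong: if_cong)
      then show ?thesis unfolding expands_def using True E subring_setD(1)[OF B]
        by (intro exI[of _ "\<lambda>e. if e = s then b else 0"]) auto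
    next
      case False
      then obtain c where c: "\<forall>e\<in>E. c e \<in> B" "b * t = (\<Sum>e\<in>E. c e * e)"
        using E(5) t by (auto simp: expands_def)
      have "(\<Sum>e\<in>E. (c(s := 0)) e * e) = (\<Sum>e\<in>E. c e * e)"
        using True by (intro sum.cong) auto
      then have "b * t = (\<Sum>e\<in>insert s E. (c(s := 0)) e * e)" using True fin c(2) by simp
      then show ?thesis unfolding expands_def using c(1) subring_setD(1)[OF B]
        by (intro exI[of _ "c(s := 0)"]) auto
    qed
    then show ?thesis using E True by (intro exI[of _ "insert s E"]) auto
  next
    case False
    \<comment> \<open>Unless s already lies in \<open>E\<close>, there is a nontrivial relation. It
      must involve s, because \<open>E\<close> is free, and the coefficient of s is the new
      denominator.\<close>
    have "\<exists>d\<in>B. d \<noteq> 0 \<and> expands B E d s"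
    proof (cases "s \<in> E")
      case True
      have "(\<Sum>e\<in>E. (if e = s then 1 else 0) * e) = 1 * s"
        using fin True by (simp add: if_distrib[of "\<lambda>z. z * _"] sum.delta cong: if_cong)
      then have "expands B E 1 s" unfolding expands_def using subring_setD[OF B]
        by (intro exI[of _ "\<lambda>e. if e = s then 1 else 0"]) auto
      then show ?thesis using subring_setD(2)[OF B] by (intro bexI[of _ 1]) auto
    next
      case s: False
      then obtain c where c: "\<forall>e\<in>insert s E. c e \<in> B" "(\<Sum>e\<in>insert s E. c e * e) = 0" "\<exists>e\<in>insert s E. c e \<noteq> 0"
        using False fin by (auto simp: free_over_def)
      then have eq: "c s * s = (\<Sum>e\<in>E. - c e * e)"
        using s fin by (simp add: sum_negf eq_neg_iff_add_eq_0)
      have "c s \<noteq> 0"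
      proof
        assume "c s = 0"
        then have "(\<Sum>e\<in>E. c e * e) = 0" using c(2) s fin by simp
        then show False using E(2) c(1,3) \<open>c s = 0\<close> by (auto simp: free_over_def)
      qed
      moreover have "expands B E (c s) s" unfolding expands_def
        using eq c(1) subring_setD(5)[OF B] by (intro exI[of _ "\<lambda>e. - c e"]) auto
      ultimately show ?thesis using c(1) by blast
    qed
    then obtain d where d: "d \<in> B" "d \<noteq> 0" "expands B E d s" by blast
    have scale: "expands B E (a * b') t" if b': "expands B E b' t" "a \<in> B" for a b' t
    proof -
      obtain c where "\<forall>e\<in>E. c e \<in> B" "b' * t = (\<Sum>e\<in>E. c e * e)" using b'(1) by (auto simp: expands_def)
      then have "a * b' * t = (\<Sum>e\<in>E. a * c e * e)" "\<forall>e\<in>E. a * c e \<in> B"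
        using b'(2) subring_setD(4)[OF B] by (simp_all add: mult.assoc sum_distrib_left)
      then show ?thesis unfolding expands_def by (intro exI[of _ "\<lambda>e. a * c e"]) auto
    qed
    have "\<forall>t\<in>insert s S. expands B E (b * d) t"
      using scale[OF d(3) E(3)] scale[OF _ d(1)] E(5) by (auto simp: mult.commute)
    then show ?thesis using E d subring_setD(4)[OF B] by (intro exI[of _ E] conjI bexI[of _ "b * d"]) auto
  qed
qed

text \<open>The same with polynomial coefficients: the elements of \<open>E\<close> enter as
  constants, and one denominator serves all coefficients of p.\<close>

definition expands_poly :: "'a::comm_ring_1 set \<Rightarrow> nat set \<Rightarrow> 'a set \<Rightarrow> 'a \<Rightarrow> 'a mpoly \<Rightarrow> bool" where
  "expands_poly B V E b p \<longleftrightarrow>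
    (\<exists>c. (\<forall>e\<in>E. c e \<in> polys_over B V) \<and> cst b * p = (\<Sum>e\<in>E. cst e * c e))"

lemma expands_polyI:
  assumes B: "subring_set B" and p: "p \<in> polys V"
    and ex: "\<And>\<alpha>. \<alpha> \<in> keys p \<Longrightarrow> expands B E b (lookup p \<alpha>)"
  shows "expands_poly B V E b p"
proof -
  obtain c where c: "\<And>\<alpha> e. \<alpha> \<in> keys p \<Longrightarrow> e \<in> E \<Longrightarrow> c \<alpha> e \<in> B"
    "\<And>\<alpha>. \<alpha> \<in> keys p \<Longrightarrow> b * lookup p \<alpha> = (\<Sum>e\<in>E. c \<alpha> e * e)"
    using ex unfolding expands_def by metis
  define d where "d = (\<lambda>e. \<Sum>\<alpha>\<in>keys p. single \<alpha> (c \<alpha> e))"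
  have "d e \<in> polys_over B V" if "e \<in> E" for e
    unfolding d_def using c(1) that p
    by (intro polys_over_sum[OF B] polys_over_single[OF B]) (auto simp: polys_over_def)
  moreover have "cst b * p = (\<Sum>e\<in>E. cst e * d e)"
  proof -
    have "cst b * p = (\<Sum>\<alpha>\<in>keys p. single \<alpha> (\<Sum>e\<in>E. c \<alpha> e * e))"
      by (subst (1) mpoly_expand[of p]) (simp add: sum_distrib_left cst_def mult_single c(2))
    also have "\<dots> = (\<Sum>\<alpha>\<in>keys p. \<Sum>e\<in>E. cst e * single \<alpha> (c \<alpha> e))"
    proof (rule sum.cong[OF refl])
      fix \<alpha>
      show "single \<alpha> (\<Sum>e\<in>E. c \<alpha> e * e) = (\<Sum>e\<in>E. cst e * single \<alpha> (c \<alpha> e))"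
        by (induction E rule: infinite_finite_induct)
          (simp_all add: single_add cst_def mult_single mult.commute)
    qed
    also have "\<dots> = (\<Sum>e\<in>E. cst e * d e)"
      by (subst sum.swap) (simp add: d_def sum_distrib_left)
    finally show ?thesis .
  qed
  ultimately show ?thesis unfolding expands_poly_def by blast
qed

lemma free_over_extend_polys:
  fixes B :: "'a::idom set"
  assumes B: "subring_set B" and "free_over B E0" "finite S" "finite P" "P \<subseteq> polys V"
  shows "\<exists>E. E0 \<subseteq> E \<and> free_over B E \<and> (\<exists>b\<in>B. b \<noteq> 0 \<and> (\<forall>s\<in>S. expands B E b s) \<and>
    (\<forall>p\<in>P. expands_poly B V E b p))"
proof -
  let ?S = "S \<union> (\<Union>p\<in>P. lookup p ` keys p)"
  have "finite ?S" using assms by auto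
  from free_over_extend[OF B this assms(2)] obtain E b where *: "E0 \<subseteq> E" "free_over B E" "b \<in> B" "b \<noteq> 0"
    "\<forall>s\<in>?S. expands B E b s" by blast
  have "expands_poly B V E b p" if "p \<in> P" for p
    using * that assms(5) by (intro expands_polyI[OF B]) auto
  then show ?thesis using * by blast
qed

lemma free_over_polys:
  assumes "free_over B E" "\<And>e. e \<in> E \<Longrightarrow> c e \<in> polys_over B V" "(\<Sum>e\<in>E. cst e * c e) = 0" "e \<in> E"
  shows "c e = 0"
proof (rule poly_mapping_eqI)
  fix \<alpha>
  have "(\<Sum>e\<in>E. lookup (c e) \<alpha> * e) = 0"
    using arg_cong[OF assms(3), of "\<lambda>p. lookup p \<alpha>"]
    by (simp add: lookup_sum lookup_cst_mult mult.commute)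
  moreover have "lookup (c e) \<alpha> \<in> B" if "e \<in> E" for e
    using assms(2)[OF that] by (auto simp: polys_over_def)
  ultimately show "lookup (c e) \<alpha> = lookup 0 \<alpha>"
    using free_overD[OF assms(1) _ _ assms(4), of "\<lambda>e. lookup (c e) \<alpha>"] by simp
qed

text \<open>The quotients \<open>G c\<close> are not unique, but their values at \<xi> are. Staying
  at first order keeps the expansion free of factorials.\<close>

lemma mpoly_taylor:
  fixes p :: "'a::comm_ring_1 mpoly"
  assumes "p \<in> polys {..<r}"
  shows "\<exists>G. (\<forall>c. G c \<in> polys {..<r}) \<and>
    p = cst (evalp (\<lambda>c. c) \<xi> p) + (\<Sum>c<r. (var c - cst (\<xi> c)) * G c) \<and>
    (\<forall>c<r. evalp (\<lambda>c. c) \<xi> (G c) = evalp (\<lambda>c. c) \<xi> (pderiv_mp c p))"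
  using subring_set_UNIV assms
proof (induction rule: polys_over_induct)
  let ?e = "evalp (\<lambda>c. c) \<xi> :: 'a mpoly \<Rightarrow> 'a"
  interpret ev: comm_ring_hom ?e by (rule evalp_hom[OF id_hom])
  interpret cst: comm_ring_hom "cst :: 'a \<Rightarrow> 'a mpoly" by (rule cst_hom)
  note mem = polys_over_add[OF subring_set_UNIV] polys_over_mult[OF subring_set_UNIV]
    polys_over_zero[OF subring_set_UNIV] polys_over_cst[OF subring_set_UNIV UNIV_I]
  {
    case (cst c)
    then show ?case by (intro exI[of _ "\<lambda>_. 0"]) (auto simp: mem evalp_cst[OF id_hom])
  next
    case (var i)
    have "1 \<in> polys {..<r}"
      using subring_set_polys_over[OF subring_set_UNIV] by (rule subring_setD)
    moreover have "(\<Sum>c<r. (var c - cst (\<xi> c)) * (if i = c then 1 else 0)) = var i - cst (\<xi> i)"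
      using var by (simp add: if_distrib[of "\<lambda>z. _ * z"] sum.delta' cong: if_cong)
    ultimately show ?case
      by (intro exI[of _ "\<lambda>c. if i = c then 1 else 0"]) (auto simp: mem evalp_var[OF id_hom])
  next
    case (add p q)
    then obtain G H where *: "\<forall>c. G c \<in> polys {..<r}"
      "p = cst (?e p) + (\<Sum>c<r. (var c - cst (\<xi> c)) * G c)"
      "\<forall>c<r. ?e (G c) = ?e (pderiv_mp c p)"
      "\<forall>c. H c \<in> polys {..<r}"
      "q = cst (?e q) + (\<Sum>c<r. (var c - cst (\<xi> c)) * H c)"
      "\<forall>c<r. ?e (H c) = ?e (pderiv_mp c q)" by blast
    have "p + q = cst (?e (p + q)) + (\<Sum>c<r. (var c - cst (\<xi> c)) * (G c + H c))"
      by (subst (1) *(2), subst (1) *(5)) (simp add: distrib_left sum.distrib ev.hom_add cst.hom_add)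
    moreover have "\<forall>c<r. ?e (G c + H c) = ?e (pderiv_mp c (p + q))"
      using *(3,6) by (simp add: ev.hom_add pderiv_mp_add)
    ultimately show ?case
      using *(1,4) by (intro exI[of _ "\<lambda>c. G c + H c"]) (simp add: mem)
  next
    case (mult p q)
    then obtain G H where *: "\<forall>c. G c \<in> polys {..<r}"
      "p = cst (?e p) + (\<Sum>c<r. (var c - cst (\<xi> c)) * G c)"
      "\<forall>c<r. ?e (G c) = ?e (pderiv_mp c p)"
      "\<forall>c. H c \<in> polys {..<r}"
      "q = cst (?e q) + (\<Sum>c<r. (var c - cst (\<xi> c)) * H c)"
      "\<forall>c<r. ?e (H c) = ?e (pderiv_mp c q)" by blast
    have q: "q \<in> polys {..<r}"
      by (subst *(5)) (intro mem polys_over_sum[OF subring_set_UNIV] subring_setD(6)[OF subring_set_polys_over[OF subring_set_UNIV]]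
        polys_over_var[OF subring_set_UNIV]; use *(4) in auto)
    let ?p = "cst (?e p)" and ?q = "cst (?e q)"
    \<comment> \<open>Expanding one factor at a time gives the quotients G_c q + p(\<xi>) H_c, whose
      values at \<xi> follow the product rule.\<close>
    have "p * q = ?p * ?q + (p - ?p) * q + ?p * (q - ?q)" by (simp add: algebra_simps)
    also have "p - ?p = (\<Sum>c<r. (var c - cst (\<xi> c)) * G c)" using *(2) by (simp add: algebra_simps)
    also have "q - ?q = (\<Sum>c<r. (var c - cst (\<xi> c)) * H c)" using *(5) by (simp add: algebra_simps)
    also have "?p * ?q = cst (?e (p * q))" by (simp add: ev.hom_mult cst.hom_mult)
    finally have "p * q = cst (?e (p * q)) +
        ((\<Sum>c<r. (var c - cst (\<xi> c)) * G c) * q + ?p * (\<Sum>c<r. (var c - cst (\<xi> c)) * H c))"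
      by (simp only: add.assoc)
    also have "(\<Sum>c<r. (var c - cst (\<xi> c)) * G c) * q + ?p * (\<Sum>c<r. (var c - cst (\<xi> c)) * H c) =
        (\<Sum>c<r. (var c - cst (\<xi> c)) * (G c * q + ?p * H c))"
      unfolding sum_distrib_left sum_distrib_right sum.distrib[symmetric]
      by (intro sum.cong refl) (simp add: algebra_simps)
    finally have "p * q = cst (?e (p * q)) + (\<Sum>c<r. (var c - cst (\<xi> c)) * (G c * q + ?p * H c))" .
    moreover have "\<forall>c<r. ?e (G c * q + ?p * H c) = ?e (pderiv_mp c (p * q))"
      using *(3,6) by (simp add: ev.hom_add ev.hom_mult pderiv_mp_mult evalp_cst[OF id_hom])
    ultimately show ?case
      using *(1,4) q by (intro exI[of _ "\<lambda>c. G c * q + ?p * H c"]) (simp add: mem)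
  }
qed

lemma root_char_poly_of_eigenvector:
  fixes N :: "'a::idom mat"
  assumes N: "N \<in> carrier_mat s s" and w: "w \<in> carrier_vec s" "w \<noteq> 0\<^sub>v s" "N *\<^sub>v w = z \<cdot>\<^sub>v w"
  shows "poly (char_poly N) z = 0"
proof -
  define A where "A = z \<cdot>\<^sub>m 1\<^sub>m s - N"
  have A: "A \<in> carrier_mat s s" unfolding A_def using N by (intro minus_carrier_mat)
  have ev: "comm_ring_hom (\<lambda>p. poly p z)" by (rule comm_ring_homI) auto
  have "map_mat (\<lambda>p. poly p z) (char_poly_matrix N) = A"
    using N by (intro eq_matI) (auto simp: A_def char_poly_matrix_def)
  then have "poly (char_poly N) z = det A"
    unfolding char_poly_def by (simp add: comm_ring_hom.hom_det[OF ev, symmetric])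
  moreover have "A *\<^sub>v w = 0\<^sub>v s"
  proof -
    have "A *\<^sub>v w = (z \<cdot>\<^sub>m 1\<^sub>m s) *\<^sub>v w - N *\<^sub>v w"
      unfolding A_def using N w by (intro minus_mult_distrib_mat_vec) auto
    also have "(z \<cdot>\<^sub>m 1\<^sub>m s) *\<^sub>v w = z \<cdot>\<^sub>v w"
      using w by (intro eq_vecI) (auto simp: smult_scalar_prod_distrib[of _ s])
    finally show ?thesis using w by simp
  qed
  ultimately show ?thesis using det_0_iff_vec_prod_zero[OF A] w by auto
qed

text \<open>A system of r equations in r unknowns over \<open>B\<close>, with a zero \<xi> in the
  larger domain and nonvanishing Jacobian determinant there. In the application \<open>B\<close> is
  K[y] and \<xi> lists the bound coordinates.\<close>

locale nondegenerate_zero =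
  fixes B :: "'a::idom set" and r :: nat and \<xi> :: "nat \<Rightarrow> 'a" and F :: "nat \<Rightarrow> 'a mpoly"
  assumes B: "subring_set B"
    and F: "\<And>a. a < r \<Longrightarrow> F a \<in> polys_over B {..<r}"
    and F_zero: "\<And>a. a < r \<Longrightarrow> evalp (\<lambda>c. c) \<xi> (F a) = 0"
    and jac: "det (mat r r (\<lambda>(a, c). evalp (\<lambda>c. c) \<xi> (pderiv_mp c (F a)))) \<noteq> 0"
begin

abbreviation "ev \<equiv> evalp (\<lambda>c. c) \<xi>"

sublocale ev: comm_ring_hom ev by (rule evalp_hom[OF id_hom])
sublocale cst: comm_ring_hom "cst :: 'a \<Rightarrow> 'a mpoly" by (rule cst_hom)

lemma ev_cst [simp]: "ev (cst c) = c" by (rule evalp_cst[OF id_hom])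

lemma polys_UNIV: "p \<in> polys_over B V \<Longrightarrow> p \<in> polys V"
  by (erule polys_over_mono) auto

text \<open>Write F_a as the sum of (t_c - \<xi>_c) G_ac and let h be the determinant of G, a
  Bezoutian. Cramer's rule puts h (t_c - \<xi>_c) into the ideal of the F_a, hence also h (p -
  p(\<xi>)). At \<xi> the entries of G are the partial derivatives, so h takes the Jacobian
  determinant as its value. The coefficients here lie in the large domain, not yet in
  \<open>B\<close>.\<close>

lemma diagonal_multiplier:
  "\<exists>h\<in>polys {..<r}. ev h \<noteq> 0 \<and> (\<forall>p\<in>polys {..<r}.
    \<exists>q. (\<forall>a<r. q a \<in> polys {..<r}) \<and> h * (p - cst (ev p)) = (\<Sum>a<r. q a * F a))"
proof -
  note S = subring_set_polys_over[OF subring_set_UNIV, of "{..<r}"]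
  have "\<forall>a\<in>{..<r}. \<exists>G. (\<forall>c. G c \<in> polys {..<r}) \<and>
    F a = (\<Sum>c<r. (var c - cst (\<xi> c)) * G c) \<and> (\<forall>c<r. ev (G c) = ev (pderiv_mp c (F a)))"
  proof
    fix a assume "a \<in> {..<r}"
    then have "a < r" by simp
    then show "\<exists>G. (\<forall>c. G c \<in> polys {..<r}) \<and>
      F a = (\<Sum>c<r. (var c - cst (\<xi> c)) * G c) \<and> (\<forall>c<r. ev (G c) = ev (pderiv_mp c (F a)))"
      using mpoly_taylor[OF polys_UNIV[OF F], of a \<xi>] by (simp add: F_zero)
  qed
  from bchoice[OF this] obtain G where G: "\<And>a c. a < r \<Longrightarrow> G a c \<in> polys {..<r}"
    "\<And>a. a < r \<Longrightarrow> F a = (\<Sum>c<r. (var c - cst (\<xi> c)) * G a c)"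
    "\<And>a c. a < r \<Longrightarrow> c < r \<Longrightarrow> ev (G a c) = ev (pderiv_mp c (F a))" by blast
  define N where "N = mat r r (\<lambda>(a, c). G a c)"
  have N: "N \<in> carrier_mat r r" by (simp add: N_def)
  have Nmem: "\<And>i j. i < r \<Longrightarrow> j < r \<Longrightarrow> N $$ (i, j) \<in> polys {..<r}" by (simp add: N_def G)
  define h where "h = det N"
  define A where "A = (\<lambda>c a. adj_mat N $$ (c, a))"
  have A: "A c a \<in> polys {..<r}" if "c < r" "a < r" for c a
    unfolding A_def by (rule adj_mat_mem[OF S N Nmem that])
  have hmem: "h \<in> polys {..<r}" unfolding h_def by (rule det_mem[OF S N Nmem])
  have "map_mat ev N = mat r r (\<lambda>(a, c). ev (pderiv_mp c (F a)))"
    by (rule eq_matI) (auto simp: N_def G)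
  then have "ev h \<noteq> 0" using jac by (simp add: h_def ev.hom_det[symmetric])
  have adj: "(\<Sum>a<r. A c a * G a c') = (if c = c' then h else 0)" if "c < r" "c' < r" for c c'
  proof -
    have "(adj_mat N * N) $$ (c, c') = (\<Sum>a<r. A c a * G a c')"
      using that adj_mat(1)[OF N] N
      by (auto simp: A_def N_def scalar_prod_def atLeast0LessThan intro!: sum.cong)
    then show ?thesis using that by (auto simp: adj_mat(3)[OF N] h_def)
  qed
  have hvar: "h * (var c - cst (\<xi> c)) = (\<Sum>a<r. A c a * F a)" if "c < r" for c
  proof -
    have "(\<Sum>a<r. A c a * F a) = (\<Sum>a<r. \<Sum>c'<r. A c a * G a c' * (var c' - cst (\<xi> c')))"
      by (intro sum.cong refl) (simp add: G(2) sum_distrib_left mult_ac)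
    also have "\<dots> = (\<Sum>c'<r. (if c = c' then h else 0) * (var c' - cst (\<xi> c')))"
      by (subst sum.swap) (auto simp: sum_distrib_right[symmetric] adj that intro!: sum.cong)
    also have "\<dots> = h * (var c - cst (\<xi> c))"
      using that by (simp add: if_distrib[of "\<lambda>z. z * _"] sum.delta cong: if_cong)
    finally show ?thesis ..
  qed
  have "\<exists>q. (\<forall>a<r. q a \<in> polys {..<r}) \<and> h * (p - cst (ev p)) = (\<Sum>a<r. q a * F a)"
    if p: "p \<in> polys {..<r}" for p
  proof -
    obtain H where H: "\<forall>c. H c \<in> polys {..<r}"
      "p = cst (ev p) + (\<Sum>c<r. (var c - cst (\<xi> c)) * H c)"
      using mpoly_taylor[OF p, of \<xi>] by blast
    have "h * (p - cst (ev p)) = (\<Sum>c<r. (h * (var c - cst (\<xi> c))) * H c)"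
      by (subst (1) H(2)) (simp add: sum_distrib_left mult.assoc)
    also have "\<dots> = (\<Sum>c<r. \<Sum>a<r. A c a * H c * F a)"
      by (intro sum.cong refl) (simp add: hvar sum_distrib_left sum_distrib_right mult_ac)
    also have "\<dots> = (\<Sum>a<r. (\<Sum>c<r. A c a * H c) * F a)"
      by (subst sum.swap) (simp add: sum_distrib_right)
    finally have "h * (p - cst (ev p)) = (\<Sum>a<r. (\<Sum>c<r. A c a * H c) * F a)" .
    moreover have "\<forall>a<r. (\<Sum>c<r. A c a * H c) \<in> polys {..<r}"
      using A H by (auto intro!: subring_set_sum[OF S] subring_setD(4)[OF S])
    ultimately show ?thesis by (intro exI[of _ "\<lambda>a. \<Sum>c<r. A c a * H c"] conjI)
  qed
  then show ?thesis using hmem \<open>ev h \<noteq> 0\<close> by blast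
qed

text \<open>Modulo the equations \<open>F a\<close>, multiplication by b p acts on the family h
  through the matrix \<beta> with entries in \<open>B\<close>.\<close>

definition coeff_relation ::
  "'a set \<Rightarrow> ('a \<Rightarrow> 'a mpoly) \<Rightarrow> 'a mpoly \<Rightarrow> 'a \<Rightarrow> ('a \<Rightarrow> 'a \<Rightarrow> 'a) \<Rightarrow> (nat \<Rightarrow> 'a \<Rightarrow> 'a mpoly) \<Rightarrow> bool" where
  "coeff_relation E h p b \<beta> Q \<longleftrightarrow> b \<in> B \<and> b \<noteq> 0 \<and> (\<forall>d\<in>E. \<forall>e\<in>E. \<beta> d e \<in> B) \<and>
    (\<forall>a<r. \<forall>e\<in>E. Q a e \<in> polys_over B {..<r}) \<and>
    (\<forall>e\<in>E. cst b * h e * p - (\<Sum>d\<in>E. cst (\<beta> d e) * h d) = (\<Sum>a<r. Q a e * F a)) \<and>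
    (ev p = 0 \<longrightarrow> (\<forall>d\<in>E. \<forall>e\<in>E. \<beta> d e = 0))"

text \<open>The coefficients of the identity of \<open>diagonal_multiplier\<close> are compared along a finite set
  that is linearly independent over the subring; this replaces a computation in a tensor square.\<close>
lemma coefficient_relations:
  "\<exists>E h. finite E \<and> (\<forall>e\<in>E. h e \<in> polys_over B {..<r}) \<and> (\<exists>e\<in>E. ev (h e) \<noteq> 0) \<and>
    (\<forall>p\<in>polys_over B {..<r}. \<exists>b \<beta> Q. coeff_relation E h p b \<beta> Q)"
proof -
  note S = subring_set_polys_over[OF B, of "{..<r}"]
  note SU = subring_set_polys_over[OF subring_set_UNIV, of "{..<r}"]
  obtain h0 where h0: "h0 \<in> polys {..<r}" "ev h0 \<noteq> 0"
    "\<forall>p\<in>polys {..<r}. \<exists>q. (\<forall>a<r. q a \<in> polys {..<r}) \<and>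
      h0 * (p - cst (ev p)) = (\<Sum>a<r. q a * F a)"
    using diagonal_multiplier by blast
  have "free_over B {}" by (simp add: free_over_def)
  from free_over_extend_polys[OF B this, of "{}" "{h0}" "{..<r}"] h0(1)
  obtain E b1 where E: "free_over B E" "b1 \<in> B" "b1 \<noteq> 0" "expands_poly B {..<r} E b1 h0" by auto
  then obtain h where h: "\<And>e. e \<in> E \<Longrightarrow> h e \<in> polys_over B {..<r}" "cst b1 * h0 = (\<Sum>e\<in>E. cst e * h e)"
    by (auto simp: expands_poly_def)
  have finE: "finite E" using E(1) by (simp add: free_over_def)
  have ne: "\<exists>e\<in>E. ev (h e) \<noteq> 0"
  proof (rule ccontr)
    assume "\<not> ?thesis"
    then have "ev (cst b1 * h0) = 0" unfolding h(2) by (simp add: ev.hom_sum ev.hom_mult)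
    then show False using h0(2) E(3) by (simp add: ev.hom_mult)
  qed
  have main: "\<exists>b \<beta> Q. coeff_relation E h p b \<beta> Q" if p: "p \<in> polys_over B {..<r}" for p
  proof -
    obtain q where q: "\<forall>a<r. q a \<in> polys {..<r}" "h0 * (p - cst (ev p)) = (\<Sum>a<r. q a * F a)"
      using h0(3) polys_UNIV[OF p] by blast
    have "(\<lambda>a. cst b1 * q a) ` {..<r} \<subseteq> polys {..<r}"
      using q(1) by (auto intro!: subring_setD(4)[OF SU] polys_over_cst[OF subring_set_UNIV])
    \<comment> \<open>The set \<open>E'\<close> depends on p, but it contains the fixed set
      \<open>E\<close> along which h was expanded.\<close>
    from free_over_extend_polys[OF B E(1) _ _ this, of "(\<lambda>e. ev p * e) ` E"] finE
    obtain E' b where E': "E \<subseteq> E'" "free_over B E'" "b \<in> B" "b \<noteq> 0"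
      "\<forall>d\<in>E. expands B E' b (ev p * d)" "\<forall>a<r. expands_poly B {..<r} E' b (cst b1 * q a)" by auto
    obtain \<beta> where \<beta>: "\<And>d e. d \<in> E \<Longrightarrow> e \<in> E' \<Longrightarrow> \<beta> d e \<in> B"
      "\<And>d. d \<in> E \<Longrightarrow> b * (ev p * d) = (\<Sum>e\<in>E'. \<beta> d e * e)"
      using E'(5) unfolding expands_def by metis
    have "\<forall>a\<in>{..<r}. \<exists>c. (\<forall>e\<in>E'. c e \<in> polys_over B {..<r}) \<and>
        cst b * (cst b1 * q a) = (\<Sum>e\<in>E'. cst e * c e)"
      using E'(6) by (simp add: expands_poly_def)
    from bchoice[OF this] obtain Q where
      Q: "\<And>a e. a < r \<Longrightarrow> e \<in> E' \<Longrightarrow> Q a e \<in> polys_over B {..<r}"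
      "\<And>a. a < r \<Longrightarrow> cst b * (cst b1 * q a) = (\<Sum>e\<in>E'. cst e * Q a e)" by blast
    have finE': "finite E'" using E'(2) by (simp add: free_over_def)
    \<comment> \<open>The coefficient of e in b b1 h0 (p - p(\<xi>)) minus its expression by the
      \<open>F a\<close>. It has coefficients in \<open>B\<close>, so freeness of \<open>E'\<close>
      makes each \<open>T e\<close> vanish.\<close>
    define T where "T = (\<lambda>e. (if e \<in> E then cst b * h e * p else 0) - (\<Sum>d\<in>E. cst (\<beta> d e) * h d) - (\<Sum>a<r. Q a e * F a))"
    have Tmem: "T e \<in> polys_over B {..<r}" if "e \<in> E'" for e
      unfolding T_def using that h(1) p Q(1) \<beta>(1) E'(3) F
      by (auto intro!: subring_setD(1,4,5,6)[OF S] subring_set_sum[OF S] polys_over_cst[OF B])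
    have "(\<Sum>e\<in>E'. cst e * T e) = 0"
    proof -
      have 1: "(\<Sum>e\<in>E'. cst e * (if e \<in> E then cst b * h e * p else 0)) = cst b * (cst b1 * h0) * p"
      proof -
        have "(\<Sum>e\<in>E'. cst e * (if e \<in> E then cst b * h e * p else 0)) = (\<Sum>e\<in>E. cst e * (cst b * h e * p))"
          using E'(1) finE' by (intro sum.mono_neutral_cong_right) auto
        then show ?thesis unfolding h(2) by (simp add: sum_distrib_left sum_distrib_right mult_ac)
      qed
      have 2: "(\<Sum>e\<in>E'. cst e * (\<Sum>d\<in>E. cst (\<beta> d e) * h d)) = cst b * (cst b1 * h0) * cst (ev p)"
      proof -
        have "(\<Sum>e\<in>E'. cst e * (\<Sum>d\<in>E. cst (\<beta> d e) * h d)) = (\<Sum>d\<in>E. (\<Sum>e\<in>E'. cst (\<beta> d e) * cst e) * h d)"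
          unfolding sum_distrib_left sum_distrib_right by (subst sum.swap) (simp add: mult_ac)
        also have "\<dots> = (\<Sum>d\<in>E. cst (b * (ev p * d)) * h d)"
          by (intro sum.cong refl) (simp add: \<beta>(2) cst.hom_sum cst.hom_mult)
        finally show ?thesis unfolding h(2) by (simp add: cst.hom_mult sum_distrib_left sum_distrib_right mult_ac)
      qed
      have 3: "(\<Sum>e\<in>E'. cst e * (\<Sum>a<r. Q a e * F a)) = cst b * (cst b1 * (h0 * (p - cst (ev p))))"
      proof -
        have "(\<Sum>e\<in>E'. cst e * (\<Sum>a<r. Q a e * F a)) = (\<Sum>a<r. (\<Sum>e\<in>E'. cst e * Q a e) * F a)"
          unfolding sum_distrib_left sum_distrib_right by (subst sum.swap) (simp add: mult_ac)
        also have "\<dots> = (\<Sum>a<r. cst b * (cst b1 * q a) * F a)"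
          by (intro sum.cong refl) (simp add: Q(2)[symmetric])
        finally show ?thesis unfolding q(2) by (simp add: sum_distrib_left mult_ac)
      qed
      show ?thesis unfolding T_def right_diff_distrib sum_subtractf 1 2 3 by (simp add: algebra_simps)
    qed
    then have T0: "T e = 0" if "e \<in> E'" for e
      by - (rule free_over_polys[OF E'(2), where c = T, OF Tmem], use that in auto)
    have id: "cst b * h e * p - (\<Sum>d\<in>E. cst (\<beta> d e) * h d) = (\<Sum>a<r. Q a e * F a)" if "e \<in> E" for e
      using T0[of e] that E'(1) by (auto simp: T_def)
    \<comment> \<open>The \<beta> d e are the coordinates of b p(\<xi>) d in the free set
      \<open>E'\<close>, so they vanish together with p(\<xi>).\<close>
    have \<beta>0: "\<beta> d e = 0" if "ev p = 0" "d \<in> E" "e \<in> E" for d e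
      using \<beta>[OF that(2)] that E'(1,2) unfolding free_over_def by auto
    show ?thesis
      using E'(1,3,4) \<beta>(1) Q(1) id \<beta>0
      unfolding coeff_relation_def
      by (intro exI[of _ b] exI[of _ \<beta>] exI[of _ Q]) blast
  qed
  show ?thesis using finE h(1) ne main by (intro exI[of _ E] exI[of _ h]) blast
qed

text \<open>If p vanishes at \<xi>, then so does the matrix \<beta>, and b h_e p lies in the ideal
  of the equations over \<open>B\<close> itself. Any e for which h_e does not vanish at \<xi> gives
  the multiplier.\<close>

lemma vanishing_multiplier:
  assumes "p \<in> polys_over B {..<r}" "ev p = 0"
  obtains H Q where "H \<in> polys_over B {..<r}" "ev H \<noteq> 0" "\<And>a. a < r \<Longrightarrow> Q a \<in> polys_over B {..<r}"
    "H * p = (\<Sum>a<r. Q a * F a)"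
proof -
  obtain E h where E: "finite E" "\<And>e. e \<in> E \<Longrightarrow> h e \<in> polys_over B {..<r}" "\<exists>e\<in>E. ev (h e) \<noteq> 0"
    "\<And>p. p \<in> polys_over B {..<r} \<Longrightarrow> \<exists>b \<beta> Q. coeff_relation E h p b \<beta> Q"
    using coefficient_relations by blast
  obtain e where e: "e \<in> E" "ev (h e) \<noteq> 0" using E(3) by blast
  obtain b \<beta> Q where rel: "coeff_relation E h p b \<beta> Q" using E(4)[OF assms(1)] by blast
  have b: "b \<in> B" "b \<noteq> 0" "\<forall>a<r. \<forall>e\<in>E. Q a e \<in> polys_over B {..<r}"
    "cst b * h e * p - (\<Sum>d\<in>E. cst (\<beta> d e) * h d) = (\<Sum>a<r. Q a e * F a)" "\<forall>d\<in>E. \<forall>e\<in>E. \<beta> d e = 0"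
    using rel assms(2) e(1) unfolding coeff_relation_def by blast+
  show ?thesis
  proof (rule that[of "cst b * h e" "\<lambda>a. Q a e"])
    show "cst b * h e \<in> polys_over B {..<r}"
      using b(1) E(2)[OF e(1)] by (intro polys_over_mult[OF B] polys_over_cst[OF B])
    show "ev (cst b * h e) \<noteq> 0" using b(2) e(2) by (simp add: ev.hom_mult)
    show "cst b * h e * p = (\<Sum>a<r. Q a e * F a)" using b(4,5) e(1) by simp
  qed (use b e in auto)
qed

text \<open>At \<xi> the coefficient relations say that the nonzero vector of values of h is an
  eigenvector, with eigenvalue b p(\<xi>), of a matrix over \<open>B\<close>. The eigenvalue is a
  root of the characteristic polynomial, and a nonzero root divides the lowest nonzero
  coefficient.\<close>

lemma multiple_in_subring:
  assumes p: "p \<in> polys_over B {..<r}" "ev p \<noteq> 0"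
  shows "\<exists>d\<in>B. d \<noteq> 0 \<and> ev p dvd d"
proof -
  obtain E h where E: "finite E" "\<And>e. e \<in> E \<Longrightarrow> h e \<in> polys_over B {..<r}" "\<exists>e\<in>E. ev (h e) \<noteq> 0"
    "\<And>p. p \<in> polys_over B {..<r} \<Longrightarrow> \<exists>b \<beta> Q. coeff_relation E h p b \<beta> Q"
    using coefficient_relations by blast
  obtain b \<beta> Q where rel: "coeff_relation E h p b \<beta> Q" using E(4)[OF p(1)] by blast
  have b: "b \<in> B" "b \<noteq> 0" "\<And>d e. d \<in> E \<Longrightarrow> e \<in> E \<Longrightarrow> \<beta> d e \<in> B"
    "\<And>e. e \<in> E \<Longrightarrow> cst b * h e * p - (\<Sum>d\<in>E. cst (\<beta> d e) * h d) = (\<Sum>a<r. Q a e * F a)"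
    using rel by (simp_all add: coeff_relation_def)
  have eig: "b * ev p * ev (h e) = (\<Sum>d\<in>E. \<beta> d e * ev (h d))" if "e \<in> E" for e
  proof -
    have "ev (cst b * h e * p - (\<Sum>d\<in>E. cst (\<beta> d e) * h d)) = 0"
      unfolding b(4)[OF that] by (simp add: ev.hom_sum ev.hom_mult F_zero)
    then show ?thesis by (simp add: ev.hom_minus ev.hom_mult ev.hom_sum mult_ac)
  qed
  obtain es where es: "set es = E" "distinct es" using finite_distinct_list[OF E(1)] by blast
  define s where "s = length es"
  \<comment> \<open>The arguments of \<beta> are swapped because the sum in \<open>eig\<close> runs
    over the first one.\<close>
  define N where "N = mat s s (\<lambda>(i, j). \<beta> (es ! j) (es ! i))"
  define w where "w = vec s (\<lambda>i. ev (h (es ! i)))"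
  have N: "N \<in> carrier_mat s s" and w: "w \<in> carrier_vec s" by (simp_all add: N_def w_def)
  have "N *\<^sub>v w = (b * ev p) \<cdot>\<^sub>v w"
  proof (rule eq_vecI)
    fix i assume "i < dim_vec ((b * ev p) \<cdot>\<^sub>v w)"
    then have i: "i < s" by (simp add: w_def)
    have "(N *\<^sub>v w) $ i = (\<Sum>j<s. \<beta> (es ! j) (es ! i) * ev (h (es ! j)))"
      using i by (simp add: N_def w_def scalar_prod_def atLeast0LessThan)
    also have "\<dots> = (\<Sum>d\<in>E. \<beta> d (es ! i) * ev (h d))"
      using es by (intro sum.reindex_bij_betw[OF bij_betw_nth]) (auto simp: s_def)
    finally show "(N *\<^sub>v w) $ i = ((b * ev p) \<cdot>\<^sub>v w) $ i"
      using i eig[of "es ! i"] es nth_mem[of i es] by (auto simp: w_def s_def)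
  qed (simp add: N_def w_def)
  moreover have "w \<noteq> 0\<^sub>v s"
  proof
    assume w0: "w = 0\<^sub>v s"
    have "ev (h e) = 0" if eE: "e \<in> E" for e
    proof -
      obtain i where "i < s" "e = es ! i" using eE es by (metis in_set_conv_nth s_def)
      then show ?thesis using arg_cong[OF w0, of "\<lambda>v. v $ i"] by (simp add: w_def)
    qed
    then show False using E(3) by blast
  qed
  ultimately have root: "poly (char_poly N) (b * ev p) = 0"
    using root_char_poly_of_eigenvector[OF N w] by blast
  define C where "C = char_poly N"
  have "C \<noteq> 0" using degree_monic_char_poly[OF N] by (auto simp: C_def)
  have "Polynomial.coeff C k \<in> B" for k
  proof -
    define PB where "PB = {q :: 'a poly. \<forall>k. Polynomial.coeff q k \<in> B}"
    have PB: "subring_set PB"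
      unfolding subring_set_def PB_def
      by (auto simp: Polynomial.coeff_mult intro!: subring_setD[OF B] subring_set_sum[OF B])
    have "C \<in> PB" unfolding C_def char_poly_def
    proof (rule det_mem[OF PB char_poly_matrix_closed[OF N]])
      fix i j assume ij: "i < s" "j < s"
      then have "char_poly_matrix N $$ (i, j) = (if i = j then [:0, 1:] else 0) + [: - \<beta> (es ! j) (es ! i) :]"
        by (simp add: char_poly_matrix_def N_def)
      moreover have "- \<beta> (es ! j) (es ! i) \<in> B"
        using ij es nth_mem[of _ es] by (intro subring_setD(5)[OF B] b(3)) (auto simp: s_def)
      then have "[: - \<beta> (es ! j) (es ! i) :] \<in> PB" "[:0, 1:] \<in> PB" "0 \<in> PB"
        using subring_setD[OF B] by (auto simp: PB_def coeff_pCons split: nat.split)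
      ultimately show "char_poly_matrix N $$ (i, j) \<in> PB" using subring_setD(3)[OF PB] by auto
    qed
    then show ?thesis by (simp add: PB_def)
  qed
  \<comment> \<open>Powers of the variable are cancelled until the constant coefficient is nonzero;
    it is then z times the negative of a polynomial value.\<close>
  moreover have low: "\<exists>k. Polynomial.coeff C k \<noteq> 0 \<and> z dvd Polynomial.coeff C k" if "poly C z = 0" "z \<noteq> 0" for z
    using \<open>C \<noteq> 0\<close> that(1)
  proof (induction C)
    case 0 then show ?case by simp
  next
    case (pCons c C)
    show ?case
    proof (cases "c = 0")
      case False
      have "c = z * (- poly C z)" using pCons.prems by (simp add: eq_neg_iff_add_eq_0)
      then have "z dvd c" by (rule dvdI)
      then show ?thesis using False by (intro exI[of _ 0]) simp
    next
      case True
      then have "poly C z = 0" "C \<noteq> 0" using pCons.prems that(2) by auto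
      then obtain k where "Polynomial.coeff C k \<noteq> 0 \<and> z dvd Polynomial.coeff C k" using pCons.IH by blast
      then show ?thesis by (intro exI[of _ "Suc k"]) simp
    qed
  qed
  moreover have "poly C (b * ev p) = 0" "b * ev p \<noteq> 0" using root p(2) b(2) by (auto simp: C_def)
  ultimately obtain k where "Polynomial.coeff C k \<in> B" "Polynomial.coeff C k \<noteq> 0" "b * ev p dvd Polynomial.coeff C k"
    by blast
  then show ?thesis using dvd_mult_right by blast
qed

end

section \<open>Charts given by a nonvanishing maximal minor of the Jacobi matrix\<close>

locale jacobi_chart =
  fixes \<iota> :: "'k::field \<Rightarrow> 'a::idom" and n m :: nat and x :: "nat \<Rightarrow> 'a" and f :: "nat \<Rightarrow> 'k mpoly"
    and \<rho> \<gamma> :: "nat \<Rightarrow> nat" and r :: nat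
  assumes hom: "comm_ring_hom \<iota>" and perf: "perfect_field TYPE('k)"
    and pres: "ess_fin_presentation \<iota> n x m f"
    and r: "r = mat_rank m n (jacobi \<iota> x f)"
    and \<rho>: "\<rho> ` {..<r} \<subseteq> {..<m}" and \<gamma>: "\<gamma> ` {..<r} \<subseteq> {..<n}" and \<gamma>_inj: "inj_on \<gamma> {..<r}"
    and minor_nz: "det (submat r (jacobi \<iota> x f) \<rho> \<gamma>) \<noteq> 0"
begin

abbreviation "\<Delta> \<equiv> det (submat r (jacobi \<iota> x f) \<rho> \<gamma>)"
abbreviation "ev \<equiv> evalp \<iota> x"

text \<open>The indices of the bound coordinates, those in the columns of the minor;
  \<open>Y\<close> holds the free ones.\<close>

definition C :: "nat set" where "C = \<gamma> ` {..<r}"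
definition Y :: "nat set" where "Y = {..<n} - C"

sublocale \<iota>: comm_ring_hom \<iota> by (rule hom)
sublocale ev: comm_ring_hom ev by (rule evalp_hom[OF hom])

lemmas P_closed = polys_over_add[OF subring_set_UNIV] polys_over_mult[OF subring_set_UNIV]
  polys_over_zero[OF subring_set_UNIV] polys_over_cst[OF subring_set_UNIV UNIV_I]
  polys_over_var[OF subring_set_UNIV] polys_over_sum[OF subring_set_UNIV]

lemma f_in: "i < m \<Longrightarrow> f i \<in> polys {..<n}"
  using pres by (simp add: ess_fin_presentation_def polys_in_eq)

lemma ev_zero_iff:
  "p \<in> polys {..<n} \<and> ev p = 0 \<longleftrightarrow>
    (\<exists>g. (\<forall>i<m. g i \<in> polys {..<n}) \<and> p = (\<Sum>i<m. g i * f i))"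
proof -
  have "{p \<in> polys_in n. ev p = 0} = {\<Sum>i<m. g i * f i | g. \<forall>i<m. g i \<in> polys_in n}"
    using pres by (simp add: ess_fin_presentation_def)
  from arg_cong[OF this, of "\<lambda>A. p \<in> A"] show ?thesis by (auto simp: polys_in_eq)
qed

lemma ev_f: assumes "i < m" shows "ev (f i) = 0"
proof -
  have "f i = (\<Sum>k<m. (if k = i then 1 else 0) * f k)"
    using assms by (simp add: if_distrib[of "\<lambda>z. z * _"] sum.delta cong: if_cong)
  moreover have "\<forall>k<m. (if k = i then 1 else 0) \<in> polys {..<n}"
    using subring_setD(1,2)[OF subring_set_polys_over[OF subring_set_UNIV, of "{..<n}"]] by auto
  ultimately have "\<exists>g. (\<forall>k<m. g k \<in> polys {..<n}) \<and> f i = (\<Sum>k<m. g k * f k)"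
    by (intro exI[of _ "\<lambda>k. if k = i then 1 else 0"] conjI)
  from ev_zero_iff[THEN iffD2, OF this] show ?thesis ..
qed

lemma fraction_rep:
  "\<exists>p\<in>polys {..<n}. \<exists>q\<in>polys {..<n}. (\<exists>t. ev q * t = 1) \<and> y * ev q = ev p"
proof -
  obtain S where S: "S \<subseteq> ev ` polys_in n" "\<forall>s\<in>S. \<exists>t. s * t = 1"
    "\<forall>y. \<exists>a\<in>ev ` polys_in n. \<exists>s\<in>S. y * s = a"
    using pres by (auto simp: ess_fin_presentation_def)
  obtain a s where "a \<in> ev ` polys_in n" "s \<in> S" "y * s = a" using S(3) by blast
  then show ?thesis using S(1,2) by (auto simp: polys_in_eq) blast
qed

lemma Y_n: "Y \<subseteq> {..<n}" by (auto simp: Y_def)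

lemma pderiv_eq_zero:
  assumes "p \<in> polys V" "j \<notin> V"
  shows "pderiv_mp j p = 0"
proof (rule poly_mapping_eqI)
  fix \<beta>
  have "\<beta> + single j 1 \<notin> keys p"
  proof
    assume "\<beta> + single j 1 \<in> keys p"
    then have "keys (\<beta> + single j 1) \<subseteq> V" using assms(1) by (simp add: polys_over_def)
    moreover have "j \<in> keys (\<beta> + single j (1::nat))"
      by (simp add: in_keys_iff lookup_add)
    ultimately show False using assms(2) by blast
  qed
  then show "lookup (pderiv_mp j p) \<beta> = lookup 0 \<beta>"
    by (simp add: lookup_pderiv_mp not_in_keys_iff_lookup_eq_zero)
qed

text \<open>Differentiating g = sum of q_i f_i and evaluating gives a combination of rows of the
  Jacobi matrix. Its entries in bound columns vanish, since g does not involve bound variables. The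
  bordered minor relation expresses \<Delta> times column j by the bound columns, so \<Delta> times
  the j-th derivative of g evaluates to 0, and \<open>alg_independentI\<close> applies.\<close>

lemma free_coordinates_independent:
  assumes "g \<in> polys Y" "ev g = 0"
  shows "g = 0"
proof (rule alg_independentI[OF hom perf Y_n _ assms])
  fix g j assume g: "g \<in> polys Y" "ev g = 0" and j: "j < n"
  have "g \<in> polys {..<n}" using g(1) Y_n by (auto intro: polys_over_mono)
  then obtain q where q: "\<forall>i<m. q i \<in> polys {..<n}" "g = (\<Sum>i<m. q i * f i)"
    using ev_zero_iff[of g] g(2) by blast
  have ev_pd: "ev (pderiv_mp k g) = (\<Sum>i<m. ev (q i) * jacobi \<iota> x f i k)" for k
    unfolding q(2) by (simp add: pderiv_mp_sum pderiv_mp_mult ev.hom_sum ev.hom_add ev.hom_mult ev_f jacobi_def)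
  have zero: "(\<Sum>i<m. ev (q i) * jacobi \<iota> x f i (\<gamma> c)) = 0" if "c < r" for c
  proof -
    have "\<gamma> c \<notin> Y" using that by (auto simp: Y_def C_def)
    then show ?thesis using pderiv_eq_zero[OF g(1)] by (simp add: ev_pd[symmetric])
  qed
  obtain v where v: "\<And>i. i < m \<Longrightarrow> (\<Sum>c<r. jacobi \<iota> x f i (\<gamma> c) * v c) + jacobi \<iota> x f i j * \<Delta> = 0"
    using bordered_minor_relation[OF r \<rho> \<gamma> j] by blast
  have "ev (pderiv_mp j g) * \<Delta> = (\<Sum>i<m. ev (q i) * (jacobi \<iota> x f i j * \<Delta>))"
    by (simp add: ev_pd sum_distrib_right mult.assoc)
  also have "\<dots> = (\<Sum>i<m. - (\<Sum>c<r. ev (q i) * (jacobi \<iota> x f i (\<gamma> c) * v c)))"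
  proof (rule sum.cong[OF refl])
    fix i assume "i \<in> {..<m}"
    then have "jacobi \<iota> x f i j * \<Delta> = - (\<Sum>c<r. jacobi \<iota> x f i (\<gamma> c) * v c)"
      using v[of i] by (simp add: eq_neg_iff_add_eq_0 add.commute)
    then show "ev (q i) * (jacobi \<iota> x f i j * \<Delta>) = - (\<Sum>c<r. ev (q i) * (jacobi \<iota> x f i (\<gamma> c) * v c))"
      by (simp add: sum_distrib_left)
  qed
  also have "\<dots> = - (\<Sum>c<r. \<Sum>i<m. ev (q i) * (jacobi \<iota> x f i (\<gamma> c) * v c))"
    by (simp add: sum_negf sum.swap[of _ "{..<m}"])
  also have "(\<Sum>c<r. \<Sum>i<m. ev (q i) * (jacobi \<iota> x f i (\<gamma> c) * v c)) = 0"
  proof (rule sum.neutral, rule ballI)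
    fix c assume "c \<in> {..<r}"
    then have "(\<Sum>i<m. ev (q i) * jacobi \<iota> x f i (\<gamma> c)) * v c = 0" using zero by simp
    then show "(\<Sum>i<m. ev (q i) * (jacobi \<iota> x f i (\<gamma> c) * v c)) = 0"
      unfolding sum_distrib_right by (simp only: mult.assoc)
  qed
  finally show "ev (pderiv_mp j g) = 0" using minor_nz by simp
qed

section \<open>The polynomial ring of the chart as polynomials in the bound variables over
  K[y]\<close>

definition \<sigma>_var :: "nat \<Rightarrow> 'a mpoly" where
  "\<sigma>_var k = (if k \<in> C then var (the_inv_into {..<r} \<gamma> k) else cst (x k))"

text \<open>Bound variables are renamed to 0, ..., r - 1 and free ones become constants in
  \<open>B\<close>. On polynomials in the first n variables this is a bijection onto the polynomials
  over \<open>B\<close>, injective because the free coordinates are independent; evaluation at \<xi>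
  gives back \<open>ev\<close>.\<close>

definition \<sigma> :: "'k mpoly \<Rightarrow> 'a mpoly" where
  "\<sigma> = evalp (\<lambda>c. cst (\<iota> c)) \<sigma>_var"

definition B :: "'a set" where "B = ev ` polys Y"

abbreviation "\<xi> \<equiv> (\<lambda>c. x (\<gamma> c))"
abbreviation "ev1 \<equiv> evalp (\<lambda>c. c) \<xi>"

lemma inv_\<gamma> [simp]: "c < r \<Longrightarrow> the_inv_into {..<r} \<gamma> (\<gamma> c) = c"
  using \<gamma>_inj by (intro the_inv_into_f_f) auto

lemma \<gamma>_C: "c < r \<Longrightarrow> \<gamma> c \<in> C" by (auto simp: C_def)

lemma C_E: assumes "k \<in> C" obtains c where "c < r" "k = \<gamma> c" using assms by (auto simp: C_def)

lemma cst_\<iota>_hom: "comm_ring_hom (\<lambda>c. cst (\<iota> c))"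
proof -
  interpret cst: comm_ring_hom "cst :: 'a \<Rightarrow> 'a mpoly" by (rule cst_hom)
  show ?thesis by (rule comm_ring_homI) (simp_all add: \<iota>.hom_add \<iota>.hom_mult cst.hom_add cst.hom_mult)
qed

sublocale \<sigma>: comm_ring_hom \<sigma> unfolding \<sigma>_def by (rule evalp_hom[OF cst_\<iota>_hom])

lemma \<sigma>_cst [simp]: "\<sigma> (cst c) = cst (\<iota> c)" unfolding \<sigma>_def by (rule evalp_cst[OF cst_\<iota>_hom])
lemma \<sigma>_var [simp]: "\<sigma> (var k) = \<sigma>_var k" unfolding \<sigma>_def by (rule evalp_var[OF cst_\<iota>_hom])

lemma ev1_\<sigma>: "ev1 (\<sigma> p) = ev p"
proof -
  have "ev1 (\<sigma>_var k) = x k" for k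
    by (auto simp: \<sigma>_var_def evalp_cst[OF id_hom] evalp_var[OF id_hom] elim!: C_E)
  then show ?thesis
    unfolding \<sigma>_def by (subst hom_evalp[OF cst_\<iota>_hom evalp_hom[OF id_hom]]) (simp add: evalp_cst[OF id_hom])
qed

lemma \<sigma>_free: assumes "g \<in> polys Y" shows "\<sigma> g = cst (ev g)"
proof -
  have "\<sigma> g = evalp (\<lambda>c. cst (\<iota> c)) (\<lambda>i. cst (x i)) g"
    unfolding \<sigma>_def using assms by (intro evalp_cong) (auto simp: polys_over_def Y_def \<sigma>_var_def)
  then show ?thesis using hom_evalp[OF hom cst_hom] by metis
qed

lemma B_subring: "subring_set B"
  unfolding B_def by (rule subring_set_image[OF evalp_hom[OF hom] subring_set_polys_over[OF subring_set_UNIV]])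

lemma \<sigma>_in: assumes "p \<in> polys {..<n}" shows "\<sigma> p \<in> polys_over B {..<r}"
  unfolding \<sigma>_def
proof (rule evalp_mem[OF cst_\<iota>_hom subring_set_polys_over[OF B_subring] assms subring_set_UNIV])
  fix c
  have "ev (cst c) = \<iota> c" by (rule evalp_cst[OF hom])
  then have "\<iota> c \<in> B" unfolding B_def by (metis P_closed(4) image_eqI)
  then show "cst (\<iota> c) \<in> polys_over B {..<r}" by (rule polys_over_cst[OF B_subring])
next
  fix k assume k: "k \<in> {..<n}"
  show "\<sigma>_var k \<in> polys_over B {..<r}"
  proof (cases "k \<in> C")
    case True
    then show ?thesis by (auto simp: \<sigma>_var_def intro!: polys_over_var[OF B_subring] elim!: C_E)
  next
    case False
    then have "k \<in> Y" using k by (simp add: Y_def)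
    have "ev (var k) = x k" by (rule evalp_var[OF hom])
    then have "x k \<in> B" unfolding B_def using P_closed(5)[OF \<open>k \<in> Y\<close>] by (metis image_eqI)
    then show ?thesis using False by (simp add: \<sigma>_var_def polys_over_cst[OF B_subring])
  qed
qed

lemma \<sigma>_surj: assumes "P \<in> polys_over B {..<r}" shows "\<exists>p\<in>polys {..<n}. \<sigma> p = P"
  using B_subring assms
proof (induction rule: polys_over_induct)
  case (cst b)
  then obtain g where g: "g \<in> polys Y" "b = ev g" by (auto simp: B_def)
  then have "g \<in> polys {..<n}" using Y_n by (auto intro: polys_over_mono)
  then show ?case using \<sigma>_free[OF g(1)] g(2) by auto
next
  case (var c)
  then have "\<gamma> c < n" "\<sigma> (var (\<gamma> c)) = var c" using \<gamma> \<gamma>_C by (auto simp: \<sigma>_var_def)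
  then show ?case by (intro bexI[of _ "var (\<gamma> c)"] P_closed(5)) auto
next
  case (add p q)
  then show ?case by (metis P_closed(1) \<sigma>.hom_add)
next
  case (mult p q)
  then show ?case by (metis P_closed(2) \<sigma>.hom_mult)
qed

text \<open>Exponents are split into the part in the bound variables, renamed to \<open>0, \<dots>, r - 1\<close>, and the
  part in the free variables.\<close>
definition bound_part :: "(nat \<Rightarrow>\<^sub>0 nat) \<Rightarrow> (nat \<Rightarrow>\<^sub>0 nat)" where
  "bound_part \<alpha> = (\<Sum>c<r. single c (lookup \<alpha> (\<gamma> c)))"

definition free_part :: "(nat \<Rightarrow>\<^sub>0 nat) \<Rightarrow> (nat \<Rightarrow>\<^sub>0 nat)" where
  "free_part \<alpha> = (\<Sum>i\<in>Y. single i (lookup \<alpha> i))"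

lemma lookup_bound_part: "lookup (bound_part \<alpha>) c = (if c < r then lookup \<alpha> (\<gamma> c) else 0)"
  by (auto simp: bound_part_def lookup_sum lookup_single when_def)

lemma lookup_free_part: "lookup (free_part \<alpha>) i = (if i \<in> Y then lookup \<alpha> i else 0)"
  by (auto simp: free_part_def lookup_sum lookup_single when_def Y_def)

lemma \<sigma>_single:
  assumes "keys \<alpha> \<subseteq> {..<n}"
  shows "\<sigma> (single \<alpha> c) = single (bound_part \<alpha>) (\<iota> c * mon x (free_part \<alpha>))"
proof -
  interpret cst: comm_ring_hom "cst :: 'a \<Rightarrow> 'a mpoly" by (rule cst_hom)
  have fin: "finite C" "finite Y" by (auto simp: C_def Y_def)
  have un: "{..<n} = C \<union> Y" "C \<inter> Y = {}" using \<gamma> by (auto simp: C_def Y_def)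
  have 1: "(\<Prod>i\<in>C. \<sigma>_var i ^ lookup \<alpha> i) = mon var (bound_part \<alpha>)"
  proof -
    have "(\<Prod>i\<in>C. \<sigma>_var i ^ lookup \<alpha> i) = (\<Prod>c<r. var c ^ lookup \<alpha> (\<gamma> c))"
      unfolding C_def prod.reindex[OF \<gamma>_inj] o_def
      by (intro prod.cong) (auto simp: \<sigma>_var_def C_def)
    also have "\<dots> = mon var (bound_part \<alpha>)"
      by (subst mon_superset[of "{..<r}"]) (auto simp: in_keys_iff lookup_bound_part split: if_splits)
    finally show ?thesis .
  qed
  have 2: "(\<Prod>i\<in>Y. \<sigma>_var i ^ lookup \<alpha> i) = cst (mon x (free_part \<alpha>))"
  proof -
    have "mon x (free_part \<alpha>) = (\<Prod>i\<in>Y. x i ^ lookup \<alpha> i)"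
      using fin by (subst mon_superset[of Y]) (auto simp: in_keys_iff lookup_free_part split: if_splits)
    then show ?thesis by (auto simp: cst.hom_prod cst.hom_power \<sigma>_var_def Y_def intro!: prod.cong)
  qed
  have "\<sigma> (single \<alpha> c) = cst (\<iota> c) * mon \<sigma>_var \<alpha>"
    unfolding \<sigma>_def by (rule evalp_single[OF cst_\<iota>_hom])
  also have "mon \<sigma>_var \<alpha> = (\<Prod>i\<in>C. \<sigma>_var i ^ lookup \<alpha> i) * (\<Prod>i\<in>Y. \<sigma>_var i ^ lookup \<alpha> i)"
    unfolding mon_superset[OF finite_lessThan assms] un(1) using fin un(2) by (rule prod.union_disjoint)
  finally show ?thesis unfolding 1 2
    by (subst single_eq_cst_mon) (simp add: cst.hom_mult mult_ac)
qed

text \<open>The coefficient of \<sigma> p at a given bound exponent is the value of a polynomial in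
  the free coordinates, which are independent. Among monomials with the same bound part the free
  part determines the exponent, so the polynomial g collects them without cancellation.\<close>

lemma \<sigma>_inj:
  assumes p: "p \<in> polys {..<n}" and "\<sigma> p = 0"
  shows "p = 0"
proof (rule poly_mapping_eqI)
  fix \<alpha>0
  have keys: "keys \<alpha> \<subseteq> {..<n}" if "\<alpha> \<in> keys p" for \<alpha>
    using p that by (auto simp: polys_over_def)
  define K where "K = {\<alpha> \<in> keys p. bound_part \<alpha> = bound_part \<alpha>0}"
  have K: "finite K" by (simp add: K_def)
  define g where "g = (\<Sum>\<alpha>\<in>K. single (free_part \<alpha>) (lookup p \<alpha>))"
  have "g \<in> polys Y" unfolding g_def
    by (intro P_closed(6) polys_over_single[OF subring_set_UNIV])
      (auto simp: in_keys_iff lookup_free_part split: if_splits)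
  moreover have "ev g = 0"
  proof -
    have "\<sigma> p = (\<Sum>\<alpha>\<in>keys p. \<sigma> (single \<alpha> (lookup p \<alpha>)))"
      by (subst (1) mpoly_expand[of p]) (simp add: \<sigma>.hom_sum)
    also have "\<dots> = (\<Sum>\<alpha>\<in>keys p. single (bound_part \<alpha>)
        (\<iota> (lookup p \<alpha>) * mon x (free_part \<alpha>)))"
      by (intro sum.cong refl \<sigma>_single keys)
    finally have "lookup (\<sigma> p) (bound_part \<alpha>0) = (\<Sum>\<alpha>\<in>keys p.
        if bound_part \<alpha> = bound_part \<alpha>0 then \<iota> (lookup p \<alpha>) * mon x (free_part \<alpha>) else 0)"
      by (simp add: lookup_sum lookup_single when_def)
    also have "\<dots> = (\<Sum>\<alpha>\<in>K. \<iota> (lookup p \<alpha>) * mon x (free_part \<alpha>))"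
      unfolding K_def by (subst sum.inter_filter) simp_all
    also have "\<dots> = ev g" by (simp add: g_def evalp_sum[OF hom] evalp_single[OF hom])
    finally show ?thesis using assms(2) by simp
  qed
  ultimately have "g = 0" by (rule free_coordinates_independent)
  show "lookup p \<alpha>0 = lookup 0 \<alpha>0"
  proof (rule ccontr)
    assume "lookup p \<alpha>0 \<noteq> lookup 0 \<alpha>0"
    then have \<alpha>0: "\<alpha>0 \<in> keys p" by (simp add: in_keys_iff)
    have inj: "\<alpha> = \<alpha>0" if "\<alpha> \<in> K" "free_part \<alpha> = free_part \<alpha>0" for \<alpha>
    proof (rule poly_mapping_eqI)
      fix i
      have bp: "bound_part \<alpha> = bound_part \<alpha>0" and \<alpha>: "\<alpha> \<in> keys p" using that(1) by (auto simp: K_def)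
      consider "i \<in> C" | "i \<in> Y" | "i \<notin> {..<n}" by (auto simp: Y_def)
      then show "lookup \<alpha> i = lookup \<alpha>0 i"
      proof cases
        case 1
        then obtain c where "c < r" "i = \<gamma> c" by (rule C_E)
        then show ?thesis using arg_cong[OF bp, of "\<lambda>\<beta>. lookup \<beta> c"] by (simp add: lookup_bound_part)
      next
        case 2
        then show ?thesis using arg_cong[OF that(2), of "\<lambda>\<beta>. lookup \<beta> i"] by (simp add: lookup_free_part)
      next
        case 3
        then have "i \<notin> keys \<alpha>" "i \<notin> keys \<alpha>0" using keys[OF \<alpha>] keys[OF \<alpha>0] by auto
        then show ?thesis by (simp add: in_keys_iff)
      qed
    qed
    have "lookup g (free_part \<alpha>0) = (\<Sum>\<alpha>\<in>K. if \<alpha> = \<alpha>0 then lookup p \<alpha> else 0)"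
      unfolding g_def lookup_sum by (intro sum.cong refl) (auto simp: lookup_single when_def dest: inj)
    also have "\<dots> = lookup p \<alpha>0" using \<alpha>0 K by (simp add: K_def)
    finally show False using \<open>g = 0\<close> \<alpha>0 by (simp add: in_keys_iff)
  qed
qed

lemma pderiv_\<sigma>:
  assumes "p \<in> polys {..<n}" "c < r"
  shows "pderiv_mp c (\<sigma> p) = \<sigma> (pderiv_mp (\<gamma> c) p)"
  using subring_set_UNIV assms(1)
proof (induction rule: polys_over_induct)
  case (var i)
  show ?case
  proof (cases "i \<in> C")
    case True
    then obtain d where "d < r" "i = \<gamma> d" by (rule C_E)
    then show ?thesis using True \<gamma>_inj assms(2) by (auto simp: \<sigma>_var_def inj_on_eq_iff)
  next
    case False
    then have "i \<noteq> \<gamma> c" using \<gamma>_C[OF assms(2)] by auto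
    then show ?thesis using False by (simp add: \<sigma>_var_def)
  qed
qed (simp_all add: pderiv_mp_add pderiv_mp_mult \<sigma>.hom_add \<sigma>.hom_mult)

text \<open>As \<sigma> turns derivatives in bound variables into derivatives in the renamed ones,
  the Jacobian determinant at \<xi> is the chosen minor.\<close>

sublocale nz: nondegenerate_zero B r \<xi> "\<lambda>a. \<sigma> (f (\<rho> a))"
proof
  show "subring_set B" by (rule B_subring)
  have f\<rho>: "f (\<rho> a) \<in> polys {..<n}" if "a < r" for a using f_in \<rho> that by auto
  then show "\<sigma> (f (\<rho> a)) \<in> polys_over B {..<r}" if "a < r" for a using \<sigma>_in that by blast
  show "ev1 (\<sigma> (f (\<rho> a))) = 0" if "a < r" for a using ev_f \<rho> that by (auto simp: ev1_\<sigma>)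
  have "mat r r (\<lambda>(a, c). ev1 (pderiv_mp c (\<sigma> (f (\<rho> a))))) = submat r (jacobi \<iota> x f) \<rho> \<gamma>"
    by (rule eq_matI) (auto simp: submat_def jacobi_def pderiv_\<sigma>[OF f\<rho>] ev1_\<sigma>)
  then show "det (mat r r (\<lambda>(a, c). ev1 (pderiv_mp c (\<sigma> (f (\<rho> a)))))) \<noteq> 0" using minor_nz by simp
qed

text \<open>\<open>vanishing_multiplier\<close> pulled back along \<sigma>. It replaces the full
  list of m equations by the r selected ones, which are all that Newton iteration controls.\<close>

lemma relation_multiplier:
  assumes p: "p \<in> polys {..<n}" "ev p = 0"
  shows "\<exists>H Q. ev H \<noteq> 0 \<and> H * p = (\<Sum>a<r. Q a * f (\<rho> a))"
proof -
  obtain H' Q' where HQ: "H' \<in> polys_over B {..<r}" "ev1 H' \<noteq> 0" "\<And>a. a < r \<Longrightarrow> Q' a \<in> polys_over B {..<r}"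
    "H' * \<sigma> p = (\<Sum>a<r. Q' a * \<sigma> (f (\<rho> a)))"
  proof -
    have "ev1 (\<sigma> p) = 0" using p(2) by (simp add: ev1_\<sigma>)
    from nz.vanishing_multiplier[OF \<sigma>_in[OF p(1)] this] that show ?thesis by blast
  qed
  obtain H where H: "H \<in> polys {..<n}" "\<sigma> H = H'" using \<sigma>_surj[OF HQ(1)] by blast
  have "\<forall>a\<in>{..<r}. \<exists>q. q \<in> polys {..<n} \<and> \<sigma> q = Q' a" using \<sigma>_surj HQ(3) by blast
  from bchoice[OF this] obtain Q where Q: "\<And>a. a < r \<Longrightarrow> Q a \<in> polys {..<n}" "\<And>a. a < r \<Longrightarrow> \<sigma> (Q a) = Q' a"
    by blast
  have "\<sigma> (H * p - (\<Sum>a<r. Q a * f (\<rho> a))) = 0"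
    using HQ(4) by (simp add: \<sigma>.hom_minus \<sigma>.hom_mult \<sigma>.hom_sum H Q)
  moreover have "H * p - (\<Sum>a<r. Q a * f (\<rho> a)) \<in> polys {..<n}"
    using H(1) p(1) Q(1) f_in \<rho>
    by (intro subring_setD(6)[OF subring_set_polys_over[OF subring_set_UNIV]] P_closed) auto
  ultimately have "H * p - (\<Sum>a<r. Q a * f (\<rho> a)) = 0" using \<sigma>_inj by blast
  moreover have "ev H \<noteq> 0" using HQ(2) H(2) ev1_\<sigma>[of H] by simp
  ultimately show ?thesis by (metis eq_iff_diff_eq_0)
qed

text \<open>Up to a unit every element is a value \<open>ev p\<close>, and to such values the
  characteristic polynomial argument over \<open>B\<close> applies.\<close>

lemma multiple_in_free_coordinates:
  assumes "y \<noteq> 0"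
  shows "\<exists>g\<in>polys Y. ev g \<noteq> 0 \<and> y dvd ev g"
proof -
  obtain p q t where pq: "p \<in> polys {..<n}" "ev q * t = 1" "y * ev q = ev p"
    using fraction_rep[of y] by blast
  have "ev q \<noteq> 0" using pq(2) by auto
  then have "ev p \<noteq> 0" using pq(3) assms by (metis no_zero_divisors)
  then have "\<exists>d\<in>B. d \<noteq> 0 \<and> ev p dvd d"
    using nz.multiple_in_subring[OF \<sigma>_in[OF pq(1)]] by (simp add: ev1_\<sigma>)
  then obtain g where g: "g \<in> polys Y" "ev g \<noteq> 0" "ev p dvd ev g" by (auto simp: B_def)
  have "y dvd ev p" unfolding pq(3)[symmetric] by simp
  then have "y dvd ev g" using g(3) by (rule dvd_trans)
  then show ?thesis using g by blast
qed

end

section \<open>Formal deformations along a free coordinate\<close>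

lemma fps_X_power_dvd_iff:
  fixes s :: "'a::comm_ring_1 fps"
  shows "fps_X ^ N dvd s \<longleftrightarrow> (\<forall>k<N. fps_nth s k = 0)"
proof
  assume "\<forall>k<N. fps_nth s k = 0"
  then have "s = fps_X ^ N * fps_shift N s" by (intro fps_ext) (auto simp: fps_X_power_mult_nth)
  then show "fps_X ^ N dvd s" by (rule dvdI)
qed (auto simp: fps_X_power_mult_nth elim!: dvdE)

lemma fps_const_hom: "comm_ring_hom (fps_const :: 'a::comm_ring_1 \<Rightarrow> 'a fps)"
  by (rule comm_ring_homI) simp_all

lemma fps_nth_0_hom: "comm_ring_hom (\<lambda>s :: 'a::comm_ring_1 fps. fps_nth s 0)"
  by (rule comm_ring_homI) (simp_all add: fps_mult_nth_0)

text \<open>The contraction principle in the adic topology of \<open>fps_X\<close>, started at 0.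
  The hypotheses concern only families divisible by \<open>fps_X\<close>, and \<Psi> maps such
  families to such families.\<close>

lemma fps_contraction_fixpoint:
  fixes \<Psi> :: "(nat \<Rightarrow> 'a::comm_ring_1 fps) \<Rightarrow> nat \<Rightarrow> 'a fps"
  assumes X: "\<And>w a. (\<And>a. fps_X dvd w a) \<Longrightarrow> fps_X dvd \<Psi> w a"
    and contr: "\<And>w w' N a. (\<And>a. fps_X dvd w a) \<Longrightarrow> (\<And>a. fps_X dvd w' a) \<Longrightarrow>
      (\<And>a. fps_X ^ N dvd w a - w' a) \<Longrightarrow> fps_X ^ Suc N dvd \<Psi> w a - \<Psi> w' a"
  shows "\<exists>w. (\<forall>a. fps_X dvd w a) \<and> (\<forall>a. \<Psi> w a = w a)"
proof -
  define W where "W = (\<lambda>N. (\<Psi> ^^ N) (\<lambda>_. 0))"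
  have W_Suc: "W (Suc N) = \<Psi> (W N)" for N by (simp add: W_def)
  have WX: "fps_X dvd W N a" for N a
    by (induction N arbitrary: a) (auto simp: W_Suc intro: X, simp add: W_def)
  have step: "fps_X ^ N dvd W (Suc N) a - W N a" for N a
  proof (induction N arbitrary: a)
    case (Suc N)
    show ?case
      using contr[where w = "W (Suc N)" and w' = "W N", OF WX WX Suc] unfolding W_Suc[symmetric] .
  qed simp
  have diff: "fps_X ^ N dvd W (N + k) a - W N a" for N k a
  proof (induction k)
    case (Suc k)
    have "fps_X ^ N dvd W (Suc (N + k)) a - W (N + k) a"
      by (rule dvd_trans[OF _ step]) (simp add: le_imp_power_dvd)
    from dvd_add[OF this Suc] show ?case by simp
  qed simp
  \<comment> \<open>The coefficient at k no longer changes from the iterate \<open>W (Suc k)\<close>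
    on, so it is the coefficient of the limit.\<close>
  define w where "w = (\<lambda>a. Abs_fps (\<lambda>k. fps_nth (W (Suc k) a) k))"
  have lim: "fps_X ^ N dvd w a - W N a" for N a
    unfolding fps_X_power_dvd_iff
  proof (intro allI impI)
    fix k assume "k < N"
    then obtain l where l: "N = Suc k + l" using less_imp_Suc_add by fastforce
    have "fps_nth (W N a - W (Suc k) a) k = 0"
      using diff[of "Suc k" l a] unfolding l fps_X_power_dvd_iff by blast
    then show "fps_nth (w a - W N a) k = 0" by (simp add: w_def)
  qed
  have wX: "fps_X dvd w a" for a
    using dvd_add[OF lim[of 1 a, unfolded power_one_right] WX[of 1 a]] by simp
  have "\<Psi> w a = w a" for a
  proof -
    have "fps_X ^ N dvd \<Psi> w a - w a" for N
    proof -
      have "fps_X ^ Suc N dvd \<Psi> w a - \<Psi> (W N) a" by (rule contr[OF wX WX lim])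
      moreover have "fps_X ^ Suc N dvd w a - W (Suc N) a" by (rule lim)
      ultimately have "fps_X ^ Suc N dvd (\<Psi> w a - \<Psi> (W N) a) - (w a - W (Suc N) a)" by (rule dvd_diff)
      then have "fps_X ^ Suc N dvd \<Psi> w a - w a" by (simp add: W_Suc)
      then show ?thesis by (rule dvd_trans[rotated]) (simp add: le_imp_power_dvd)
    qed
    then have "fps_nth (\<Psi> w a - w a) k = 0" for k unfolding fps_X_power_dvd_iff by blast
    then have "\<Psi> w a - w a = 0" by (intro fps_ext) (simp only: fps_zero_nth)
    then show ?thesis by simp
  qed
  then show ?thesis using wX by blast
qed

text \<open>The expansion at x of p in the increment D s, with D^2 split off the part beyond the
  linear term. That part is of second order in s, hence contracting on families divisible by
  \<open>fps_X\<close>: agreement modulo \<open>fps_X ^ N\<close> improves by one power.\<close>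

definition taylor_remainder ::
  "('k::comm_ring_1 \<Rightarrow> 'a::comm_ring_1) \<Rightarrow> (nat \<Rightarrow> 'a) \<Rightarrow> 'a \<Rightarrow> nat \<Rightarrow> 'k mpoly \<Rightarrow>
    ((nat \<Rightarrow> 'a fps) \<Rightarrow> 'a fps) \<Rightarrow> bool" where
  "taylor_remainder \<iota> x D n p Q \<longleftrightarrow> (\<forall>s. (\<forall>k. fps_X dvd s k) \<longrightarrow>
    evalp (\<lambda>c. fps_const (\<iota> c)) (\<lambda>k. fps_const (x k) + fps_const D * s k) p =
      fps_const (evalp \<iota> x p) + fps_const D * ((\<Sum>k<n. fps_const (evalp \<iota> x (pderiv_mp k p)) * s k) + fps_const D * Q s) \<and>
    fps_X dvd Q s \<and>
    (\<forall>s' N. (\<forall>k. fps_X dvd s' k) \<longrightarrow> (\<forall>k. fps_X ^ N dvd s k - s' k) \<longrightarrow> fps_X ^ Suc N dvd Q s - Q s'))"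

text \<open>Induction on the structure of p needs no higher derivatives and no division by
  factorials, so the expansion holds in every characteristic.\<close>

lemma fps_taylor_second_order:
  fixes \<iota> :: "'k::comm_ring_1 \<Rightarrow> 'a::comm_ring_1" and x :: "nat \<Rightarrow> 'a" and D :: 'a
  assumes hom: "comm_ring_hom \<iota>" and "p \<in> polys {..<n}"
  shows "\<exists>Q. taylor_remainder \<iota> x D n p Q"
  using subring_set_UNIV assms(2)
proof (induction rule: polys_over_induct)
  interpret ev: comm_ring_hom "evalp \<iota> x" by (rule evalp_hom[OF hom])
  interpret fc: comm_ring_hom "fps_const :: 'a \<Rightarrow> 'a fps" by (rule fps_const_hom)
  interpret \<iota>: comm_ring_hom \<iota> by (rule hom)
  define \<phi> where "\<phi> = (\<lambda>c. fps_const (\<iota> c))"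
  have \<phi>: "comm_ring_hom \<phi>"
    by (rule comm_ring_homI) (simp_all add: \<phi>_def \<iota>.hom_add \<iota>.hom_mult)
  define T where "T = (\<lambda>s. evalp \<phi> (\<lambda>k. fps_const (x k) + fps_const D * s k))"
  have Thom: "T s (p + q) = T s p + T s q" "T s (p * q) = T s p * T s q" for s p q
    unfolding T_def by (rule evalp_add[OF \<phi>], rule evalp_mult[OF \<phi>])
  define L where "L = (\<lambda>p s. \<Sum>k<n. fps_const (evalp \<iota> x (pderiv_mp k p)) * s k)"
  have LX: "fps_X dvd L p s" if "\<forall>k. fps_X dvd s k" for p s
    unfolding L_def using that by (intro dvd_sum) simp
  have LN: "fps_X ^ N dvd L p s - L p s'" if "\<forall>k. fps_X ^ N dvd s k - s' k" for p s s' N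
    unfolding L_def sum_subtractf[symmetric] right_diff_distrib[symmetric]
    using that by (intro dvd_sum) simp
  have Ladd: "L (p + q) s = L p s + L q s" for p q s
    by (simp add: L_def pderiv_mp_add ev.hom_add fc.hom_add distrib_right sum.distrib del: fps_const_add)
  have Lmult: "L (p * q) s = fps_const (evalp \<iota> x q) * L p s + fps_const (evalp \<iota> x p) * L q s" for p q s
    by (simp add: L_def pderiv_mp_mult ev.hom_add ev.hom_mult fc.hom_add fc.hom_mult sum_distrib_left
        sum.distrib algebra_simps del: fps_const_add fps_const_mult)
  define R where "R = (\<lambda>p Q. \<forall>s. (\<forall>k. fps_X dvd s k) \<longrightarrow>
    T s p = fps_const (evalp \<iota> x p) + fps_const D * (L p s + fps_const D * Q s) \<and>
    fps_X dvd Q s \<and>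
    (\<forall>s' N. (\<forall>k. fps_X dvd s' k) \<longrightarrow> (\<forall>k. fps_X ^ N dvd s k - s' k) \<longrightarrow> fps_X ^ Suc N dvd Q s - Q s'))"
  have goal: "taylor_remainder \<iota> x D n p Q \<longleftrightarrow> R p Q" for p Q
    unfolding taylor_remainder_def R_def T_def L_def \<phi>_def by (rule refl)
  {
    case (cst c)
    have "R (cst c) (\<lambda>_. 0)"
      unfolding R_def T_def evalp_cst[OF \<phi>] evalp_cst[OF hom] by (simp add: \<phi>_def L_def)
    then show ?case unfolding goal by blast
  next
    case (var i)
    have "L (var i) s = s i" for s
      using var by (simp add: L_def if_distrib[of "evalp \<iota> x"] if_distrib[of fps_const] if_distrib[of "\<lambda>z. z * _"] sum.delta' cong: if_cong)
    then have "R (var i) (\<lambda>_. 0)"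
      by (simp add: R_def T_def evalp_var[OF \<phi>] evalp_var[OF hom])
    then show ?case unfolding goal by blast
  next
    case (add p q)
    then obtain P Q where P: "R p P" and Q: "R q Q" unfolding goal by blast
    have "R (p + q) (\<lambda>s. P s + Q s)"
      unfolding R_def
    proof (intro allI impI conjI)
      fix s :: "nat \<Rightarrow> 'a fps" assume s: "\<forall>k. fps_X dvd s k"
      show "T s (p + q) = fps_const (evalp \<iota> x (p + q)) + fps_const D * (L (p + q) s + fps_const D * (P s + Q s))"
      proof -
        have "T s p = fps_const (evalp \<iota> x p) + fps_const D * (L p s + fps_const D * P s)"
          "T s q = fps_const (evalp \<iota> x q) + fps_const D * (L q s + fps_const D * Q s)"
          using P Q s unfolding R_def by blast+
        then show ?thesis
          unfolding Thom Ladd ev.hom_add fc.hom_add by (simp only: distrib_left ac_simps)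
      qed
      show "fps_X dvd P s + Q s" using P Q s by (auto simp: R_def intro: dvd_add)
      fix s' N assume s': "\<forall>k. fps_X dvd s' k" "\<forall>k. fps_X ^ N dvd s k - s' k"
      have "fps_X ^ Suc N dvd P s - P s'" "fps_X ^ Suc N dvd Q s - Q s'"
        using P Q s s' unfolding R_def by blast+
      from dvd_add[OF this] show "fps_X ^ Suc N dvd P s + Q s - (P s' + Q s')"
        by (simp add: algebra_simps)
    qed
    then show ?case unfolding goal by blast
  next
    case (mult p q)
    then obtain P Q where P: "R p P" and Q: "R q Q" unfolding goal by blast
    define u where "u = (\<lambda>s. L p s + fps_const D * P s)"
    define v where "v = (\<lambda>s. L q s + fps_const D * Q s)"
    let ?p = "fps_const (evalp \<iota> x p)" and ?q = "fps_const (evalp \<iota> x q)"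
    have uX: "fps_X dvd u s" "fps_X dvd v s" if "\<forall>k. fps_X dvd s k" for s
      unfolding u_def v_def using LX[OF that] P Q that unfolding R_def by (auto intro: dvd_add)
    \<comment> \<open>Multiply p(x) + D u by q(x) + D v: besides the two old remainders, scaled by
      constants, the new remainder receives the product u v.\<close>
    have "R (p * q) (\<lambda>s. ?p * Q s + ?q * P s + u s * v s)"
      unfolding R_def
    proof (intro allI impI conjI)
      fix s :: "nat \<Rightarrow> 'a fps" assume s: "\<forall>k. fps_X dvd s k"
      have "T s p = ?p + fps_const D * u s" "T s q = ?q + fps_const D * v s"
        using P Q s by (simp_all add: R_def u_def v_def)
      then have "T s (p * q) = ?p * ?q + fps_const D * (?p * v s + ?q * u s + fps_const D * (u s * v s))"
        by (simp add: Thom algebra_simps)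
      also have "?p * v s + ?q * u s = L (p * q) s + fps_const D * (?p * Q s + ?q * P s)"
        by (simp add: Lmult u_def v_def algebra_simps del: fps_const_mult)
      finally show "T s (p * q) = fps_const (evalp \<iota> x (p * q)) +
          fps_const D * (L (p * q) s + fps_const D * (?p * Q s + ?q * P s + u s * v s))"
        by (simp add: ev.hom_mult fc.hom_mult distrib_left add.assoc del: fps_const_mult)
      show "fps_X dvd ?p * Q s + ?q * P s + u s * v s"
        using P Q s uX[OF s] by (auto simp: R_def intro!: dvd_add)
      fix s' N assume s': "\<forall>k. fps_X dvd s' k" "\<forall>k. fps_X ^ N dvd s k - s' k"
      have PQ: "fps_X ^ Suc N dvd P s - P s'" "fps_X ^ Suc N dvd Q s - Q s'"
        using P Q s s' unfolding R_def by blast+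
      have PQ': "fps_X ^ N dvd P s - P s'" "fps_X ^ N dvd Q s - Q s'"
        using dvd_trans[OF le_imp_power_dvd PQ(1), of N] dvd_trans[OF le_imp_power_dvd PQ(2), of N] by simp_all
      have "u s - u s' = (L p s - L p s') + fps_const D * (P s - P s')"
        "v s - v s' = (L q s - L q s') + fps_const D * (Q s - Q s')"
        by (simp_all add: u_def v_def algebra_simps)
      then have uv: "fps_X ^ N dvd u s - u s'" "fps_X ^ N dvd v s - v s'"
        using LN[OF s'(2)] PQ' by (simp_all add: dvd_add)
      \<comment> \<open>The extra power of \<open>fps_X\<close> comes from the undifferenced factor,
        which is divisible by \<open>fps_X\<close>.\<close>
      have uvs: "fps_X ^ Suc N dvd u s * (v s - v s')" "fps_X ^ Suc N dvd (u s - u s') * v s'"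
        using mult_dvd_mono[OF uX(1)[OF s] uv(2)] mult_dvd_mono[OF uv(1) uX(2)[OF s'(1)]]
        by (simp_all add: mult.commute)
      have "fps_X ^ Suc N dvd ?p * (Q s - Q s') + ?q * (P s - P s') + (u s * (v s - v s') + (u s - u s') * v s')"
        by (rule dvd_add[OF dvd_add[OF dvd_mult[OF PQ(2)] dvd_mult[OF PQ(1)]] dvd_add[OF uvs]])
      also have "?p * (Q s - Q s') + ?q * (P s - P s') + (u s * (v s - v s') + (u s - u s') * v s') =
          ?p * Q s + ?q * P s + u s * v s - (?p * Q s' + ?q * P s' + u s' * v s')"
        by (simp add: algebra_simps)
      finally show "fps_X ^ Suc N dvd ?p * Q s + ?q * P s + u s * v s - (?p * Q s' + ?q * P s' + u s' * v s')" .
    qed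
    then show ?case unfolding goal by blast
  }
qed

section \<open>The deformation homomorphism\<close>

context jacobi_chart
begin

abbreviation "J \<equiv> jacobi \<iota> x f"
abbreviation "evX s \<equiv> evalp (\<lambda>c. fps_const (\<iota> c)) (\<lambda>k. fps_const (x k) + fps_const \<Delta> * s k)"

lemma fps_\<iota>_hom: "comm_ring_hom (\<lambda>c. fps_const (\<iota> c))"
  by (rule comm_ring_homI) (simp_all add: \<iota>.hom_add \<iota>.hom_mult)

text \<open>Newton iteration: with \<open>s\<close> of the form \<open>adj J \<cdot> w\<close> in the bound coordinates, the equations
  \<open>f = 0\<close> become a contracting fixed point problem for \<open>w\<close>, without dividing by the minor.\<close>
lemma newton:
  assumes j: "j \<in> Y"
  shows "\<exists>s. (\<forall>k. fps_X dvd s k) \<and> (\<forall>a<r. evX s (f (\<rho> a)) = 0) \<and>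
    (\<forall>k\<in>Y. s k = (if k = j then fps_const \<Delta> * fps_X else 0))"
proof -
  interpret fc: comm_ring_hom "fps_const :: 'a \<Rightarrow> 'a fps" by (rule fps_const_hom)
  have f\<rho>: "f (\<rho> a) \<in> polys {..<n}" if "a < r" for a using f_in \<rho> that by auto
  have "\<forall>a\<in>{..<r}. \<exists>Q. taylor_remainder \<iota> x \<Delta> n (f (\<rho> a)) Q"
    by (intro ballI fps_taylor_second_order[OF hom f\<rho>]) simp
  from bchoice[OF this] obtain Q where
    Q: "\<And>a. a < r \<Longrightarrow> taylor_remainder \<iota> x \<Delta> n (f (\<rho> a)) (Q a)" by auto
  have Q1: "evX s (f (\<rho> a)) = fps_const \<Delta> * ((\<Sum>k<n. fps_const (J (\<rho> a) k) * s k) + fps_const \<Delta> * Q a s)"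
    if "a < r" "\<And>k. fps_X dvd s k" for a s
  proof -
    have "ev (f (\<rho> a)) = 0" using ev_f \<rho> that(1) by auto
    then show ?thesis using Q[OF that(1)] that(2) by (simp add: taylor_remainder_def jacobi_def)
  qed
  have Q2: "fps_X dvd Q a s" if "a < r" "\<And>k. fps_X dvd s k" for a s
    using Q[OF that(1)] that(2) by (simp add: taylor_remainder_def)
  have Q3: "fps_X ^ Suc N dvd Q a s - Q a s'"
    if "a < r" "\<And>k. fps_X dvd s k" "\<And>k. fps_X dvd s' k" "\<And>k. fps_X ^ N dvd s k - s' k" for a s s' N
    using Q[OF that(1)] that(2-4) unfolding taylor_remainder_def by blast
  define Adj where "Adj = (\<lambda>c a. fps_const (adj_mat (submat r J \<rho> \<gamma>) $$ (c, a)))"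
  \<comment> \<open>The Jacobi submatrix times its adjugate is \<Delta> times the identity, so the
    bound coordinates contribute \<Delta> w a to the linear term. The factor \<Delta> in coordinate
    j makes its contribution divisible by \<Delta> too; together with the \<Delta> in
    \<open>evX\<close> this moves x_j by \<Delta>^2 times \<open>fps_X\<close>.\<close>
  define S where "S = (\<lambda>w k. if k \<in> C then \<Sum>a<r. Adj (the_inv_into {..<r} \<gamma> k) a * w a
    else if k = j then fps_const \<Delta> * fps_X else 0)"
  have SX: "fps_X dvd S w k" if "\<And>a. fps_X dvd w a" for w k
    using that by (auto simp: S_def intro!: dvd_sum)
  have SN: "fps_X ^ N dvd S w k - S w' k" if "\<And>a. fps_X ^ N dvd w a - w' a" for w w' N k
    using that by (auto simp: S_def sum_subtractf[symmetric] right_diff_distrib[symmetric] intro!: dvd_sum)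
  \<comment> \<open>Splitting \<Delta>^2 off \<open>evX (S w) (f (\<rho> a))\<close> leaves w a + J
    (\<rho> a) j times \<open>fps_X\<close> + Q a (S w). A fixed point of \<Psi> makes this factor
    vanish.\<close>
  define \<Psi> where "\<Psi> = (\<lambda>w a. if a < r then - (fps_const (J (\<rho> a) j) * fps_X + Q a (S w)) else 0)"
  have "\<exists>w. (\<forall>a. fps_X dvd w a) \<and> (\<forall>a. \<Psi> w a = w a)"
  proof (rule fps_contraction_fixpoint)
    show "fps_X dvd \<Psi> w a" if "\<And>a. fps_X dvd w a" for w a
      using Q2[of a "S w", OF _ SX[OF that]] by (auto simp: \<Psi>_def simp del: minus_add_distrib intro!: dvd_add)
    show "fps_X ^ Suc N dvd \<Psi> w a - \<Psi> w' a"
      if "\<And>a. fps_X dvd w a" "\<And>a. fps_X dvd w' a" "\<And>a. fps_X ^ N dvd w a - w' a" for w w' N a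
    proof (cases "a < r")
      case True
      have "fps_X ^ Suc N dvd - (Q a (S w) - Q a (S w'))"
        unfolding dvd_minus_iff by (rule Q3[OF True SX[OF that(1)] SX[OF that(2)] SN[OF that(3)]])
      then show ?thesis using True by (simp add: \<Psi>_def)
    qed (simp add: \<Psi>_def)
  qed
  then obtain w where w: "\<And>a. fps_X dvd w a" "\<And>a. \<Psi> w a = w a" by blast
  have fin: "finite C" "finite Y" by (auto simp: C_def Y_def)
  have un: "{..<n} = C \<union> Y" "C \<inter> Y = {}" using \<gamma> by (auto simp: C_def Y_def)
  have "evX (S w) (f (\<rho> a)) = 0" if a: "a < r" for a
  proof -
    have M: "submat r J \<rho> \<gamma> \<in> carrier_mat r r" by simp
    have adj: "(\<Sum>c<r. J (\<rho> a) (\<gamma> c) * adj_mat (submat r J \<rho> \<gamma>) $$ (c, b)) = (if a = b then \<Delta> else 0)" if "b < r" for b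
    proof -
      have "(submat r J \<rho> \<gamma> * adj_mat (submat r J \<rho> \<gamma>)) $$ (a, b) =
          (\<Sum>c<r. J (\<rho> a) (\<gamma> c) * adj_mat (submat r J \<rho> \<gamma>) $$ (c, b))"
        using a that adj_mat(1)[OF M]
        by (auto simp: submat_def scalar_prod_def atLeast0LessThan intro!: sum.cong)
      then show ?thesis using a that by (auto simp: adj_mat(2)[OF M])
    qed
    have "(\<Sum>k\<in>C. fps_const (J (\<rho> a) k) * S w k) = (\<Sum>c<r. \<Sum>b<r. fps_const (J (\<rho> a) (\<gamma> c)) * Adj c b * w b)"
      unfolding C_def sum.reindex[OF \<gamma>_inj] o_def
      by (intro sum.cong refl) (simp add: S_def C_def sum_distrib_left mult.assoc)
    also have "\<dots> = (\<Sum>b<r. fps_const (\<Sum>c<r. J (\<rho> a) (\<gamma> c) * adj_mat (submat r J \<rho> \<gamma>) $$ (c, b)) * w b)"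
      by (subst sum.swap)
        (simp add: Adj_def sum_distrib_right fc.hom_sum)
    also have "\<dots> = (\<Sum>b<r. (if a = b then fps_const \<Delta> * w b else 0))"
      by (intro sum.cong refl) (simp add: adj)
    also have "\<dots> = fps_const \<Delta> * w a" using a by simp
    finally have sumC: "(\<Sum>k\<in>C. fps_const (J (\<rho> a) k) * S w k) = fps_const \<Delta> * w a" .
    have "(\<Sum>k\<in>Y. fps_const (J (\<rho> a) k) * S w k) = (\<Sum>k\<in>Y. if k = j then fps_const (J (\<rho> a) j) * (fps_const \<Delta> * fps_X) else 0)"
      by (intro sum.cong refl) (auto simp: S_def Y_def)
    also have "\<dots> = fps_const \<Delta> * (fps_const (J (\<rho> a) j) * fps_X)"
      using j fin by (simp add: mult.left_commute)
    finally have sumY: "(\<Sum>k\<in>Y. fps_const (J (\<rho> a) k) * S w k) = fps_const \<Delta> * (fps_const (J (\<rho> a) j) * fps_X)" .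
    have "(\<Sum>k<n. fps_const (J (\<rho> a) k) * S w k) + fps_const \<Delta> * Q a (S w) =
        fps_const \<Delta> * (w a + fps_const (J (\<rho> a) j) * fps_X + Q a (S w))"
      unfolding un(1) sum.union_disjoint[OF fin un(2)] sumC sumY by (simp only: distrib_left)
    also have "w a + fps_const (J (\<rho> a) j) * fps_X + Q a (S w) = 0"
    proof -
      have "w a = - (fps_const (J (\<rho> a) j) * fps_X + Q a (S w))"
        unfolding w(2)[of a, symmetric] using a by (simp only: \<Psi>_def if_True)
      then show ?thesis by simp
    qed
    finally show ?thesis using Q1[OF a SX[OF w(1)]] by simp
  qed
  moreover have "\<forall>k\<in>Y. S w k = (if k = j then fps_const \<Delta> * fps_X else 0)"
    by (auto simp: S_def Y_def)
  ultimately show ?thesis using SX[OF w(1)] by (intro exI[of _ "S w"] conjI allI impI) simp_all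
qed

text \<open>Substituting the Newton solution kills the r selected equations, hence the whole kernel
  of \<open>ev\<close>, and so factors through the image of the polynomials in A. It extends to A
  because a power series with invertible constant term is invertible. The divisibility by \<Delta>
  is recorded because it makes \<theta> \<Delta> a unit multiple of \<Delta>.\<close>

lemma shift_hom:
  assumes j: "j \<in> Y"
  shows "\<exists>\<theta>. comm_ring_hom \<theta> \<and> (\<forall>c. \<theta> (\<iota> c) = fps_const (\<iota> c)) \<and> (\<forall>y. fps_nth (\<theta> y) 0 = y) \<and>
    (\<forall>y. fps_const \<Delta> dvd \<theta> y - fps_const y) \<and>
    (\<forall>k\<in>Y. \<theta> (x k) = fps_const (x k) + (if k = j then fps_const (\<Delta> ^ 2) * fps_X else 0))"
proof -
  obtain s where s: "\<And>k. fps_X dvd s k" "\<And>a. a < r \<Longrightarrow> evX s (f (\<rho> a)) = 0"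
    "\<And>k. k \<in> Y \<Longrightarrow> s k = (if k = j then fps_const \<Delta> * fps_X else 0)"
    using newton[OF j] by blast
  define T where "T = evX s"
  interpret T: comm_ring_hom T unfolding T_def by (rule evalp_hom[OF fps_\<iota>_hom])
  let ?P = "polys {..<n}"
  have s0: "fps_nth (s k) 0 = 0" for k using s(1)[of k] fps_X_power_dvd_iff[of 1 "s k"] by simp
  have T0: "fps_nth (T p) 0 = ev p" for p
    unfolding T_def by (subst hom_evalp[OF fps_\<iota>_hom fps_nth_0_hom]) (simp add: s0)
  \<comment> \<open>The multiplier H survives under T, since its constant term \<open>ev H\<close>
    is nonzero, and power series over a domain form a domain.\<close>
  have T_zero: "T p = 0" if p: "p \<in> ?P" "ev p = 0" for p
  proof -
    obtain H Q where H: "ev H \<noteq> 0" "H * p = (\<Sum>a<r. Q a * f (\<rho> a))"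
      using relation_multiplier[OF p] by blast
    have "T H * T p = T (\<Sum>a<r. Q a * f (\<rho> a))" unfolding H(2)[symmetric] by (simp add: T.hom_mult)
    also have "\<dots> = (\<Sum>a<r. T (Q a) * T (f (\<rho> a)))" by (simp add: T.hom_sum T.hom_mult)
    also have "\<dots> = 0" using s(2) by (simp add: T_def)
    finally have "T H * T p = 0" .
    moreover have "T H \<noteq> 0" using H(1) T0[of H] by auto
    ultimately show ?thesis by simp
  qed
  have T_dvd: "fps_const \<Delta> dvd T p - fps_const (ev p)" if p: "p \<in> ?P" for p
  proof -
    obtain Q where "T p = fps_const (ev p) + fps_const \<Delta> * ((\<Sum>k<n. fps_const (ev (pderiv_mp k p)) * s k) + fps_const \<Delta> * Q s)"
      using fps_taylor_second_order[OF hom p, of x \<Delta>] s(1) unfolding T_def taylor_remainder_def by blast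
    then show ?thesis by simp
  qed
  have unit: "\<exists>u. T q * u = 1" if "ev q * t = 1" for q t
    using fps_right_inverse[of "T q" t] that T0[of q] by metis
  have cross: "T p * T q' = T p' * T q"
    if "p \<in> ?P" "q \<in> ?P" "p' \<in> ?P" "q' \<in> ?P" "y * ev q = ev p" "y * ev q' = ev p'" for p q p' q' y
  proof -
    have "ev (p * q' - p' * q) = 0"
      by (simp add: ev.hom_minus ev.hom_mult that(5,6)[symmetric])
    moreover have "p * q' - p' * q \<in> ?P"
      using that by (intro subring_setD(4,6)[OF subring_set_polys_over[OF subring_set_UNIV]])
    ultimately have "T (p * q' - p' * q) = 0" by (intro T_zero)
    then show ?thesis by (simp add: T.hom_minus T.hom_mult)
  qed
  \<comment> \<open>One t serves all representations of y as a fraction, so choosing t for each y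
    yields a well-defined \<theta>.\<close>
  have "\<forall>y. \<exists>t. \<forall>p\<in>?P. \<forall>q\<in>?P. y * ev q = ev p \<longrightarrow> t * T q = T p"
  proof
    fix y
    obtain p0 q0 t0 where 0: "p0 \<in> ?P" "q0 \<in> ?P" "ev q0 * t0 = 1" "y * ev q0 = ev p0"
      using fraction_rep[of y] by blast
    obtain u where u: "T q0 * u = 1" using unit[OF 0(3)] by blast
    have "T p0 * u * T q = T p" if "p \<in> ?P" "q \<in> ?P" "y * ev q = ev p" for p q
    proof -
      have "T p0 * u * T q = (T p0 * T q) * u" by (simp add: mult_ac)
      also have "\<dots> = T p * (T q0 * u)" using cross[OF 0(1,2) that(1,2) 0(4) that(3)] by (simp add: mult_ac)
      finally show ?thesis using u by simp
    qed
    then show "\<exists>t. \<forall>p\<in>?P. \<forall>q\<in>?P. y * ev q = ev p \<longrightarrow> t * T q = T p" by blast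
  qed
  from choice[OF this] obtain \<theta> where \<theta>: "\<And>y p q. p \<in> ?P \<Longrightarrow> q \<in> ?P \<Longrightarrow> y * ev q = ev p \<Longrightarrow> \<theta> y * T q = T p"
    by blast
  have one: "1 \<in> ?P" using subring_set_polys_over[OF subring_set_UNIV] by (rule subring_setD)
  have \<theta>_ev: "\<theta> (ev p) = T p" if "p \<in> ?P" for p
    using \<theta>[OF that one, of "ev p"] by (simp add: ev.hom_one T.hom_one)
  have rep: "\<exists>p q u. p \<in> ?P \<and> q \<in> ?P \<and> T q * u = 1 \<and> T q \<noteq> 0 \<and> ev q \<noteq> 0 \<and> y * ev q = ev p \<and> \<theta> y * T q = T p" for y
  proof -
    obtain p q t where 0: "p \<in> ?P" "q \<in> ?P" "ev q * t = 1" "y * ev q = ev p"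
      using fraction_rep[of y] by blast
    obtain u where u: "T q * u = 1" using unit[OF 0(3)] by blast
    have "T q \<noteq> 0" "ev q \<noteq> 0" using u 0(3) by auto
    then show ?thesis using 0 u \<theta>[OF 0(1,2,4)] by blast
  qed
  have "comm_ring_hom \<theta>"
  proof (rule comm_ring_homI)
    show "\<theta> 1 = 1" using \<theta>_ev[OF one] by (simp add: ev.hom_one T.hom_one)
    fix y z
    obtain p q where p: "p \<in> ?P" "q \<in> ?P" "T q \<noteq> 0" "y * ev q = ev p" "\<theta> y * T q = T p"
      using rep[of y] by blast
    obtain p' q' where p': "p' \<in> ?P" "q' \<in> ?P" "T q' \<noteq> 0" "z * ev q' = ev p'" "\<theta> z * T q' = T p'"
      using rep[of z] by blast
    have "(y + z) * ev (q * q') = ev (p * q' + p' * q)"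
      by (simp add: ev.hom_add ev.hom_mult p(4)[symmetric] p'(4)[symmetric] algebra_simps)
    then have "\<theta> (y + z) * T (q * q') = T (p * q' + p' * q)"
      using p p' by (intro \<theta> P_closed) auto
    also have "\<dots> = (\<theta> y + \<theta> z) * T (q * q')"
      by (simp add: T.hom_add T.hom_mult p(5)[symmetric] p'(5)[symmetric] algebra_simps)
    finally show "\<theta> (y + z) = \<theta> y + \<theta> z" using p(3) p'(3) by (simp add: T.hom_mult)
    have "(y * z) * ev (q * q') = ev (p * p')"
      by (simp add: ev.hom_mult p(4)[symmetric] p'(4)[symmetric] algebra_simps)
    then have "\<theta> (y * z) * T (q * q') = T (p * p')"
      using p p' by (intro \<theta> P_closed) auto
    also have "\<dots> = (\<theta> y * \<theta> z) * T (q * q')"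
      by (simp add: T.hom_mult p(5)[symmetric] p'(5)[symmetric] algebra_simps)
    finally show "\<theta> (y * z) = \<theta> y * \<theta> z" using p(3) p'(3) by (simp add: T.hom_mult)
  qed
  moreover have "\<theta> (\<iota> c) = fps_const (\<iota> c)" for c
  proof -
    have "ev (cst c) = \<iota> c" by (rule evalp_cst[OF hom])
    moreover have "T (cst c) = fps_const (\<iota> c)" unfolding T_def by (rule evalp_cst[OF fps_\<iota>_hom])
    ultimately show ?thesis using \<theta>_ev[OF P_closed(4)[of c]] by simp
  qed
  moreover have "fps_nth (\<theta> y) 0 = y" for y
  proof -
    obtain p q where p: "ev q \<noteq> 0" "y * ev q = ev p" "\<theta> y * T q = T p" using rep[of y] by blast
    have "fps_nth (\<theta> y) 0 * ev q = y * ev q"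
      using arg_cong[OF p(3), of "\<lambda>t. fps_nth t 0"] by (simp add: fps_mult_nth_0 T0 p(2))
    then show ?thesis using p(1) by simp
  qed
  moreover have "fps_const \<Delta> dvd \<theta> y - fps_const y" for y
  proof -
    obtain p q u where p: "p \<in> ?P" "q \<in> ?P" "T q * u = 1" "y * ev q = ev p" "\<theta> y * T q = T p"
      using rep[of y] by blast
    \<comment> \<open>Numerator and denominator are both congruent to their constants modulo
      \<Delta>; the inverse u of T q then removes the denominator.\<close>
    have "(\<theta> y - fps_const y) * T q = (T p - fps_const (ev p)) - fps_const y * (T q - fps_const (ev q))"
      by (simp add: p(4)[symmetric] p(5)[symmetric] algebra_simps)
    also have "fps_const \<Delta> dvd \<dots>" by (rule dvd_diff[OF T_dvd[OF p(1)] dvd_mult[OF T_dvd[OF p(2)]]])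
    finally have "fps_const \<Delta> dvd (\<theta> y - fps_const y) * T q * u" by (rule dvd_mult2)
    then show ?thesis by (simp add: mult.assoc p(3))
  qed
  moreover have "\<theta> (x k) = fps_const (x k) + (if k = j then fps_const (\<Delta> ^ 2) * fps_X else 0)" if k: "k \<in> Y" for k
  proof -
    have "ev (var k) = x k" by (rule evalp_var[OF hom])
    moreover have "T (var k) = fps_const (x k) + fps_const \<Delta> * s k" unfolding T_def by (rule evalp_var[OF fps_\<iota>_hom])
    moreover have "var k \<in> ?P" using k Y_n by (intro P_closed) auto
    ultimately show ?thesis using \<theta>_ev[of "var k"] s(3)[OF k]
      by (cases "k = j") (simp_all add: power2_eq_square mult.assoc[symmetric])
  qed
  ultimately show ?thesis by blast
qed

end

section \<open>Ideals of the ring of differential operators\<close>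

text \<open>The coefficients form a Hasse-Schmidt derivation. In the k-th coefficient of \<theta>(s
  y) = \<theta>(s) \<theta>(y) the term with i = 0 is s times the k-th coefficient of \<theta>(y),
  so the commutator with s involves only earlier coefficients.\<close>

lemma deformation_coeff_diffop:
  fixes \<theta> :: "'a::comm_ring_1 \<Rightarrow> 'a fps"
  assumes "comm_ring_hom \<theta>" "\<And>c. \<theta> (\<iota> c) = fps_const (\<iota> c)" "\<And>y. fps_nth (\<theta> y) 0 = y"
  shows "(\<lambda>y. fps_nth (\<theta> y) k) \<in> diffop_lev \<iota> (Suc k)"
proof (induction k rule: less_induct)
  case (less k)
  interpret \<theta>: comm_ring_hom \<theta> by fact
  have "klinear \<iota> (\<lambda>y. fps_nth (\<theta> y) k)"
    by (simp add: klinear_def \<theta>.hom_add \<theta>.hom_mult assms(2))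
  moreover have "(\<lambda>y. s * fps_nth (\<theta> y) k - fps_nth (\<theta> (s * y)) k) \<in> diffop_lev \<iota> k" for s
  proof -
    have "(\<lambda>y. - (\<Sum>i=1..k. fps_nth (\<theta> s) i * fps_nth (\<theta> y) (k - i))) \<in> diffop_lev \<iota> k"
    proof (intro diffop_lev_uminus diffop_lev_sum diffop_lev_lmult)
      fix i assume "i \<in> {1..k}"
      then have "k - i < k" "Suc (k - i) \<le> k" by auto
      then show "(\<lambda>y. fps_nth (\<theta> y) (k - i)) \<in> diffop_lev \<iota> k"
        using less diffop_lev_mono by blast
    qed
    then show ?thesis
    proof (rule mem_congI)
      fix y
      have "fps_nth (\<theta> (s * y)) k = (\<Sum>i=0..k. fps_nth (\<theta> s) i * fps_nth (\<theta> y) (k - i))"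
        by (simp add: \<theta>.hom_mult fps_mult_nth)
      also have "\<dots> = s * fps_nth (\<theta> y) k + (\<Sum>i=1..k. fps_nth (\<theta> s) i * fps_nth (\<theta> y) (k - i))"
        by (simp add: sum.atLeast_Suc_atMost assms(3))
      finally show "s * fps_nth (\<theta> y) k - fps_nth (\<theta> (s * y)) k =
          - (\<Sum>i=1..k. fps_nth (\<theta> s) i * fps_nth (\<theta> y) (k - i))" by simp
    qed
  qed
  ultimately show ?case by simp
qed

text \<open>Let \<theta>_k be the k-th coefficient. As operators, \<theta>_k after multiplication by
  a is the sum over i up to k of \<theta>_i(a) \<theta>_(k-i). The left side lies in
  \<open>I\<close>, the terms with i < k do so by induction, and the term i = k is multiplication by
  \<theta>_k(a), as \<theta>_0 is the identity.\<close>

lemma diffop_ideal_deformation_stable: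
  fixes \<theta> :: "'a::comm_ring_1 \<Rightarrow> 'a fps"
  assumes \<theta>: "comm_ring_hom \<theta>" "\<And>c. \<theta> (\<iota> c) = fps_const (\<iota> c)" "\<And>y. fps_nth (\<theta> y) 0 = y"
    and I: "ideal I (diffop_ring \<iota>)" and a: "(\<lambda>y. a * y) \<in> I"
  shows "(\<lambda>y. fps_nth (\<theta> a) k * y) \<in> I"
proof (induction k rule: less_induct)
  case (less k)
  interpret \<theta>: comm_ring_hom \<theta> by fact
  have D: "(\<lambda>y. fps_nth (\<theta> y) i) \<in> diffops \<iota>" for i
    unfolding diffops_iff using deformation_coeff_diffop[OF \<theta>, of i] by (rule exI)
  have "(\<lambda>y. fps_nth (\<theta> (a * y)) k - (\<Sum>i<k. fps_nth (\<theta> a) i * fps_nth (\<theta> y) (k - i))) \<in> I"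
  proof (intro diffop_ideal_diff[OF I] diffop_ideal_sum[OF I])
    show "(\<lambda>y. fps_nth (\<theta> (a * y)) k) \<in> I" by (rule diffop_ideal_lcomp[OF I a D])
    fix i assume "i \<in> {..<k}"
    then have "(\<lambda>y. fps_nth (\<theta> a) i * y) \<in> I" using less by simp
    then show "(\<lambda>y. fps_nth (\<theta> a) i * fps_nth (\<theta> y) (k - i)) \<in> I"
      by (rule diffop_ideal_rcomp[OF I _ D])
  qed
  then show ?case
  proof (rule mem_congI)
    fix y
    have "fps_nth (\<theta> (a * y)) k = (\<Sum>i=0..k. fps_nth (\<theta> a) i * fps_nth (\<theta> y) (k - i))"
      by (simp add: \<theta>.hom_mult fps_mult_nth)
    also have "{0..k} = insert k {..<k}" by auto
    finally show "fps_nth (\<theta> a) k * y =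
        fps_nth (\<theta> (a * y)) k - (\<Sum>i<k. fps_nth (\<theta> a) i * fps_nth (\<theta> y) (k - i))"
      by (simp add: \<theta>(3))
  qed
qed

text \<open>Only coefficients at or above the degree are computed. This avoids binomial
  coefficients, which could vanish in positive characteristic.\<close>

lemma fps_linear_power_nth:
  fixes a b :: "'a::comm_ring_1"
  assumes "m \<le> k"
  shows "fps_nth ((fps_const a + fps_const b * fps_X) ^ m) k = (if m = k then b ^ k else 0)"
  using assms
proof (induction m arbitrary: k)
  case 0
  then show ?case by auto
next
  case (Suc m)
  let ?s = "fps_const a + fps_const b * fps_X"
  obtain l where k: "k = Suc l" "m \<le> l" using Suc.prems by (cases k) auto
  have "?s ^ Suc m = fps_const a * ?s ^ m + fps_const b * (fps_X * ?s ^ m)"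
    by (simp add: algebra_simps)
  then have "fps_nth (?s ^ Suc m) k = a * fps_nth (?s ^ m) k + b * fps_nth (?s ^ m) l"
    by (simp add: k(1) del: power_Suc)
  then show ?case using Suc.IH[of k] Suc.IH[of l] k by simp
qed

section \<open>Saturation at the minor\<close>

context jacobi_chart
begin

context
  fixes I assumes I: "ideal I (diffop_ring \<iota>)" and I_nz: "I \<noteq> {\<lambda>y. 0}"
begin

text \<open>The saturation at \<Delta> of the ideal of elements whose multiplication operators lie
  in \<open>I\<close>. Factors \<Delta> can be cancelled in it although \<Delta> need not be a
  unit.\<close>

definition minor_sat :: "'a set" where
  "minor_sat = {a. \<exists>N. (\<lambda>y. \<Delta> ^ N * a * y) \<in> I}"

lemma mult_ideal:
  "(\<lambda>y. 0 * y) \<in> I" "(\<lambda>y. a * y) \<in> I \<Longrightarrow> (\<lambda>y. b * y) \<in> I \<Longrightarrow> (\<lambda>y. (a + b) * y) \<in> I"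
  "(\<lambda>y. a * y) \<in> I \<Longrightarrow> (\<lambda>y. (z * a) * y) \<in> I"
  using ideal_diffop_ideal_mult_ops[OF I] unfolding ideal_type_ring_iff by blast+

lemma mult_ideal_sum: "(\<And>i. i \<in> A \<Longrightarrow> (\<lambda>y. g i * y) \<in> I) \<Longrightarrow> (\<lambda>y. (\<Sum>i\<in>A. g i) * y) \<in> I"
proof (induction A rule: infinite_finite_induct)
  case (insert a A)
  have "(\<lambda>y. (g a + (\<Sum>i\<in>A. g i)) * y) \<in> I" using insert by (intro mult_ideal) auto
  then show ?case by (rule mem_congI) (simp add: insert.hyps)
qed (use mult_ideal(1) in \<open>simp_all only: sum.infinite sum.empty not_False_eq_True\<close>)

lemma minor_sat_mult: "a \<in> minor_sat \<Longrightarrow> z * a \<in> minor_sat"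
proof -
  assume "a \<in> minor_sat"
  then obtain N where "(\<lambda>y. \<Delta> ^ N * a * y) \<in> I" by (auto simp: minor_sat_def)
  then have "(\<lambda>y. (z * (\<Delta> ^ N * a)) * y) \<in> I" by (rule mult_ideal)
  then have "(\<lambda>y. \<Delta> ^ N * (z * a) * y) \<in> I" by (rule mem_congI) (simp add: mult_ac)
  then show ?thesis unfolding minor_sat_def by blast
qed

lemma minor_sat_cancel: "\<Delta> ^ k * a \<in> minor_sat \<Longrightarrow> a \<in> minor_sat"
proof -
  assume "\<Delta> ^ k * a \<in> minor_sat"
  then obtain N where "(\<lambda>y. \<Delta> ^ N * (\<Delta> ^ k * a) * y) \<in> I" by (auto simp: minor_sat_def)
  then have "(\<lambda>y. \<Delta> ^ (N + k) * a * y) \<in> I" by (rule mem_congI) (simp add: power_add mult_ac)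
  then show ?thesis unfolding minor_sat_def by blast
qed

text \<open>Since \<theta> \<Delta> = \<Delta> (1 + e) with 1 + e invertible, \<Delta>^N \<theta>(a)
  is \<theta>(\<Delta>^N a) times a power series. Its coefficients are therefore combinations of
  coefficients of \<theta>(\<Delta>^N a), which lie in the ideal.\<close>

lemma minor_sat_deformation:
  assumes \<theta>: "comm_ring_hom \<theta>" "\<And>c. \<theta> (\<iota> c) = fps_const (\<iota> c)" "\<And>y. fps_nth (\<theta> y) 0 = y"
    and dvd: "fps_const \<Delta> dvd \<theta> \<Delta> - fps_const \<Delta>" and a: "a \<in> minor_sat"
  shows "fps_nth (\<theta> a) k \<in> minor_sat"
proof -
  interpret \<theta>: comm_ring_hom \<theta> by (rule \<theta>)
  obtain N where N: "(\<lambda>y. \<Delta> ^ N * a * y) \<in> I" using a by (auto simp: minor_sat_def)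
  obtain e where e: "\<theta> \<Delta> - fps_const \<Delta> = fps_const \<Delta> * e" using dvd by (rule dvdE)
  \<comment> \<open>The constant terms give \<Delta> e_0 = 0, and \<Delta> can be cancelled in a
    domain.\<close>
  have "fps_nth e 0 = 0"
    using arg_cong[OF e, of "\<lambda>s. fps_nth s 0"] minor_nz by (simp add: \<theta>(3))
  then obtain v where v: "(1 + e) * v = 1"
    using fps_right_inverse[of "1 + e" 1] by auto
  have "\<theta> \<Delta> * v = fps_const \<Delta> * ((1 + e) * v)" using e by (simp add: algebra_simps)
  then have \<Delta>v: "\<theta> \<Delta> * v = fps_const \<Delta>" using v by simp
  have "\<theta> (\<Delta> ^ N * a) * v ^ N = (\<theta> \<Delta> * v) ^ N * \<theta> a"
    by (simp add: \<theta>.hom_mult \<theta>.hom_power power_mult_distrib mult_ac)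
  also have "\<dots> = fps_const (\<Delta> ^ N) * \<theta> a" unfolding \<Delta>v by simp
  finally have "\<Delta> ^ N * fps_nth (\<theta> a) k = fps_nth (\<theta> (\<Delta> ^ N * a) * v ^ N) k" by simp
  also have "\<dots> = (\<Sum>i=0..k. fps_nth (v ^ N) (k - i) * fps_nth (\<theta> (\<Delta> ^ N * a)) i)"
    unfolding fps_mult_nth by (intro sum.cong refl) (rule mult.commute)
  finally have eq: "\<Delta> ^ N * fps_nth (\<theta> a) k = (\<Sum>i=0..k. fps_nth (v ^ N) (k - i) * fps_nth (\<theta> (\<Delta> ^ N * a)) i)" .
  have "(\<lambda>y. \<Delta> ^ N * fps_nth (\<theta> a) k * y) \<in> I"
    unfolding eq by (intro mult_ideal_sum mult_ideal diffop_ideal_deformation_stable[OF \<theta> I N])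
  then show ?thesis unfolding minor_sat_def by blast
qed

text \<open>The coefficient of the highest power of one variable is extracted by a deformation.\<close>
lemma minor_sat_peel:
  assumes "finite W" "W \<subseteq> Y" "g \<in> polys W" "g \<noteq> 0" "ev g \<in> minor_sat"
  shows "1 \<in> minor_sat"
  using assms
proof (induction W arbitrary: g)
  case empty
  have "lookup g \<alpha> = lookup (cst (lookup g 0)) \<alpha>" for \<alpha>
  proof (cases "\<alpha> \<in> keys g")
    case True
    then have "keys \<alpha> = {}" using empty by (auto simp: polys_over_def)
    then show ?thesis by (simp add: cst_def keys_eq_empty)
  next
    case False
    then show ?thesis by (auto simp: cst_def lookup_single when_def in_keys_iff)
  qed
  then have g: "g = cst (lookup g 0)" by (intro poly_mapping_eqI) blast
  define c where "c = lookup g 0"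
  have "c \<noteq> 0" using g empty(3) by (auto simp: c_def cst_def)
  have "ev g = \<iota> c" using g evalp_cst[OF hom] unfolding c_def by metis
  then have "\<iota> (inverse c) * \<iota> c \<in> minor_sat" using empty(4) minor_sat_mult by simp
  moreover have "\<iota> (inverse c) * \<iota> c = 1" using \<open>c \<noteq> 0\<close> by (simp add: \<iota>.hom_mult[symmetric])
  ultimately show ?case by simp
next
  case (insert j W)
  have j: "j \<in> Y" using insert.prems by simp
  obtain \<theta> where \<theta>: "comm_ring_hom \<theta>" "\<And>c. \<theta> (\<iota> c) = fps_const (\<iota> c)" "\<And>y. fps_nth (\<theta> y) 0 = y"
    "\<And>y. fps_const \<Delta> dvd \<theta> y - fps_const y"
    "\<And>k. k \<in> Y \<Longrightarrow> \<theta> (x k) = fps_const (x k) + (if k = j then fps_const (\<Delta> ^ 2) * fps_X else 0)"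
    using shift_hom[OF j] by blast
  interpret fc: comm_ring_hom "fps_const :: 'a \<Rightarrow> 'a fps" by (rule fps_const_hom)
  define k where "k = Max ((\<lambda>\<alpha>. lookup \<alpha> j) ` keys g)"
  have kne: "keys g \<noteq> {}" using insert.prems(3) by (simp add: keys_eq_empty)
  have kmax: "lookup \<alpha> j \<le> k" if "\<alpha> \<in> keys g" for \<alpha>
    unfolding k_def using that by (intro Max_ge) auto
  have "k \<in> (\<lambda>\<alpha>. lookup \<alpha> j) ` keys g"
    unfolding k_def using kne by (intro Max_in) auto
  then obtain \<alpha>0 where \<alpha>0: "\<alpha>0 \<in> keys g" "lookup \<alpha>0 j = k" by blast
  define del where "del = (\<lambda>\<alpha> :: nat \<Rightarrow>\<^sub>0 nat. \<alpha> - single j (lookup \<alpha> j))"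
  have lookup_del: "lookup (del \<alpha>) i = (if i = j then 0 else lookup \<alpha> i)" for \<alpha> i
    by (simp add: del_def lookup_minus lookup_single when_def)
  have keysW: "keys \<alpha> \<subseteq> insert j W" if "\<alpha> \<in> keys g" for \<alpha>
    using that insert.prems(2) by (auto simp: polys_over_def)
  have keys_del: "keys (del \<alpha>) \<subseteq> W" if "\<alpha> \<in> keys g" for \<alpha>
  proof
    fix i assume "i \<in> keys (del \<alpha>)"
    then have "i \<noteq> j" "i \<in> keys \<alpha>"
      by (auto simp: in_keys_iff lookup_del split: if_splits)
    then show "i \<in> W" using keysW[OF that] by blast
  qed
  define K where "K = {\<alpha> \<in> keys g. lookup \<alpha> j = k}"
  have finK: "finite K" by (simp add: K_def)
  \<comment> \<open>The coefficient of the k-th power of variable j, where k is the degree of g in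
    that variable. Dropping the exponent of j is injective on \<open>K\<close>, so no terms cancel
    and h is nonzero.\<close>
  define h where "h = (\<Sum>\<alpha>\<in>K. single (del \<alpha>) (lookup g \<alpha>))"
  have h: "h \<in> polys W" unfolding h_def
    using keys_del by (intro P_closed(6) polys_over_single[OF subring_set_UNIV]) (auto simp: K_def)
  have "h \<noteq> 0"
  proof
    assume "h = 0"
    have inj: "\<alpha> = \<alpha>0" if "\<alpha> \<in> K" "del \<alpha> = del \<alpha>0" for \<alpha>
    proof (rule poly_mapping_eqI)
      fix i
      show "lookup \<alpha> i = lookup \<alpha>0 i"
        using that(1) \<alpha>0(2) arg_cong[OF that(2), of "\<lambda>\<beta>. lookup \<beta> i"]
        by (cases "i = j") (auto simp: lookup_del K_def)
    qed
    have "lookup h (del \<alpha>0) = (\<Sum>\<alpha>\<in>K. if \<alpha> = \<alpha>0 then lookup g \<alpha> else 0)"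
      unfolding h_def lookup_sum by (intro sum.cong refl) (auto simp: lookup_single when_def dest: inj)
    also have "\<dots> = lookup g \<alpha>0" using \<alpha>0 finK by (simp add: K_def)
    finally show False using \<open>h = 0\<close> \<alpha>0(1) by (simp add: in_keys_iff)
  qed
  \<comment> \<open>The other free coordinates are fixed by \<theta> and x_j is shifted by
    \<Delta>^2 times \<open>fps_X\<close>. So monomials of degree below k in variable j do not reach
    \<open>fps_X ^ k\<close>, and those of degree k contribute the factor \<Delta>^(2k).\<close>
  have mon: "fps_nth (fps_const c * mon (\<lambda>i. \<theta> (x i)) \<alpha>) k =
      (if lookup \<alpha> j = k then \<Delta> ^ (2 * k) * (c * mon x (del \<alpha>)) else 0)"
    if \<alpha>: "\<alpha> \<in> keys g" for \<alpha> c
  proof -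
    have "mon (\<lambda>i. \<theta> (x i)) \<alpha> = (\<Prod>i\<in>insert j W. \<theta> (x i) ^ lookup \<alpha> i)"
      using keysW[OF \<alpha>] insert.hyps by (intro mon_superset) auto
    also have "\<dots> = \<theta> (x j) ^ lookup \<alpha> j * (\<Prod>i\<in>W. \<theta> (x i) ^ lookup \<alpha> i)"
      using insert.hyps by simp
    also have "(\<Prod>i\<in>W. \<theta> (x i) ^ lookup \<alpha> i) = (\<Prod>i\<in>W. fps_const (x i ^ lookup (del \<alpha>) i))"
    proof (rule prod.cong[OF refl])
      fix i assume "i \<in> W"
      then have "i \<in> Y" "i \<noteq> j" using insert.prems(1) insert.hyps by auto
      then show "\<theta> (x i) ^ lookup \<alpha> i = fps_const (x i ^ lookup (del \<alpha>) i)"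
        by (simp add: \<theta>(5) lookup_del)
    qed
    also have "\<dots> = fps_const (mon x (del \<alpha>))"
      unfolding fc.hom_prod[symmetric] using keys_del[OF \<alpha>] insert.hyps by (subst mon_superset[of W]) auto
    also have "\<theta> (x j) = fps_const (x j) + fps_const (\<Delta> ^ 2) * fps_X" using \<theta>(5)[OF j] by simp
    finally have "fps_const c * mon (\<lambda>i. \<theta> (x i)) \<alpha> = fps_const (c * mon x (del \<alpha>)) *
        (fps_const (x j) + fps_const (\<Delta> ^ 2) * fps_X) ^ lookup \<alpha> j"
      by (simp add: fc.hom_mult mult_ac del: fps_const_mult fps_const_power)
    then show ?thesis
      using fps_linear_power_nth[OF kmax[OF \<alpha>], of "x j" "\<Delta> ^ 2"]
      by (simp add: power_mult[symmetric] mult_ac del: fps_const_power)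
  qed
  have "\<theta> (ev g) = evalp (\<lambda>c. fps_const (\<iota> c)) (\<lambda>i. \<theta> (x i)) g"
    by (subst hom_evalp[OF hom \<theta>(1)]) (simp add: \<theta>(2))
  then have "fps_nth (\<theta> (ev g)) k = (\<Sum>\<alpha>\<in>keys g.
      fps_nth (fps_const (\<iota> (lookup g \<alpha>)) * mon (\<lambda>i. \<theta> (x i)) \<alpha>) k)"
    by (simp only: evalp_mon fps_sum_nth)
  also have "\<dots> = (\<Sum>\<alpha>\<in>keys g. if lookup \<alpha> j = k then
      \<Delta> ^ (2 * k) * (\<iota> (lookup g \<alpha>) * mon x (del \<alpha>)) else 0)"
    by (intro sum.cong refl mon)
  also have "\<dots> = (\<Sum>\<alpha>\<in>K. \<Delta> ^ (2 * k) * (\<iota> (lookup g \<alpha>) * mon x (del \<alpha>)))"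
    unfolding K_def by (subst sum.inter_filter) simp_all
  also have "\<dots> = \<Delta> ^ (2 * k) * ev h"
    by (simp add: h_def evalp_sum[OF hom] evalp_single[OF hom] sum_distrib_left)
  finally have "\<Delta> ^ (2 * k) * ev h \<in> minor_sat"
    using minor_sat_deformation[OF \<theta>(1-4) insert.prems(4), of k] by simp
  then have "ev h \<in> minor_sat" by (rule minor_sat_cancel)
  then show ?case using insert.IH h \<open>h \<noteq> 0\<close> insert.prems(1) by blast
qed

lemma minor_power_in_ideal: "\<exists>N. (\<lambda>y. \<Delta> ^ N * y) \<in> I"
proof -
  obtain a where a: "a \<noteq> 0" "(\<lambda>y. a * y) \<in> I" using diffop_ideal_has_mult_op[OF I I_nz] by blast
  obtain g where g: "g \<in> polys Y" "ev g \<noteq> 0" "a dvd ev g"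
    using multiple_in_free_coordinates[OF a(1)] by blast
  obtain z where z: "ev g = a * z" using g(3) by (rule dvdE)
  have "(\<lambda>y. (z * a) * y) \<in> I" using a(2) by (rule mult_ideal)
  then have "(\<lambda>y. \<Delta> ^ 0 * ev g * y) \<in> I" by (rule mem_congI) (simp add: z mult.commute)
  then have "ev g \<in> minor_sat" unfolding minor_sat_def by blast
  moreover have "g \<noteq> 0" using g(2) by auto
  ultimately have "1 \<in> minor_sat" using minor_sat_peel[of Y g] g(1) by (auto simp: Y_def)
  then obtain N where "(\<lambda>y. \<Delta> ^ N * 1 * y) \<in> I" unfolding minor_sat_def by blast
  then have "(\<lambda>y. \<Delta> ^ N * y) \<in> I" by (rule mem_congI) simp
  then show ?thesis by blast
qed

end

end

theorem theorem1p2: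
  fixes \<iota> :: "'k::field \<Rightarrow> 'a::idom"
    and n m :: nat and x :: "nat \<Rightarrow> 'a" and f :: "nat \<Rightarrow> 'k mpoly"
  assumes "perfect_field TYPE('k)"
    and "\<iota> 1 = 1" and "\<And>a b. \<iota> (a + b) = \<iota> a + \<iota> b" and "\<And>a b. \<iota> (a * b) = \<iota> a * \<iota> b"
    and "ess_fin_presentation \<iota> n x m f"
  shows "simple_ring (diffop_ring \<iota>) \<longleftrightarrow>
    (\<forall>M. maximalideal M type_ring \<and> jacobian_ideal \<iota> n x m f \<subseteq> M \<longrightarrow>
       simple_ring (diffop_loc \<iota> M))"
proof
  assume "simple_ring (diffop_ring \<iota>)"
  then show "\<forall>M. maximalideal M type_ring \<and> jacobian_ideal \<iota> n x m f \<subseteq> M \<longrightarrow> simple_ring (diffop_loc \<iota> M)"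
    using simple_diffop_loc by blast
next
  assume loc: "\<forall>M. maximalideal M type_ring \<and> jacobian_ideal \<iota> n x m f \<subseteq> M \<longrightarrow> simple_ring (diffop_loc \<iota> M)"
  show "simple_ring (diffop_ring \<iota>)"
  proof (rule simple_diffop_ringI)
    fix M I assume M: "maximalideal M (type_ring :: 'a ring)"
      and I: "ideal I (diffop_ring \<iota>)" "I \<noteq> {\<lambda>y. 0}"
    show "\<exists>s. s \<notin> M \<and> (\<lambda>y. s * y) \<in> I"
    proof (cases "jacobian_ideal \<iota> n x m f \<subseteq> M")
      case True
      then show ?thesis using simple_diffop_loc_meets[OF M _ I] loc M by blast
    next
      case False
      define r where "r = mat_rank m n (jacobi \<iota> x f)"
      have "\<not> minors m n (jacobi \<iota> x f) r \<subseteq> M"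
        using False ring.genideal_minimal[OF cring.axioms(1)[OF cring_type_ring] maximalideal.axioms(1)[OF M]]
        unfolding jacobian_ideal_def r_def by blast
      then obtain \<rho> \<gamma> where \<rho>: "\<rho> ` {..<r} \<subseteq> {..<m}" and \<gamma>: "strict_mono_on {..<r} \<gamma>" "\<gamma> ` {..<r} \<subseteq> {..<n}"
        and d: "det (submat r (jacobi \<iota> x f) \<rho> \<gamma>) \<notin> M"
        unfolding minors_def submat_def by blast
      interpret jacobi_chart \<iota> n m x f \<rho> \<gamma> r
      proof (intro jacobi_chart.intro)
        show "comm_ring_hom \<iota>" using assms(2-4) by (rule comm_ring_homI)
        show "inj_on \<gamma> {..<r}" using \<gamma>(1) by (rule strict_mono_on_imp_inj_on)
        show "det (submat r (jacobi \<iota> x f) \<rho> \<gamma>) \<noteq> 0" using d maximalideal_type_ringD(2)[OF M] by auto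
      qed (use assms r_def \<rho> \<gamma> in auto)
      obtain N where "(\<lambda>y. det (submat r (jacobi \<iota> x f) \<rho> \<gamma>) ^ N * y) \<in> I"
        using minor_power_in_ideal[OF I] by blast
      then show ?thesis using d maximalideal_type_ringD(6)[OF M] by blast
    qed
  qed
qed

end
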